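(* Let $H$ be a Hopf algebra over $\mathbb{C}$ with invertible antipode, let $C$ be a left $H$-module coalgebra, and let $M$ be a ${}_CH$-SAYD module. Then $\mathbb{CM}^*(C,M)$ and $C^*_H(C,M)$ are isomorphic as cocyclic modules.
   Context: Work over $\mathbb{C}$. $S$ is the antipode of $H$, $\varepsilon$ denotes counits. Sweedler notation: $\Delta(h)=h^{(1)}\otimes h^{(2)}$ and similarly for iterated coproducts and for $C$; left coactions are written $m\mapsto m_{\langle -1\rangle}\otimes m_{\langle 0\rangle}$. A left $H$-module coalgebra is a coalgebra $C$ with a left $H$-action such that $\Delta(hc)=h^{(1)}c^{(1)}\otimes h^{(2)}c^{(2)}$ and $\varepsilon(hc)=\varepsilon(h)\varepsilon(c)$. $H$ acts diagonally on $C^{\otimes n}$. ${}_CH$-SAYD module: a vector space $M$ that is a right $H$-module and a left $H$-comodule such that for all $m\in M$, $h\in H$, $c\in C$ and $\tilde d\in C^{\otimes n}$ ($n\ge1$): (${}_CH$-AYD) $(mh)_{\langle -1\rangle}c\otimes (mh)_{\langle 0\rangle}=S(h^{(3)})m_{\langle -1\rangle}h^{(1)}c\otimes m_{\langle 0\rangle}h^{(2)}$; (${}_CH$-stability) $m_{\langle 0\rangle}\otimes_H m_{\langle -1\rangle}\tilde d=m\otimes_H\tilde d$ in $M\otimes_H C^{\otimes n}$. Operators on $C^n(C,M)=M\otimes C^{\otimes(n+1)}$: $\partial_i(m\otimes c_0\otimes\dots\otimes c_n)=m\otimes c_0\otimes\dots\otimes c_i^{(1)}\otimes c_i^{(2)}\otimes\dots\otimes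 c_n$ for $0\le i\le n$; $\partial_{n+1}(m\otimes c_0\otimes\dots\otimes c_n)=m_{\langle 0\rangle}\otimes c_0^{(2)}\otimes c_1\otimes\dots\otimes c_n\otimes m_{\langle -1\rangle}c_0^{(1)}$; $\sigma_i(m\otimes c_0\otimes\dots\otimes c_n)=m\otimes c_0\otimes\dots\otimes\varepsilon(c_{i+1})\otimes\dots\otimes c_n$ for $0\le i\le n-1$; $\tau=\tau_n$: $\tau_n(m\otimes c_0\otimes\dots\otimes c_n)=m_{\langle 0\rangle}\otimes c_1\otimes\dots\otimes c_n\otimes m_{\langle -1\rangle}c_0$. $C^n_H(C,M)=M\otimes_H C^{\otimes(n+1)}$, a cocyclic module with the operators induced by $\partial_i,\sigma_i,\tau_n$ (these descend when $M$ is a ${}_CH$-SAYD module). Bialgebra cyclic cohomology complex (Kaygun). For $g\in H$ let $L_g$ be the operator on $C^n(C,M)$ defined by $L_g(m\otimes c_0\otimes\dots\otimes c_n)=mS(g^{(1)})\otimes g^{(2)}c_0\otimes\dots\otimes g^{(n+2)}c_n$; this is a left $H$-action. Let $W^n(C,M)\subseteq C^n(C,M)$ be the linear span of the images $[L_g,\tau^i](C^n(C,M))$, $g\in H$, $i\in\mathbb{Z}^+$, where $[L_g,\tau^i]=L_g\tau^i-\tau^iL_g$. $W^*(C,M)$ is stable under the operators $\partial_i,\sigma_i,\tau$ and under the $H$-action; the quotient $\mathbb{PCM}^n(C,M)=C^n(C,M)/W^n(C,M)$ carries the induced operators and induced left $H$-action. Finally $\mathbb{CM}^n(C,M)=\mathbb{C}\otimes_H\mathbb{PCM}^n(C,M)$,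 where $\mathbb{C}$ is the trivial right $H$-module (via $\varepsilon$), with the induced operators. An isomorphism of cocyclic modules is a degreewise linear isomorphism commuting with all $\partial_i,\sigma_i,\tau_n$. *)

theory Defs
  imports Complex_Main "HOL-Algebra.Module" "HOL-Algebra.AbelCoset"
begin

section \<open>Complex vector spaces, quotients and tensor products\<close>

text \<open>
  Vector spaces are \<^locale>\<open>module\<close>s over the ring \<open>cplx\<close>.  It has the record type of a module, so
  that it also serves as the one-dimensional vector space.  The fields \<^const>\<open>mult\<close> and
  \<^const>\<open>one\<close> of a module record are meaningless for a mere vector space and are left undefined in
  the constructions below; the record of a Hopf algebra uses them for its ring structure.
\<close>

definition cplx :: "(complex, complex) module" where
  "cplx = \<lparr>carrier = UNIV, mult = (*), one = 1, zero = 0, add = (+), smult = (*)\<rparr>"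

definition linear_map ::
    "(complex, 'v, 'x) module_scheme \<Rightarrow> (complex, 'w, 'y) module_scheme \<Rightarrow> ('v \<Rightarrow> 'w) \<Rightarrow> bool" where
  "linear_map V W f \<longleftrightarrow>
     (\<forall>v\<in>carrier V. f v \<in> carrier W) \<and>
     (\<forall>v\<in>carrier V. \<forall>v'\<in>carrier V. f (v \<oplus>\<^bsub>V\<^esub> v') = f v \<oplus>\<^bsub>W\<^esub> f v') \<and>
     (\<forall>a. \<forall>v\<in>carrier V. f (a \<odot>\<^bsub>V\<^esub> v) = a \<odot>\<^bsub>W\<^esub> f v)"

definition lin_span :: "(complex, 'v, 'x) module_scheme \<Rightarrow> 'v set \<Rightarrow> 'v set" where
  "lin_span V A = \<Inter>{U. submodule U cplx V \<and> A \<subseteq> U}"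

definition quot_space ::
    "(complex, 'v, 'x) module_scheme \<Rightarrow> 'v set \<Rightarrow> (complex, 'v set) module" where
  "quot_space V U =
     \<lparr>carrier = a_rcosets\<^bsub>V\<^esub> U, mult = undefined, one = undefined, zero = U, add = set_add V,
      smult = (\<lambda>a X. \<Union>x\<in>X. U +>\<^bsub>V\<^esub> (a \<odot>\<^bsub>V\<^esub> x))\<rparr>"

text \<open>
  The operator with values in \<open>V / U\<close> induced by an operator \<open>f\<close> with values in \<open>V\<close>:
  the coset of \<open>x\<close> is sent to the coset of \<open>f x\<close>.
\<close>

definition induced ::
    "(complex, 'v, 'x) module_scheme \<Rightarrow> 'v set \<Rightarrow> ('u \<Rightarrow> 'v) \<Rightarrow> 'u set \<Rightarrow> 'v set" where
  "induced V U f X = (\<Union>x\<in>X. U +>\<^bsub>V\<^esub> f x)"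

definition free_space :: "'b set \<Rightarrow> (complex, 'b \<Rightarrow> complex) module" where
  "free_space B =
     \<lparr>carrier = {f. finite {b. f b \<noteq> 0} \<and> {b. f b \<noteq> 0} \<subseteq> B}, mult = undefined, one = undefined,
      zero = (\<lambda>b. 0), add = (\<lambda>f g b. f b + g b), smult = (\<lambda>a f b. a * f b)\<rparr>"

definition delta :: "'b \<Rightarrow> 'b \<Rightarrow> complex" where
  "delta b = (\<lambda>b'. if b' = b then 1 else 0)"

definition tensor_relations ::
    "(complex, 'v, 'x) module_scheme \<Rightarrow> (complex, 'w, 'y) module_scheme \<Rightarrow> ('v \<times> 'w \<Rightarrow> complex) set"
  where
  "tensor_relations V W = lin_span (free_space (carrier V \<times> carrier W))
     ({\<lambda>p. delta (v \<oplus>\<^bsub>V\<^esub> v', w) p - delta (v, w) p - delta (v', w) p | v v' w.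
         v \<in> carrier V \<and> v' \<in> carrier V \<and> w \<in> carrier W} \<union>
      {\<lambda>p. delta (v, w \<oplus>\<^bsub>W\<^esub> w') p - delta (v, w) p - delta (v, w') p | v w w'.
         v \<in> carrier V \<and> w \<in> carrier W \<and> w' \<in> carrier W} \<union>
      {\<lambda>p. delta (a \<odot>\<^bsub>V\<^esub> v, w) p - a * delta (v, w) p | a v w. v \<in> carrier V \<and> w \<in> carrier W} \<union>
      {\<lambda>p. delta (v, a \<odot>\<^bsub>W\<^esub> w) p - a * delta (v, w) p | a v w. v \<in> carrier V \<and> w \<in> carrier W})"

definition tensor ::
    "(complex, 'v, 'x) module_scheme \<Rightarrow> (complex, 'w, 'y) module_scheme \<Rightarrow>
     (complex, ('v \<times> 'w \<Rightarrow> complex) set) module" where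
  "tensor V W = quot_space (free_space (carrier V \<times> carrier W)) (tensor_relations V W)"

definition pure_tensor ::
    "(complex, 'v, 'x) module_scheme \<Rightarrow> (complex, 'w, 'y) module_scheme \<Rightarrow>
     'v \<Rightarrow> 'w \<Rightarrow> ('v \<times> 'w \<Rightarrow> complex) set" where
  "pure_tensor V W v w =
     tensor_relations V W +>\<^bsub>free_space (carrier V \<times> carrier W)\<^esub> delta (v, w)"

text \<open>
  The \<open>n\<close>-fold tensor power, generated by the lists \<open>[c\<^sub>1, \<dots>, c\<^sub>n]\<close>, which stand for
  \<open>c\<^sub>1 \<otimes> \<dots> \<otimes> c\<^sub>n\<close>, modulo multilinearity.
\<close>

definition power_lists :: "(complex, 'v, 'x) module_scheme \<Rightarrow> nat \<Rightarrow> 'v list set" where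
  "power_lists V n = {vs. length vs = n \<and> set vs \<subseteq> carrier V}"

definition power_relations ::
    "(complex, 'v, 'x) module_scheme \<Rightarrow> nat \<Rightarrow> ('v list \<Rightarrow> complex) set" where
  "power_relations V n = lin_span (free_space (power_lists V n))
     ({\<lambda>p. delta (vs[i := v \<oplus>\<^bsub>V\<^esub> v']) p - delta (vs[i := v]) p - delta (vs[i := v']) p | vs i v v'.
         vs \<in> power_lists V n \<and> i < n \<and> v \<in> carrier V \<and> v' \<in> carrier V} \<union>
      {\<lambda>p. delta (vs[i := a \<odot>\<^bsub>V\<^esub> v]) p - a * delta (vs[i := v]) p | vs i a v.
         vs \<in> power_lists V n \<and> i < n \<and> v \<in> carrier V})"

definition tensor_power ::
    "(complex, 'v, 'x) module_scheme \<Rightarrow> nat \<Rightarrow> (complex, ('v list \<Rightarrow> complex) set) module" where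
  "tensor_power V n = quot_space (free_space (power_lists V n)) (power_relations V n)"

definition pure_power ::
    "(complex, 'v, 'x) module_scheme \<Rightarrow> 'v list \<Rightarrow> ('v list \<Rightarrow> complex) set" where
  "pure_power V vs =
     power_relations V (length vs) +>\<^bsub>free_space (power_lists V (length vs))\<^esub> delta vs"

text \<open>
  \<open>lift Z t f\<close> is the value at \<open>t\<close> of the linear map into \<open>Z\<close> with prescribed values \<open>f\<close> on the pure
  tensors: if \<open>t = \<Sum> r\<^sub>p p\<close>, then \<open>lift Z t f = \<Sum> r\<^sub>p f(p)\<close>.  It is only used for \<open>f\<close> that are
  multilinear, in which case the choice of the representative \<open>r\<close> of the coset \<open>t\<close> is irrelevant.
  It renders Sweedler notation: the sum over \<open>h\<^sup>(\<^sup>1\<^sup>) \<otimes> h\<^sup>(\<^sup>2\<^sup>)\<close> of \<open>F(h\<^sup>(\<^sup>1\<^sup>), h\<^sup>(\<^sup>2\<^sup>))\<close> is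
  \<open>lift Z (comult H h) (\<lambda>(h\<^sub>1, h\<^sub>2). F h\<^sub>1 h\<^sub>2)\<close>.
\<close>

definition lift ::
    "(complex, 'z, 'x) module_scheme \<Rightarrow> ('b \<Rightarrow> complex) set \<Rightarrow> ('b \<Rightarrow> 'z) \<Rightarrow> 'z" where
  "lift Z t f =
     (let r = (SOME r. r \<in> t) in finsum Z (\<lambda>b. r b \<odot>\<^bsub>Z\<^esub> f b) {b. r b \<noteq> 0})"


section \<open>Hopf algebras, module coalgebras, comodules\<close>

record 'c coalgebra = "(complex, 'c) module" +
  comult :: "'c \<Rightarrow> ('c \<times> 'c \<Rightarrow> complex) set"
  counit :: "'c \<Rightarrow> complex"

locale coalgebra =
  fixes C :: "('c, 'x) coalgebra_scheme"
  assumes vector_space: "module cplx C"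
    and comult_linear: "linear_map C (tensor C C) (comult C)"
    and counit_linear: "linear_map C cplx (counit C)"
    and coassoc: "c \<in> carrier C \<Longrightarrow>
      lift (tensor_power C 3) (comult C c) (\<lambda>(a, b).
        lift (tensor_power C 3) (comult C a) (\<lambda>(a1, a2). pure_power C [a1, a2, b])) =
      lift (tensor_power C 3) (comult C c) (\<lambda>(a, b).
        lift (tensor_power C 3) (comult C b) (\<lambda>(b1, b2). pure_power C [a, b1, b2]))"
    and counit_left: "c \<in> carrier C \<Longrightarrow> lift C (comult C c) (\<lambda>(a, b). counit C a \<odot>\<^bsub>C\<^esub> b) = c"
    and counit_right: "c \<in> carrier C \<Longrightarrow> lift C (comult C c) (\<lambda>(a, b). counit C b \<odot>\<^bsub>C\<^esub> a) = c"

record 'h hopf_algebra = "'h coalgebra" +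
  antipode :: "'h \<Rightarrow> 'h"

locale hopf_algebra =
  fixes H :: "('h, 'x) hopf_algebra_scheme"
  assumes ring: "ring H"
    and coalgebra: "coalgebra H"
    and smult_mult_left: "h \<in> carrier H \<Longrightarrow> k \<in> carrier H \<Longrightarrow>
      a \<odot>\<^bsub>H\<^esub> (h \<otimes>\<^bsub>H\<^esub> k) = (a \<odot>\<^bsub>H\<^esub> h) \<otimes>\<^bsub>H\<^esub> k"
    and smult_mult_right: "h \<in> carrier H \<Longrightarrow> k \<in> carrier H \<Longrightarrow>
      a \<odot>\<^bsub>H\<^esub> (h \<otimes>\<^bsub>H\<^esub> k) = h \<otimes>\<^bsub>H\<^esub> (a \<odot>\<^bsub>H\<^esub> k)"
    and comult_mult: "h \<in> carrier H \<Longrightarrow> k \<in> carrier H \<Longrightarrow>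
      comult H (h \<otimes>\<^bsub>H\<^esub> k) =
      lift (tensor H H) (comult H h) (\<lambda>(h1, h2).
        lift (tensor H H) (comult H k) (\<lambda>(k1, k2). pure_tensor H H (h1 \<otimes>\<^bsub>H\<^esub> k1) (h2 \<otimes>\<^bsub>H\<^esub> k2)))"
    and comult_one: "comult H \<one>\<^bsub>H\<^esub> = pure_tensor H H \<one>\<^bsub>H\<^esub> \<one>\<^bsub>H\<^esub>"
    and counit_mult: "h \<in> carrier H \<Longrightarrow> k \<in> carrier H \<Longrightarrow>
      counit H (h \<otimes>\<^bsub>H\<^esub> k) = counit H h * counit H k"
    and counit_one: "counit H \<one>\<^bsub>H\<^esub> = 1"
    and antipode_linear: "linear_map H H (antipode H)"
    and antipode_left: "h \<in> carrier H \<Longrightarrow>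
      lift H (comult H h) (\<lambda>(h1, h2). antipode H h1 \<otimes>\<^bsub>H\<^esub> h2) = counit H h \<odot>\<^bsub>H\<^esub> \<one>\<^bsub>H\<^esub>"
    and antipode_right: "h \<in> carrier H \<Longrightarrow>
      lift H (comult H h) (\<lambda>(h1, h2). h1 \<otimes>\<^bsub>H\<^esub> antipode H h2) = counit H h \<odot>\<^bsub>H\<^esub> \<one>\<^bsub>H\<^esub>"

definition invertible_antipode :: "('h, 'x) hopf_algebra_scheme \<Rightarrow> bool" where
  "invertible_antipode H \<longleftrightarrow> bij_betw (antipode H) (carrier H) (carrier H)"

definition left_action ::
    "(complex, 'h, 'x) module_scheme \<Rightarrow> (complex, 'v, 'y) module_scheme \<Rightarrow> ('h \<Rightarrow> 'v \<Rightarrow> 'v) \<Rightarrow> bool"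
  where
  "left_action H V l \<longleftrightarrow>
     (\<forall>h\<in>carrier H. linear_map V V (l h)) \<and>
     (\<forall>v\<in>carrier V. linear_map H V (\<lambda>h. l h v)) \<and>
     (\<forall>h\<in>carrier H. \<forall>k\<in>carrier H. \<forall>v\<in>carrier V. l (h \<otimes>\<^bsub>H\<^esub> k) v = l h (l k v)) \<and>
     (\<forall>v\<in>carrier V. l \<one>\<^bsub>H\<^esub> v = v)"

definition right_action ::
    "(complex, 'h, 'x) module_scheme \<Rightarrow> (complex, 'v, 'y) module_scheme \<Rightarrow> ('v \<Rightarrow> 'h \<Rightarrow> 'v) \<Rightarrow> bool"
  where
  "right_action H V r \<longleftrightarrow>
     (\<forall>h\<in>carrier H. linear_map V V (\<lambda>v. r v h)) \<and>
     (\<forall>v\<in>carrier V. linear_map H V (r v)) \<and>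
     (\<forall>h\<in>carrier H. \<forall>k\<in>carrier H. \<forall>v\<in>carrier V. r v (h \<otimes>\<^bsub>H\<^esub> k) = r (r v h) k) \<and>
     (\<forall>v\<in>carrier V. r v \<one>\<^bsub>H\<^esub> = v)"

record ('h, 'c) module_coalgebra = "'c coalgebra" +
  lact :: "'h \<Rightarrow> 'c \<Rightarrow> 'c"

locale module_coalgebra =
  fixes H :: "('h, 'x) hopf_algebra_scheme"
    and C :: "('h, 'c, 'y) module_coalgebra_scheme"
  assumes coalgebra: "coalgebra C"
    and action: "left_action H C (lact C)"
    and comult_lact: "h \<in> carrier H \<Longrightarrow> c \<in> carrier C \<Longrightarrow>
      comult C (lact C h c) =
      lift (tensor C C) (comult H h) (\<lambda>(h1, h2).
        lift (tensor C C) (comult C c) (\<lambda>(c1, c2). pure_tensor C C (lact C h1 c1) (lact C h2 c2)))"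
    and counit_lact: "h \<in> carrier H \<Longrightarrow> c \<in> carrier C \<Longrightarrow>
      counit C (lact C h c) = counit H h * counit C c"

text \<open>\<open>M \<otimes>\<^sub>H V\<close> for a right \<open>H\<close>-module \<open>M\<close> with action \<open>r\<close> and a left \<open>H\<close>-module \<open>V\<close> with action \<open>l\<close>.\<close>

definition balancing ::
    "(complex, 'h, 'x) module_scheme \<Rightarrow> (complex, 'm, 'y) module_scheme \<Rightarrow> ('m \<Rightarrow> 'h \<Rightarrow> 'm) \<Rightarrow>
     (complex, 'v, 'z) module_scheme \<Rightarrow> ('h \<Rightarrow> 'v \<Rightarrow> 'v) \<Rightarrow> ('m \<times> 'v \<Rightarrow> complex) set set" where
  "balancing H M r V l = lin_span (tensor M V)
     {pure_tensor M V (r m h) v \<ominus>\<^bsub>tensor M V\<^esub> pure_tensor M V m (l h v) | m h v.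
        m \<in> carrier M \<and> h \<in> carrier H \<and> v \<in> carrier V}"

definition tensor_over ::
    "(complex, 'h, 'x) module_scheme \<Rightarrow> (complex, 'm, 'y) module_scheme \<Rightarrow> ('m \<Rightarrow> 'h \<Rightarrow> 'm) \<Rightarrow>
     (complex, 'v, 'z) module_scheme \<Rightarrow> ('h \<Rightarrow> 'v \<Rightarrow> 'v) \<Rightarrow>
     (complex, ('m \<times> 'v \<Rightarrow> complex) set set) module" where
  "tensor_over H M r V l = quot_space (tensor M V) (balancing H M r V l)"

definition pure_tensor_over ::
    "(complex, 'h, 'x) module_scheme \<Rightarrow> (complex, 'm, 'y) module_scheme \<Rightarrow> ('m \<Rightarrow> 'h \<Rightarrow> 'm) \<Rightarrow>
     (complex, 'v, 'z) module_scheme \<Rightarrow> ('h \<Rightarrow> 'v \<Rightarrow> 'v) \<Rightarrow>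
     'm \<Rightarrow> 'v \<Rightarrow> ('m \<times> 'v \<Rightarrow> complex) set set" where
  "pure_tensor_over H M r V l m v =
     balancing H M r V l +>\<^bsub>tensor M V\<^esub> pure_tensor M V m v"

text \<open>\<open>iter_comult H n h\<close> is \<open>h\<^sup>(\<^sup>1\<^sup>) \<otimes> \<dots> \<otimes> h\<^sup>(\<^sup>n\<^sup>+\<^sup>1\<^sup>)\<close> in the \<open>(n+1)\<close>-fold tensor power of \<open>H\<close>.\<close>

primrec iter_comult ::
    "('h, 'x) hopf_algebra_scheme \<Rightarrow> nat \<Rightarrow> 'h \<Rightarrow> ('h list \<Rightarrow> complex) set" where
  "iter_comult H 0 h = pure_power H [h]"
| "iter_comult H (Suc n) h =
     lift (tensor_power H (Suc (Suc n))) (comult H h) (\<lambda>(h1, h2).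
       lift (tensor_power H (Suc (Suc n))) (iter_comult H n h2) (\<lambda>hs. pure_power H (h1 # hs)))"

text \<open>The diagonal action of \<open>H\<close> on the \<open>(n+1)\<close>-fold tensor power of \<open>C\<close>.\<close>

definition diag_act ::
    "('h, 'x) hopf_algebra_scheme \<Rightarrow> ('h, 'c, 'y) module_coalgebra_scheme \<Rightarrow> nat \<Rightarrow>
     'h \<Rightarrow> ('c list \<Rightarrow> complex) set \<Rightarrow> ('c list \<Rightarrow> complex) set" where
  "diag_act H C n h d =
     lift (tensor_power C (Suc n)) d (\<lambda>cs.
       lift (tensor_power C (Suc n)) (iter_comult H n h) (\<lambda>hs.
         pure_power C (map2 (lact C) hs cs)))"

record ('h, 'm) module_comodule = "(complex, 'm) module" +
  ract :: "'m \<Rightarrow> 'h \<Rightarrow> 'm"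
  coact :: "'m \<Rightarrow> ('h \<times> 'm \<Rightarrow> complex) set"

locale left_comodule =
  fixes H :: "('h, 'x) hopf_algebra_scheme"
    and M :: "('h, 'm, 'y) module_comodule_scheme"
  assumes vector_space: "module cplx M"
    and coact_linear: "linear_map M (tensor H M) (coact M)"
    and coact_coassoc: "m \<in> carrier M \<Longrightarrow>
      lift (tensor H (tensor H M)) (coact M m) (\<lambda>(h, m0).
        lift (tensor H (tensor H M)) (comult H h) (\<lambda>(h1, h2).
          pure_tensor H (tensor H M) h1 (pure_tensor H M h2 m0))) =
      lift (tensor H (tensor H M)) (coact M m) (\<lambda>(h, m0).
        pure_tensor H (tensor H M) h (coact M m0))"
    and coact_counit: "m \<in> carrier M \<Longrightarrow>
      lift M (coact M m) (\<lambda>(h, m0). counit H h \<odot>\<^bsub>M\<^esub> m0) = m"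

locale SAYD_module =
  fixes H :: "('h, 'x) hopf_algebra_scheme"
    and C :: "('h, 'c, 'y) module_coalgebra_scheme"
    and M :: "('h, 'm, 'z) module_comodule_scheme"
  assumes action: "right_action H M (ract M)"
    and comodule: "left_comodule H M"
    and AYD: "m \<in> carrier M \<Longrightarrow> h \<in> carrier H \<Longrightarrow> c \<in> carrier C \<Longrightarrow>
      lift (tensor C M) (coact M (ract M m h)) (\<lambda>(k, m0). pure_tensor C M (lact C k c) m0) =
      lift (tensor C M) (comult H h) (\<lambda>(h', h3).
        lift (tensor C M) (comult H h') (\<lambda>(h1, h2).
          lift (tensor C M) (coact M m) (\<lambda>(k, m0).
            pure_tensor C M (lact C (antipode H h3 \<otimes>\<^bsub>H\<^esub> k \<otimes>\<^bsub>H\<^esub> h1) c) (ract M m0 h2))))"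
    and stability: "m \<in> carrier M \<Longrightarrow> d \<in> carrier (tensor_power C (Suc n)) \<Longrightarrow>
      lift (tensor_over H M (ract M) (tensor_power C (Suc n)) (diag_act H C n)) (coact M m)
        (\<lambda>(k, m0). pure_tensor_over H M (ract M) (tensor_power C (Suc n)) (diag_act H C n)
           m0 (diag_act H C n k d)) =
      pure_tensor_over H M (ract M) (tensor_power C (Suc n)) (diag_act H C n) m d"


section \<open>Cocyclic objects and their isomorphisms\<close>

text \<open>
  \<open>coface X n i\<close>, for \<open>i \<le> n + 1\<close>, maps degree \<open>n\<close> to degree \<open>n + 1\<close>; \<open>codegeneracy X n i\<close>, for
  \<open>i < n\<close>, maps degree \<open>n\<close> to degree \<open>n - 1\<close>; values at other indices are irrelevant.
\<close>

record 'a cocyclic =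
  component :: "nat \<Rightarrow> (complex, 'a) module"
  coface :: "nat \<Rightarrow> nat \<Rightarrow> 'a \<Rightarrow> 'a"
  codegeneracy :: "nat \<Rightarrow> nat \<Rightarrow> 'a \<Rightarrow> 'a"
  cyclic_op :: "nat \<Rightarrow> 'a \<Rightarrow> 'a"

definition cocyclic_iso :: "'a cocyclic \<Rightarrow> 'b cocyclic \<Rightarrow> (nat \<Rightarrow> 'a \<Rightarrow> 'b) \<Rightarrow> bool" where
  "cocyclic_iso X Y \<phi> \<longleftrightarrow>
     (\<forall>n. linear_map (component X n) (component Y n) (\<phi> n) \<and>
          bij_betw (\<phi> n) (carrier (component X n)) (carrier (component Y n))) \<and>
     (\<forall>n i. i \<le> Suc n \<longrightarrow> (\<forall>x\<in>carrier (component X n).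
        \<phi> (Suc n) (coface X n i x) = coface Y n i (\<phi> n x))) \<and>
     (\<forall>n i. i < n \<longrightarrow> (\<forall>x\<in>carrier (component X n).
        \<phi> (n - 1) (codegeneracy X n i x) = codegeneracy Y n i (\<phi> n x))) \<and>
     (\<forall>n. \<forall>x\<in>carrier (component X n).
        \<phi> n (cyclic_op X n x) = cyclic_op Y n (\<phi> n x))"

definition cocyclic_isomorphic :: "'a cocyclic \<Rightarrow> 'b cocyclic \<Rightarrow> bool" where
  "cocyclic_isomorphic X Y \<longleftrightarrow> (\<exists>\<phi>. cocyclic_iso X Y \<phi>)"


section \<open>The operators on \<open>M \<otimes> C \<otimes> \<dots> \<otimes> C\<close>\<close>

type_synonym ('m, 'c) cochain = "('m \<times> ('c list \<Rightarrow> complex) set \<Rightarrow> complex) set"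

definition cochains ::
    "('h, 'c, 'y) module_coalgebra_scheme \<Rightarrow> ('h, 'm, 'z) module_comodule_scheme \<Rightarrow> nat \<Rightarrow>
     (complex, ('m, 'c) cochain) module" where
  "cochains C M n = tensor M (tensor_power C (Suc n))"

definition pure_cochain ::
    "('h, 'c, 'y) module_coalgebra_scheme \<Rightarrow> ('h, 'm, 'z) module_comodule_scheme \<Rightarrow>
     'm \<Rightarrow> 'c list \<Rightarrow> ('m, 'c) cochain" where
  "pure_cochain C M m cs = pure_tensor M (tensor_power C (length cs)) m (pure_power C cs)"

definition cochain_lift ::
    "(complex, 'v, 'x) module_scheme \<Rightarrow> ('m, 'c) cochain \<Rightarrow> ('m \<Rightarrow> 'c list \<Rightarrow> 'v) \<Rightarrow> 'v" where
  "cochain_lift Z x f = lift Z x (\<lambda>(m, d). lift Z d (f m))"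

definition cochain_coface ::
    "('h, 'c, 'y) module_coalgebra_scheme \<Rightarrow> ('h, 'm, 'z) module_comodule_scheme \<Rightarrow>
     nat \<Rightarrow> nat \<Rightarrow> ('m, 'c) cochain \<Rightarrow> ('m, 'c) cochain" where
  "cochain_coface C M n i x =
     (if i \<le> n then
        cochain_lift (cochains C M (Suc n)) x (\<lambda>m cs.
          lift (cochains C M (Suc n)) (comult C (cs ! i)) (\<lambda>(a, b).
            pure_cochain C M m (take i cs @ [a, b] @ drop (Suc i) cs)))
      else
        cochain_lift (cochains C M (Suc n)) x (\<lambda>m cs.
          lift (cochains C M (Suc n)) (comult C (hd cs)) (\<lambda>(a, b).
            lift (cochains C M (Suc n)) (coact M m) (\<lambda>(k, m0).
              pure_cochain C M m0 (b # tl cs @ [lact C k a])))))"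

definition cochain_codegeneracy ::
    "('h, 'c, 'y) module_coalgebra_scheme \<Rightarrow> ('h, 'm, 'z) module_comodule_scheme \<Rightarrow>
     nat \<Rightarrow> nat \<Rightarrow> ('m, 'c) cochain \<Rightarrow> ('m, 'c) cochain" where
  "cochain_codegeneracy C M n i x =
     cochain_lift (cochains C M (n - 1)) x (\<lambda>m cs.
       counit C (cs ! Suc i) \<odot>\<^bsub>cochains C M (n - 1)\<^esub>
         pure_cochain C M m (take (Suc i) cs @ drop (Suc (Suc i)) cs))"

definition cochain_cyclic ::
    "('h, 'c, 'y) module_coalgebra_scheme \<Rightarrow> ('h, 'm, 'z) module_comodule_scheme \<Rightarrow>
     nat \<Rightarrow> ('m, 'c) cochain \<Rightarrow> ('m, 'c) cochain" where
  "cochain_cyclic C M n x =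
     cochain_lift (cochains C M n) x (\<lambda>m cs.
       lift (cochains C M n) (coact M m) (\<lambda>(k, m0).
         pure_cochain C M m0 (tl cs @ [lact C k (hd cs)])))"


section \<open>The cocyclic module \<open>M \<otimes>\<^sub>H (C \<otimes> \<dots> \<otimes> C)\<close>\<close>

definition CH_relations ::
    "('h, 'x) hopf_algebra_scheme \<Rightarrow> ('h, 'c, 'y) module_coalgebra_scheme \<Rightarrow>
     ('h, 'm, 'z) module_comodule_scheme \<Rightarrow> nat \<Rightarrow> ('m, 'c) cochain set" where
  "CH_relations H C M n = balancing H M (ract M) (tensor_power C (Suc n)) (diag_act H C n)"

definition CH ::
    "('h, 'x) hopf_algebra_scheme \<Rightarrow> ('h, 'c, 'y) module_coalgebra_scheme \<Rightarrow>
     ('h, 'm, 'z) module_comodule_scheme \<Rightarrow> ('m, 'c) cochain set cocyclic" where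
  "CH H C M =
     \<lparr>component = (\<lambda>n. tensor_over H M (ract M) (tensor_power C (Suc n)) (diag_act H C n)),
      coface = (\<lambda>n i. induced (cochains C M (Suc n)) (CH_relations H C M (Suc n))
                        (cochain_coface C M n i)),
      codegeneracy = (\<lambda>n i. induced (cochains C M (n - 1)) (CH_relations H C M (n - 1))
                        (cochain_codegeneracy C M n i)),
      cyclic_op = (\<lambda>n. induced (cochains C M n) (CH_relations H C M n) (cochain_cyclic C M n))\<rparr>"


section \<open>The bialgebra cyclic complex\<close>

definition L_op ::
    "('h, 'x) hopf_algebra_scheme \<Rightarrow> ('h, 'c, 'y) module_coalgebra_scheme \<Rightarrow>
     ('h, 'm, 'z) module_comodule_scheme \<Rightarrow> nat \<Rightarrow> 'h \<Rightarrow> ('m, 'c) cochain \<Rightarrow> ('m, 'c) cochain" where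
  "L_op H C M n g x =
     cochain_lift (cochains C M n) x (\<lambda>m cs.
       lift (cochains C M n) (iter_comult H (Suc n) g) (\<lambda>gs.
         pure_cochain C M (ract M m (antipode H (hd gs))) (map2 (lact C) (tl gs) cs)))"

definition W_space ::
    "('h, 'x) hopf_algebra_scheme \<Rightarrow> ('h, 'c, 'y) module_coalgebra_scheme \<Rightarrow>
     ('h, 'm, 'z) module_comodule_scheme \<Rightarrow> nat \<Rightarrow> ('m, 'c) cochain set" where
  "W_space H C M n = lin_span (cochains C M n)
     {L_op H C M n g ((cochain_cyclic C M n ^^ i) x) \<ominus>\<^bsub>cochains C M n\<^esub>
        (cochain_cyclic C M n ^^ i) (L_op H C M n g x) | g i x.
        g \<in> carrier H \<and> 0 < i \<and> x \<in> carrier (cochains C M n)}"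

definition PCM ::
    "('h, 'x) hopf_algebra_scheme \<Rightarrow> ('h, 'c, 'y) module_coalgebra_scheme \<Rightarrow>
     ('h, 'm, 'z) module_comodule_scheme \<Rightarrow> ('m, 'c) cochain set cocyclic" where
  "PCM H C M =
     \<lparr>component = (\<lambda>n. quot_space (cochains C M n) (W_space H C M n)),
      coface = (\<lambda>n i. induced (cochains C M (Suc n)) (W_space H C M (Suc n)) (cochain_coface C M n i)),
      codegeneracy = (\<lambda>n i. induced (cochains C M (n - 1)) (W_space H C M (n - 1))
                        (cochain_codegeneracy C M n i)),
      cyclic_op = (\<lambda>n. induced (cochains C M n) (W_space H C M n) (cochain_cyclic C M n))\<rparr>"

definition PCM_act ::
    "('h, 'x) hopf_algebra_scheme \<Rightarrow> ('h, 'c, 'y) module_coalgebra_scheme \<Rightarrow>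
     ('h, 'm, 'z) module_comodule_scheme \<Rightarrow> nat \<Rightarrow>
     'h \<Rightarrow> ('m, 'c) cochain set \<Rightarrow> ('m, 'c) cochain set" where
  "PCM_act H C M n g = induced (cochains C M n) (W_space H C M n) (L_op H C M n g)"

definition trivial_act :: "('h, 'x) hopf_algebra_scheme \<Rightarrow> complex \<Rightarrow> 'h \<Rightarrow> complex" where
  "trivial_act H a h = a * counit H h"

text \<open>
  The operator \<open>id \<otimes> f\<close> on \<open>\<complex> \<otimes>\<^sub>H PCM\<close>, where \<open>n\<close> is the degree in which \<open>f\<close> takes its values.
\<close>

definition CM_induced ::
    "('h, 'x) hopf_algebra_scheme \<Rightarrow> ('h, 'c, 'y) module_coalgebra_scheme \<Rightarrow>
     ('h, 'm, 'z) module_comodule_scheme \<Rightarrow> nat \<Rightarrow>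
     (('m, 'c) cochain set \<Rightarrow> ('m, 'c) cochain set) \<Rightarrow>
     (complex \<times> ('m, 'c) cochain set \<Rightarrow> complex) set set \<Rightarrow>
     (complex \<times> ('m, 'c) cochain set \<Rightarrow> complex) set set" where
  "CM_induced H C M n f =
     induced (tensor cplx (component (PCM H C M) n))
       (balancing H cplx (trivial_act H) (component (PCM H C M) n) (PCM_act H C M n))
       (\<lambda>t. lift (tensor cplx (component (PCM H C M) n)) t
              (\<lambda>(a, v). pure_tensor cplx (component (PCM H C M) n) a (f v)))"

definition CM ::
    "('h, 'x) hopf_algebra_scheme \<Rightarrow> ('h, 'c, 'y) module_coalgebra_scheme \<Rightarrow>
     ('h, 'm, 'z) module_comodule_scheme \<Rightarrow>
     (complex \<times> ('m, 'c) cochain set \<Rightarrow> complex) set set cocyclic" where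
  "CM H C M =
     \<lparr>component = (\<lambda>n. tensor_over H cplx (trivial_act H)
                          (component (PCM H C M) n) (PCM_act H C M n)),
      coface = (\<lambda>n i. CM_induced H C M (Suc n) (coface (PCM H C M) n i)),
      codegeneracy = (\<lambda>n i. CM_induced H C M (n - 1) (codegeneracy (PCM H C M) n i)),
      cyclic_op = (\<lambda>n. CM_induced H C M n (cyclic_op (PCM H C M) n))\<rparr>"

end

theory Submission
  imports Defs
begin

text \<open>
  Write \<open>X = M \<otimes> C \<otimes> \<dots> \<otimes> C\<close>.  Three subspaces of \<open>X\<close> matter: the balancing subspace \<open>B\<close>, with
  \<open>X / B = M \<otimes>\<^sub>H (C \<otimes> \<dots> \<otimes> C)\<close>; the subspace \<open>W\<close> spanned by the images of the commutators
  \<open>[L\<^sub>g, \<tau>\<^sup>i]\<close>; and the span \<open>J\<close> of all \<open>L\<^sub>g x - \<epsilon>(g) x\<close>.  Since \<open>\<complex> \<otimes>\<^sub>H (X / W) = X / (W + J)\<close>, the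
  theorem amounts to \<open>J = B\<close> and \<open>W \<subseteq> B\<close>, together with the fact that all operators descend to the
  quotients; the isomorphism then sends the class of \<open>x\<close> to the class of \<open>x\<close>.

  The equation \<open>J = B\<close> is best seen on linear maps \<open>p\<close> out of \<open>X\<close>.  The operator \<open>L\<^sub>g\<close> sends \<open>m \<otimes> v\<close> to
  \<open>m S(g\<^sup>(\<^sup>1\<^sup>)) \<otimes> g\<^sup>(\<^sup>2\<^sup>) v\<close>.  If \<open>p\<close> is balanced, the two actions cancel because \<open>S(g\<^sup>(\<^sup>1\<^sup>)) g\<^sup>(\<^sup>2\<^sup>) = \<epsilon>(g)\<close>, and
  \<open>p(L\<^sub>g x) = \<epsilon>(g) p(x)\<close>.  Conversely, if \<open>p\<close> has this invariance, then \<open>p(m h \<otimes> v)\<close> equals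
  \<open>p(L\<^sub>b (m a \<otimes> v)) = p(m a S(b\<^sup>(\<^sup>1\<^sup>)) \<otimes> b\<^sup>(\<^sup>2\<^sup>) v)\<close> summed over \<open>\<Delta>(h) = a \<otimes> b\<close>, which is \<open>p(m \<otimes> h v)\<close>.  These are
  the lemmas \<open>balanced_imp_L_invariant\<close> and \<open>L_invariant_imp_balanced\<close>.

  For \<open>W \<subseteq> B\<close> it suffices that \<open>\<tau>\<close> preserves \<open>B\<close>: modulo \<open>B\<close> both \<open>L\<^sub>g \<tau>\<^sup>i x\<close> and \<open>\<tau>\<^sup>i L\<^sub>g x\<close> are then
  \<open>\<epsilon>(g) \<tau>\<^sup>i x\<close>.  That \<open>\<tau>\<close> preserves \<open>B\<close> is what the anti-Yetter-Drinfeld condition says (lemma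
  \<open>tau_balanced\<close>).

  The cofaces other than the last one and the codegeneracies are of the form \<open>id \<otimes> f\<close> with an \<open>H\<close>-linear
  map \<open>f\<close> between tensor powers of \<open>C\<close>.  Such operators commute with \<open>L\<^sub>g\<close> and preserve \<open>B\<close>.  They can also
  be moved past powers of \<open>\<tau>\<close> at the price of other operators of the same form, so they send commutators
  to commutators and preserve \<open>W\<close>.  The last coface is the first one followed by \<open>\<tau>\<close>.  That \<open>H\<close> acts on
  \<open>X / W\<close> at all uses \<open>L\<^sub>h L\<^sub>g = L\<^sub>h\<^sub>g\<close>, hence that the antipode reverses products.

  Sweedler notation is handled through \<^const>\<open>lift\<close>.  A computation is a chain of four kinds of steps:
  changing the summand under a \<^const>\<open>lift\<close>, interchanging two of them, moving a linear map inside, and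
  applying an axiom such as coassociativity, which an expression may undergo once it is multilinear in
  the Sweedler components.  Two collections of rules, \<open>closed_rules\<close> and \<open>linear_rules\<close>, discharge the
  side conditions.
\<close>

section \<open>Linear maps, spans and quotients\<close>

abbreviation vspace :: "(complex, 'v, 'x) module_scheme \<Rightarrow> bool" where
  "vspace V \<equiv> module cplx V"

lemma cplx_simps [simp]:
  "carrier cplx = UNIV" "monoid.mult cplx = (*)" "\<one>\<^bsub>cplx\<^esub> = 1" "\<zero>\<^bsub>cplx\<^esub> = 0"
  "add cplx = (+)" "smult cplx = (*)"
  by (simp_all add: cplx_def)

lemma cring_cplx: "cring cplx"
proof (rule cringI)
  show "abelian_group cplx"
  proof (rule abelian_groupI)
    fix x assume "x \<in> carrier cplx"
    show "\<exists>y\<in>carrier cplx. y \<oplus>\<^bsub>cplx\<^esub> x = \<zero>\<^bsub>cplx\<^esub>"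
      by (rule bexI[of _ "- x"]) simp_all
  qed (simp_all add: add.commute add.assoc)
  show "comm_monoid cplx"
    by (rule comm_monoidI) (simp_all add: mult.commute mult.assoc)
qed (simp add: algebra_simps)

lemma vsI:
  assumes "abelian_group V"
    and "\<And>a x. x \<in> carrier V \<Longrightarrow> a \<odot>\<^bsub>V\<^esub> x \<in> carrier V"
    and "\<And>a b x. x \<in> carrier V \<Longrightarrow> (a + b) \<odot>\<^bsub>V\<^esub> x = a \<odot>\<^bsub>V\<^esub> x \<oplus>\<^bsub>V\<^esub> b \<odot>\<^bsub>V\<^esub> x"
    and "\<And>a x y. x \<in> carrier V \<Longrightarrow> y \<in> carrier V \<Longrightarrow> a \<odot>\<^bsub>V\<^esub> (x \<oplus>\<^bsub>V\<^esub> y) = a \<odot>\<^bsub>V\<^esub> x \<oplus>\<^bsub>V\<^esub> a \<odot>\<^bsub>V\<^esub> y"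
    and "\<And>a b x. x \<in> carrier V \<Longrightarrow> (a * b) \<odot>\<^bsub>V\<^esub> x = a \<odot>\<^bsub>V\<^esub> (b \<odot>\<^bsub>V\<^esub> x)"
    and "\<And>x. x \<in> carrier V \<Longrightarrow> 1 \<odot>\<^bsub>V\<^esub> x = x"
  shows "vspace V"
  by (rule moduleI[OF cring_cplx assms(1)]) (use assms in auto)

lemma vs_cplx: "vspace cplx"
proof (rule vsI)
  show "abelian_group cplx"
    using cring_cplx by (simp add: cring_def ring_def)
qed (auto simp: algebra_simps)

lemma
  assumes "vspace V"
  shows vs_zero_closed: "\<zero>\<^bsub>V\<^esub> \<in> carrier V"
    and vs_add_closed: "x \<in> carrier V \<Longrightarrow> y \<in> carrier V \<Longrightarrow> x \<oplus>\<^bsub>V\<^esub> y \<in> carrier V"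
    and vs_minus_closed: "x \<in> carrier V \<Longrightarrow> y \<in> carrier V \<Longrightarrow> x \<ominus>\<^bsub>V\<^esub> y \<in> carrier V"
    and vs_smult_closed: "x \<in> carrier V \<Longrightarrow> a \<odot>\<^bsub>V\<^esub> x \<in> carrier V"
    and vs_smult_one: "x \<in> carrier V \<Longrightarrow> 1 \<odot>\<^bsub>V\<^esub> x = x"
    and vs_smult_zero: "x \<in> carrier V \<Longrightarrow> 0 \<odot>\<^bsub>V\<^esub> x = \<zero>\<^bsub>V\<^esub>"
    and vs_smult_smult: "x \<in> carrier V \<Longrightarrow> a \<odot>\<^bsub>V\<^esub> (b \<odot>\<^bsub>V\<^esub> x) = (a * b) \<odot>\<^bsub>V\<^esub> x"
    and vs_smult_add: "x \<in> carrier V \<Longrightarrow> y \<in> carrier V \<Longrightarrow>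
      a \<odot>\<^bsub>V\<^esub> (x \<oplus>\<^bsub>V\<^esub> y) = a \<odot>\<^bsub>V\<^esub> x \<oplus>\<^bsub>V\<^esub> a \<odot>\<^bsub>V\<^esub> y"
    and vs_add_smult: "x \<in> carrier V \<Longrightarrow> (a + b) \<odot>\<^bsub>V\<^esub> x = a \<odot>\<^bsub>V\<^esub> x \<oplus>\<^bsub>V\<^esub> b \<odot>\<^bsub>V\<^esub> x"
    and vs_minus_eq: "x \<in> carrier V \<Longrightarrow> y \<in> carrier V \<Longrightarrow> x \<ominus>\<^bsub>V\<^esub> y = x \<oplus>\<^bsub>V\<^esub> (-1) \<odot>\<^bsub>V\<^esub> y"
    and vs_minus_zero_iff: "x \<in> carrier V \<Longrightarrow> y \<in> carrier V \<Longrightarrow> x \<ominus>\<^bsub>V\<^esub> y = \<zero>\<^bsub>V\<^esub> \<longleftrightarrow> x = y"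
proof -
  interpret V: module cplx V by fact
  show "\<zero>\<^bsub>V\<^esub> \<in> carrier V" by simp
  show "x \<in> carrier V \<Longrightarrow> y \<in> carrier V \<Longrightarrow> x \<oplus>\<^bsub>V\<^esub> y \<in> carrier V" by simp
  show "x \<in> carrier V \<Longrightarrow> y \<in> carrier V \<Longrightarrow> x \<ominus>\<^bsub>V\<^esub> y \<in> carrier V" by simp
  show "x \<in> carrier V \<Longrightarrow> a \<odot>\<^bsub>V\<^esub> x \<in> carrier V" by simp
  show "x \<in> carrier V \<Longrightarrow> 1 \<odot>\<^bsub>V\<^esub> x = x" using V.smult_one by simp
  show "x \<in> carrier V \<Longrightarrow> 0 \<odot>\<^bsub>V\<^esub> x = \<zero>\<^bsub>V\<^esub>" using V.smult_l_null by simp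
  show "x \<in> carrier V \<Longrightarrow> a \<odot>\<^bsub>V\<^esub> (b \<odot>\<^bsub>V\<^esub> x) = (a * b) \<odot>\<^bsub>V\<^esub> x"
    using V.smult_assoc1 by simp
  show "x \<in> carrier V \<Longrightarrow> y \<in> carrier V \<Longrightarrow>
      a \<odot>\<^bsub>V\<^esub> (x \<oplus>\<^bsub>V\<^esub> y) = a \<odot>\<^bsub>V\<^esub> x \<oplus>\<^bsub>V\<^esub> a \<odot>\<^bsub>V\<^esub> y"
    using V.smult_r_distr by simp
  show "x \<in> carrier V \<Longrightarrow> (a + b) \<odot>\<^bsub>V\<^esub> x = a \<odot>\<^bsub>V\<^esub> x \<oplus>\<^bsub>V\<^esub> b \<odot>\<^bsub>V\<^esub> x"
    using V.smult_l_distr by simp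
  have neg: "\<ominus>\<^bsub>cplx\<^esub> 1 = -1"
    using V.R.minus_equality[of "-1" 1] by simp
  show "x \<in> carrier V \<Longrightarrow> y \<in> carrier V \<Longrightarrow> x \<ominus>\<^bsub>V\<^esub> y = x \<oplus>\<^bsub>V\<^esub> (-1) \<odot>\<^bsub>V\<^esub> y"
    using V.smult_l_minus[of 1 y] V.smult_one neg by (simp add: V.M.minus_eq)
  show "x \<in> carrier V \<Longrightarrow> y \<in> carrier V \<Longrightarrow> x \<ominus>\<^bsub>V\<^esub> y = \<zero>\<^bsub>V\<^esub> \<longleftrightarrow> x = y"
    using V.M.add.inv_solve_right'[of "\<zero>\<^bsub>V\<^esub>" x y]
    by (simp add: V.M.minus_eq)
qed

lemma linear_mapI:
  assumes "\<And>v. v \<in> carrier V \<Longrightarrow> f v \<in> carrier W"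
    and "\<And>v v'. v \<in> carrier V \<Longrightarrow> v' \<in> carrier V \<Longrightarrow> f (v \<oplus>\<^bsub>V\<^esub> v') = f v \<oplus>\<^bsub>W\<^esub> f v'"
    and "\<And>a v. v \<in> carrier V \<Longrightarrow> f (a \<odot>\<^bsub>V\<^esub> v) = a \<odot>\<^bsub>W\<^esub> f v"
  shows "linear_map V W f"
  using assms by (simp add: linear_map_def)

lemma
  assumes "linear_map V W f"
  shows linear_map_closed: "v \<in> carrier V \<Longrightarrow> f v \<in> carrier W"
    and linear_map_add: "v \<in> carrier V \<Longrightarrow> v' \<in> carrier V \<Longrightarrow> f (v \<oplus>\<^bsub>V\<^esub> v') = f v \<oplus>\<^bsub>W\<^esub> f v'"
    and linear_map_smult: "v \<in> carrier V \<Longrightarrow> f (a \<odot>\<^bsub>V\<^esub> v) = a \<odot>\<^bsub>W\<^esub> f v"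
  using assms by (simp_all add: linear_map_def)

lemma linear_map_zero:
  assumes "vspace V" "vspace W" "linear_map V W f"
  shows "f \<zero>\<^bsub>V\<^esub> = \<zero>\<^bsub>W\<^esub>"
  using linear_map_smult[OF assms(3) vs_zero_closed[OF assms(1)], of 0]
    linear_map_closed[OF assms(3) vs_zero_closed[OF assms(1)]]
  by (simp add: vs_smult_zero[OF assms(1)] vs_smult_zero[OF assms(2)] vs_zero_closed[OF assms(1)])

lemma linear_map_minus:
  assumes "vspace V" "vspace W" "linear_map V W f" "x \<in> carrier V" "y \<in> carrier V"
  shows "f (x \<ominus>\<^bsub>V\<^esub> y) = f x \<ominus>\<^bsub>W\<^esub> f y"
  using assms by (simp add: vs_minus_eq linear_map_add linear_map_smult linear_map_closed vs_smult_closed)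

lemma linear_map_cong:
  assumes "linear_map V W f" "vspace V" "\<And>v. v \<in> carrier V \<Longrightarrow> g v = f v"
  shows "linear_map V W g"
  using assms by (simp add: linear_map_def vs_add_closed vs_smult_closed)

lemma linear_map_id: "linear_map V V (\<lambda>v. v)"
  by (simp add: linear_map_def)

lemma linear_map_compose:
  assumes "linear_map V W g" "linear_map U V f"
  shows "linear_map U W (\<lambda>u. g (f u))"
  using assms by (simp add: linear_map_def)

lemma linear_map_plus:
  assumes "vspace W" "linear_map V W f" "linear_map V W g"
  shows "linear_map V W (\<lambda>v. f v \<oplus>\<^bsub>W\<^esub> g v)"
proof -
  interpret W: module cplx W by fact
  show ?thesis
    using assms(2,3)
    by (intro linear_mapI) (auto simp: linear_map_def W.M.add.m_ac vs_smult_add[OF assms(1)])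
qed

lemma linear_map_scale:
  assumes "vspace W" "linear_map V W f"
  shows "linear_map V W (\<lambda>v. a \<odot>\<^bsub>W\<^esub> f v)"
  using assms by (intro linear_mapI)
    (auto simp: linear_map_def vs_smult_closed vs_smult_add vs_smult_smult mult.commute)

lemma linear_map_smult_left:
  assumes "vspace W" "linear_map V cplx f" "w \<in> carrier W"
  shows "linear_map V W (\<lambda>v. f v \<odot>\<^bsub>W\<^esub> w)"
  using assms by (intro linear_mapI) (auto simp: linear_map_def vs_smult_closed vs_add_smult vs_smult_smult)

lemma
  assumes "vspace V" "submodule U cplx V"
  shows submodule_subset: "U \<subseteq> carrier V"
    and submodule_zero: "\<zero>\<^bsub>V\<^esub> \<in> U"
    and submodule_add: "x \<in> U \<Longrightarrow> y \<in> U \<Longrightarrow> x \<oplus>\<^bsub>V\<^esub> y \<in> U"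
    and submodule_smult: "x \<in> U \<Longrightarrow> a \<odot>\<^bsub>V\<^esub> x \<in> U"
proof -
  interpret V: module cplx V by fact
  note E = V.submoduleE[OF assms(2)]
  show "U \<subseteq> carrier V" by (rule E)
  show sm: "x \<in> U \<Longrightarrow> a \<odot>\<^bsub>V\<^esub> x \<in> U" for x a using E(4) by simp
  show "x \<in> U \<Longrightarrow> y \<in> U \<Longrightarrow> x \<oplus>\<^bsub>V\<^esub> y \<in> U" by (rule E(5))
  obtain x where "x \<in> U" using E(2) by auto
  then show "\<zero>\<^bsub>V\<^esub> \<in> U" using sm[of x 0] E(1) by (auto simp: vs_smult_zero[OF assms(1)])
qed

lemma submoduleI_vs:
  assumes "vspace V" "U \<subseteq> carrier V" "\<zero>\<^bsub>V\<^esub> \<in> U"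
    and "\<And>x y. x \<in> U \<Longrightarrow> y \<in> U \<Longrightarrow> x \<oplus>\<^bsub>V\<^esub> y \<in> U"
    and "\<And>a x. x \<in> U \<Longrightarrow> a \<odot>\<^bsub>V\<^esub> x \<in> U"
  shows "submodule U cplx V"
proof -
  interpret V: module cplx V by fact
  show ?thesis
  proof (rule V.submoduleI)
    fix x assume x: "x \<in> U"
    then have "\<zero>\<^bsub>V\<^esub> \<ominus>\<^bsub>V\<^esub> x = \<zero>\<^bsub>V\<^esub> \<oplus>\<^bsub>V\<^esub> (-1) \<odot>\<^bsub>V\<^esub> x"
      using assms(2) by (intro vs_minus_eq[OF assms(1)]) auto
    then have "\<ominus>\<^bsub>V\<^esub> x = (-1) \<odot>\<^bsub>V\<^esub> x"
      using x assms(2) by (auto simp: V.M.minus_eq)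
    then show "\<ominus>\<^bsub>V\<^esub> x \<in> U" using assms(5)[OF x] by simp
  qed (use assms in auto)
qed

lemma submodule_zero_space: "vspace V \<Longrightarrow> submodule {\<zero>\<^bsub>V\<^esub>} cplx V"
proof -
  assume V: "vspace V"
  interpret V: module cplx V by fact
  show ?thesis
    by (rule submoduleI_vs[OF V]) (use V.smult_r_null in auto)
qed

lemma submodule_vimage:
  assumes "vspace V" "vspace W" "linear_map V W f" "submodule U cplx W"
  shows "submodule {v \<in> carrier V. f v \<in> U} cplx V"
  using assms by (intro submoduleI_vs)
    (auto simp: vs_zero_closed linear_map_zero submodule_zero linear_map_add linear_map_smult
      vs_add_closed vs_smult_closed submodule_add submodule_smult)

lemma submodule_lin_span:
  assumes "vspace V" "G \<subseteq> carrier V"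
  shows "submodule (lin_span V G) cplx V"
proof (rule submoduleI_vs[OF assms(1)])
  have "submodule (carrier V) cplx V"
    by (intro submoduleI_vs[OF assms(1)]) (auto simp: assms vs_zero_closed vs_add_closed vs_smult_closed)
  then show "lin_span V G \<subseteq> carrier V" using assms(2) by (auto simp: lin_span_def)
qed (auto simp: lin_span_def submodule_zero submodule_add submodule_smult assms)

lemma lin_span_superset: "G \<subseteq> lin_span V G"
  by (auto simp: lin_span_def)

lemma lin_span_least: "submodule U cplx V \<Longrightarrow> G \<subseteq> U \<Longrightarrow> lin_span V G \<subseteq> U"
  by (auto simp: lin_span_def)

lemma linear_map_lin_span:
  assumes "vspace V" "vspace W" "linear_map V W f" "submodule U cplx W" "G \<subseteq> carrier V"
    and "\<And>x. x \<in> G \<Longrightarrow> f x \<in> U" and "x \<in> lin_span V G"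
  shows "f x \<in> U"
  using lin_span_least[OF submodule_vimage[OF assms(1-4)], of G] assms(5-7) by auto

text \<open>
  Sums and multiples of cosets may be computed on representatives.  This turns the set-level
  descriptions of \<^const>\<open>quot_space\<close> and \<^const>\<open>induced\<close> into linear algebra.
\<close>

context
  fixes V :: "(complex, 'v, 'x) module_scheme" and U :: "'v set"
  assumes V: "vspace V" and U: "submodule U cplx V"
begin

interpretation V: module cplx V by (rule V)

interpretation U: abelian_subgroup U V
  by (rule abelian_subgroupI3)
    (use U in \<open>auto simp: additive_subgroup_def submodule_def V.M.abelian_group_axioms\<close>)

lemma coset_mem_iff: "x \<in> carrier V \<Longrightarrow> y \<in> U +>\<^bsub>V\<^esub> x \<longleftrightarrow> y \<in> carrier V \<and> y \<ominus>\<^bsub>V\<^esub> x \<in> U"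
  using U.a_rcos_module[of x y] U.a_elemrcos_carrier[of x y] by (auto simp: V.M.minus_eq)

lemma coset_self: "x \<in> carrier V \<Longrightarrow> x \<in> U +>\<^bsub>V\<^esub> x"
  by (rule U.a_rcos_self)

lemma coset_eq_iff:
  assumes "x \<in> carrier V" "y \<in> carrier V"
  shows "U +>\<^bsub>V\<^esub> x = U +>\<^bsub>V\<^esub> y \<longleftrightarrow> x \<ominus>\<^bsub>V\<^esub> y \<in> U"
  using coset_mem_iff[OF assms(2), of x] coset_self[OF assms(1)]
    U.a_repr_independence'[OF _ assms(2), of x] assms by auto

lemma coset_zero: "U +>\<^bsub>V\<^esub> \<zero>\<^bsub>V\<^esub> = U"
  using U.a_subset by (rule V.a_coset_add_zero)

lemma carrier_quot_space: "carrier (quot_space V U) = (\<lambda>x. U +>\<^bsub>V\<^esub> x) ` carrier V"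
  by (auto simp: quot_space_def A_RCOSETS_def RCOSETS_def a_r_coset_def)

lemma zero_quot_space: "\<zero>\<^bsub>quot_space V U\<^esub> = U"
  by (simp add: quot_space_def)

lemma add_quot_space:
  "x \<in> carrier V \<Longrightarrow> y \<in> carrier V \<Longrightarrow>
    (U +>\<^bsub>V\<^esub> x) \<oplus>\<^bsub>quot_space V U\<^esub> (U +>\<^bsub>V\<^esub> y) = U +>\<^bsub>V\<^esub> (x \<oplus>\<^bsub>V\<^esub> y)"
  by (simp add: quot_space_def U.a_rcos_sum)

lemma Union_coset_image:
  assumes "x \<in> carrier V" "\<And>y. y \<in> U +>\<^bsub>V\<^esub> x \<Longrightarrow> F y = F x"
  shows "(\<Union>y\<in>U +>\<^bsub>V\<^esub> x. F y) = F x"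
proof -
  have "F ` (U +>\<^bsub>V\<^esub> x) = {F x}"
    using assms(2) coset_self[OF assms(1)] by blast
  then show ?thesis by simp
qed

lemma smult_quot_space:
  assumes x: "x \<in> carrier V"
  shows "a \<odot>\<^bsub>quot_space V U\<^esub> (U +>\<^bsub>V\<^esub> x) = U +>\<^bsub>V\<^esub> (a \<odot>\<^bsub>V\<^esub> x)"
  unfolding quot_space_def partial_object.simps module.simps
proof (rule Union_coset_image[OF x, where F = "\<lambda>y. U +>\<^bsub>V\<^esub> (a \<odot>\<^bsub>V\<^esub> y)"])
  fix y assume "y \<in> U +>\<^bsub>V\<^esub> x"
  then have y: "y \<in> carrier V" "y \<ominus>\<^bsub>V\<^esub> x \<in> U" using x by (auto simp: coset_mem_iff)
  have "a \<odot>\<^bsub>V\<^esub> y \<ominus>\<^bsub>V\<^esub> a \<odot>\<^bsub>V\<^esub> x = a \<odot>\<^bsub>V\<^esub> (y \<ominus>\<^bsub>V\<^esub> x)"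
    using x y by (simp add: V vs_minus_eq vs_smult_add vs_smult_smult vs_smult_closed mult.commute)
  then show "U +>\<^bsub>V\<^esub> (a \<odot>\<^bsub>V\<^esub> y) = U +>\<^bsub>V\<^esub> (a \<odot>\<^bsub>V\<^esub> x)"
    using x y U V by (simp add: coset_eq_iff submodule_smult)
qed

lemma vs_quot_space: "vspace (quot_space V U)"
proof (rule vsI)
  show "abelian_group (quot_space V U)"
  proof (rule abelian_groupI)
    fix X assume "X \<in> carrier (quot_space V U)"
    then obtain x where x: "x \<in> carrier V" "X = U +>\<^bsub>V\<^esub> x" by (auto simp: carrier_quot_space)
    then have "(U +>\<^bsub>V\<^esub> (\<ominus>\<^bsub>V\<^esub> x)) \<oplus>\<^bsub>quot_space V U\<^esub> X = \<zero>\<^bsub>quot_space V U\<^esub>"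
      by (simp add: add_quot_space V.M.l_neg coset_zero zero_quot_space)
    then show "\<exists>y\<in>carrier (quot_space V U). y \<oplus>\<^bsub>quot_space V U\<^esub> X = \<zero>\<^bsub>quot_space V U\<^esub>"
      using x by (auto simp: carrier_quot_space)
    show "\<zero>\<^bsub>quot_space V U\<^esub> \<oplus>\<^bsub>quot_space V U\<^esub> X = X"
      using x add_quot_space[of "\<zero>\<^bsub>V\<^esub>" x] by (simp add: coset_zero zero_quot_space)
  next
    show "\<zero>\<^bsub>quot_space V U\<^esub> \<in> carrier (quot_space V U)"
      using coset_zero by (force simp: carrier_quot_space zero_quot_space)
  qed (auto simp: carrier_quot_space add_quot_space V.M.a_ac)
qed (auto simp: carrier_quot_space smult_quot_space add_quot_space V vs_smult_closed vs_smult_add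
    vs_add_smult vs_smult_smult vs_smult_one)

lemma linear_map_coset: "linear_map V (quot_space V U) (\<lambda>x. U +>\<^bsub>V\<^esub> x)"
  by (rule linear_mapI) (auto simp: carrier_quot_space add_quot_space smult_quot_space)

lemma coset_zero_iff: "x \<in> carrier V \<Longrightarrow> U +>\<^bsub>V\<^esub> x = \<zero>\<^bsub>quot_space V U\<^esub> \<longleftrightarrow> x \<in> U"
  using coset_mem_iff[of "\<zero>\<^bsub>V\<^esub>" x] coset_eq_iff[of x "\<zero>\<^bsub>V\<^esub>"]
  by (simp add: zero_quot_space coset_zero)

end

lemma induced_coset:
  assumes "vspace V'" "submodule U' cplx V'" "vspace V" "submodule U cplx V" "linear_map V' V f"
    and "\<And>x. x \<in> U' \<Longrightarrow> f x \<in> U" and x: "x \<in> carrier V'"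
  shows "induced V U f (U' +>\<^bsub>V'\<^esub> x) = U +>\<^bsub>V\<^esub> f x"
  unfolding induced_def
proof (rule Union_coset_image[OF assms(1,2) x])
  fix y assume "y \<in> U' +>\<^bsub>V'\<^esub> x"
  then have y: "y \<in> carrier V'" "y \<ominus>\<^bsub>V'\<^esub> x \<in> U'"
    using x by (auto simp: coset_mem_iff[OF assms(1,2)])
  show "U +>\<^bsub>V\<^esub> f y = U +>\<^bsub>V\<^esub> f x"
    using assms(6)[OF y(2)] y x assms
    by (simp add: coset_eq_iff linear_map_closed linear_map_minus[of V' V f, symmetric])
qed

lemma linear_map_induced:
  assumes "vspace V'" "submodule U' cplx V'" "vspace V" "submodule U cplx V" "linear_map V' V f"
    and "\<And>x. x \<in> U' \<Longrightarrow> f x \<in> U"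
  shows "linear_map (quot_space V' U') (quot_space V U) (induced V U f)"
proof (rule linear_mapI)
  note ind = induced_coset[OF assms]
  note simps = ind carrier_quot_space[OF assms(1,2)] carrier_quot_space[OF assms(3,4)]
    add_quot_space[OF assms(1,2)] add_quot_space[OF assms(3,4)]
    smult_quot_space[OF assms(1,2)] smult_quot_space[OF assms(3,4)]
    linear_map_closed[OF assms(5)] linear_map_add[OF assms(5)] linear_map_smult[OF assms(5)]
    vs_add_closed[OF assms(1)] vs_smult_closed[OF assms(1)]
  show "induced V U f X \<in> carrier (quot_space V U)" if "X \<in> carrier (quot_space V' U')" for X
    using that by (auto simp: simps)
  show "induced V U f (X \<oplus>\<^bsub>quot_space V' U'\<^esub> Y) = induced V U f X \<oplus>\<^bsub>quot_space V U\<^esub> induced V U f Y"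
    if "X \<in> carrier (quot_space V' U')" "Y \<in> carrier (quot_space V' U')" for X Y
    using that by (auto simp: simps)
  show "induced V U f (a \<odot>\<^bsub>quot_space V' U'\<^esub> X) = a \<odot>\<^bsub>quot_space V U\<^esub> induced V U f X"
    if "X \<in> carrier (quot_space V' U')" for X a
    using that by (auto simp: simps)
qed

section \<open>Free spaces and linear extension\<close>

lemma linear_map_finsum:
  assumes "vspace V" "vspace W" "linear_map V W g" "h \<in> A \<rightarrow> carrier V"
  shows "g (finsum V h A) = finsum W (\<lambda>a. g (h a)) A"
proof -
  interpret V: module cplx V by fact
  interpret W: module cplx W by fact
  show ?thesis
  proof (cases "finite A")
    case True
    then show ?thesis using assms(4)
      by induction (auto simp: linear_map_zero[OF assms(1-3)] linear_map_add[OF assms(3)]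
          linear_map_closed[OF assms(3)] Pi_iff)
  next
    case False
    then show ?thesis by (simp add: linear_map_zero[OF assms(1-3)])
  qed
qed

lemma linear_map_finsum_family:
  assumes "vspace V" "vspace W" "finite A" "\<And>a. a \<in> A \<Longrightarrow> linear_map V W (\<lambda>v. F v a)"
  shows "linear_map V W (\<lambda>v. finsum W (F v) A)"
proof -
  interpret W: module cplx W by fact
  show ?thesis using assms(3,4)
  proof induction
    case empty
    then show ?case using W.smult_r_null by (simp add: linear_map_def)
  next
    case (insert a A)
    then have "linear_map V W (\<lambda>v. F v a \<oplus>\<^bsub>W\<^esub> finsum W (F v) A)"
      by (intro linear_map_plus assms(2)) auto
    then show ?case
    proof (rule linear_map_cong[OF _ assms(1)])
      fix v assume "v \<in> carrier V"
      then show "finsum W (F v) (insert a A) = F v a \<oplus>\<^bsub>W\<^esub> finsum W (F v) A"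
        using insert linear_map_closed[OF insert.prems \<open>v \<in> carrier V\<close>]
        by (intro W.M.finsum_insert) auto
    qed
  qed
qed

lemma finsum_swap:
  assumes "vspace V" "finite A" "finite B" "\<And>a b. a \<in> A \<Longrightarrow> b \<in> B \<Longrightarrow> F a b \<in> carrier V"
  shows "finsum V (\<lambda>a. finsum V (F a) B) A = finsum V (\<lambda>b. finsum V (\<lambda>a. F a b) A) B"
proof -
  interpret V: module cplx V by fact
  show ?thesis using assms(2,4)
  proof induction
    case (insert a A)
    have "finsum V (\<lambda>b. finsum V (\<lambda>a. F a b) (insert a A)) B =
        finsum V (\<lambda>b. F a b \<oplus>\<^bsub>V\<^esub> finsum V (\<lambda>a. F a b) A) B"
      using insert by (intro V.M.finsum_cong' refl) (auto simp: Pi_iff)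
    also have "\<dots> = finsum V (F a) B \<oplus>\<^bsub>V\<^esub> finsum V (\<lambda>b. finsum V (\<lambda>a. F a b) A) B"
      using insert by (intro V.M.finsum_addf) (auto simp: Pi_iff)
    finally show ?case using insert by (simp add: Pi_iff)
  qed simp
qed

text \<open>
  The linear extension of \<open>f\<close> from a basis, evaluated at a formal combination \<open>r\<close>.  The value of
  \<^const>\<open>lift\<close> at a coset is the value of this extension at a chosen representative.
\<close>

definition lin_ext ::
    "(complex, 'z, 'x) module_scheme \<Rightarrow> ('b \<Rightarrow> 'z) \<Rightarrow> ('b \<Rightarrow> complex) \<Rightarrow> 'z" where
  "lin_ext Z f r = finsum Z (\<lambda>b. r b \<odot>\<^bsub>Z\<^esub> f b) {b. r b \<noteq> 0}"

lemma lift_eq_lin_ext: "lift Z t f = lin_ext Z f (SOME r. r \<in> t)"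
  by (simp add: lift_def lin_ext_def Let_def)

lemma free_space_simps [simp]:
  "r \<in> carrier (free_space B) \<longleftrightarrow> finite {b. r b \<noteq> 0} \<and> (\<forall>b. r b \<noteq> 0 \<longrightarrow> b \<in> B)"
  "r \<oplus>\<^bsub>free_space B\<^esub> s = (\<lambda>b. r b + s b)"
  "a \<odot>\<^bsub>free_space B\<^esub> r = (\<lambda>b. a * r b)"
  "\<zero>\<^bsub>free_space B\<^esub> = (\<lambda>b. 0)"
  by (auto simp: free_space_def)

lemma free_space_add_closed:
  "r \<in> carrier (free_space B) \<Longrightarrow> s \<in> carrier (free_space B) \<Longrightarrow>
    (\<lambda>b. r b + s b) \<in> carrier (free_space B)"
proof -
  assume *: "r \<in> carrier (free_space B)" "s \<in> carrier (free_space B)"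
  have sub: "{b. r b + s b \<noteq> 0} \<subseteq> {b. r b \<noteq> 0} \<union> {b. s b \<noteq> 0}"
    by (rule subsetI, rule ccontr) simp
  have "finite {b. r b + s b \<noteq> 0}"
    by (rule finite_subset[OF sub]) (use * in simp)
  moreover have "b \<in> B" if "r b + s b \<noteq> 0" for b
    using subsetD[OF sub, of b] that * by auto
  ultimately show ?thesis by simp
qed

lemma free_space_smult_closed:
  "r \<in> carrier (free_space B) \<Longrightarrow> (\<lambda>b. a * r b) \<in> carrier (free_space B)"
  by (auto intro: finite_subset[of _ "{b. r b \<noteq> 0}"])

lemma vs_free_space: "vspace (free_space B)"
proof (rule vsI)
  show "abelian_group (free_space B)"
  proof (rule abelian_groupI)
    fix r assume r: "r \<in> carrier (free_space B)"
    have "(\<lambda>b. - r b) \<in> carrier (free_space B)"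
      using free_space_smult_closed[OF r, of "-1"] by simp
    then show "\<exists>s\<in>carrier (free_space B). s \<oplus>\<^bsub>free_space B\<^esub> r = \<zero>\<^bsub>free_space B\<^esub>"
      by (rule rev_bexI) simp
  qed (auto simp del: free_space_simps(1) simp: free_space_add_closed add.assoc add.commute,
      simp)
qed (auto simp del: free_space_simps(1) simp: free_space_smult_closed algebra_simps)

lemma delta_carrier: "b \<in> B \<Longrightarrow> delta b \<in> carrier (free_space B)"
  by (simp add: delta_def)

lemma lin_ext_superset:
  assumes "vspace Z" "finite A" "{b. r b \<noteq> 0} \<subseteq> A" "f \<in> A \<rightarrow> carrier Z"
  shows "lin_ext Z f r = finsum Z (\<lambda>b. r b \<odot>\<^bsub>Z\<^esub> f b) A"
proof -
  interpret Z: module cplx Z by fact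
  show ?thesis unfolding lin_ext_def
    by (rule Z.M.add.finprod_mono_neutral_cong_left[OF assms(2,3)])
      (use assms in \<open>auto simp: vs_smult_zero Pi_iff\<close>)
qed

lemma lin_ext_delta:
  assumes "vspace Z" "f b \<in> carrier Z"
  shows "lin_ext Z f (delta b) = f b"
proof -
  interpret Z: module cplx Z by fact
  have "lin_ext Z f (delta b) = finsum Z (\<lambda>b'. delta b b' \<odot>\<^bsub>Z\<^esub> f b') {b}"
    using assms by (intro lin_ext_superset) (auto simp: delta_def)
  then show ?thesis using assms by (simp add: delta_def vs_smult_one)
qed

lemma lin_ext_closed:
  assumes "vspace Z" "r \<in> carrier (free_space B)" "f \<in> B \<rightarrow> carrier Z"
  shows "lin_ext Z f r \<in> carrier Z"
proof -
  interpret Z: module cplx Z by fact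
  show ?thesis unfolding lin_ext_def
    using assms by (intro Z.M.finsum_closed) (auto simp: Pi_iff vs_smult_closed)
qed

lemma linear_map_lin_ext:
  assumes "vspace Z" "f \<in> B \<rightarrow> carrier Z"
  shows "linear_map (free_space B) Z (lin_ext Z f)"
proof (rule linear_mapI)
  interpret Z: module cplx Z by fact
  show closed: "lin_ext Z f r \<in> carrier Z" if "r \<in> carrier (free_space B)" for r
    using that assms by (intro lin_ext_closed)
  fix r assume r: "r \<in> carrier (free_space B)"
  show "lin_ext Z f (a \<odot>\<^bsub>free_space B\<^esub> r) = a \<odot>\<^bsub>Z\<^esub> lin_ext Z f r" for a
  proof -
    have "lin_ext Z f (a \<odot>\<^bsub>free_space B\<^esub> r) = finsum Z (\<lambda>b. a \<odot>\<^bsub>Z\<^esub> (r b \<odot>\<^bsub>Z\<^esub> f b)) {b. r b \<noteq> 0}"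
      using r assms
      by (subst lin_ext_superset[of _ "{b. r b \<noteq> 0}"])
        (auto simp: vs_smult_smult vs_smult_closed Pi_iff intro!: Z.M.finsum_cong')
    also have "\<dots> = a \<odot>\<^bsub>Z\<^esub> lin_ext Z f r"
      unfolding lin_ext_def using r assms
      by (intro Z.finsum_smult_ldistr[symmetric]) (auto simp: Pi_iff vs_smult_closed)
    finally show ?thesis .
  qed
  fix s assume s: "s \<in> carrier (free_space B)"
  let ?A = "{b. r b \<noteq> 0} \<union> {b. s b \<noteq> 0}"
  have A: "finite ?A" "?A \<subseteq> B" using r s by auto
  have f: "f \<in> ?A \<rightarrow> carrier Z" using A assms by auto
  have "{b. r b + s b \<noteq> 0} \<subseteq> ?A"
    by (rule subsetI, rule ccontr) simp
  then have "lin_ext Z f (r \<oplus>\<^bsub>free_space B\<^esub> s) = finsum Z (\<lambda>b. (r b + s b) \<odot>\<^bsub>Z\<^esub> f b) ?A"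
    using lin_ext_superset[OF assms(1) A(1) _ f, of "\<lambda>b. r b + s b"] by simp
  also have "\<dots> = finsum Z (\<lambda>b. (r b \<odot>\<^bsub>Z\<^esub> f b) \<oplus>\<^bsub>Z\<^esub> (s b \<odot>\<^bsub>Z\<^esub> f b)) ?A"
    using f by (intro Z.M.finsum_cong' refl)
      (auto simp: vs_add_smult[OF assms(1)] vs_add_closed[OF assms(1)] vs_smult_closed[OF assms(1)] Pi_iff)
  also have "\<dots> = finsum Z (\<lambda>b. r b \<odot>\<^bsub>Z\<^esub> f b) ?A \<oplus>\<^bsub>Z\<^esub> finsum Z (\<lambda>b. s b \<odot>\<^bsub>Z\<^esub> f b) ?A"
    using f by (intro Z.M.finsum_addf) (auto simp: Pi_iff)
  also have "\<dots> = lin_ext Z f r \<oplus>\<^bsub>Z\<^esub> lin_ext Z f s"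
    using lin_ext_superset[OF assms(1) A(1) _ f, of r] lin_ext_superset[OF assms(1) A(1) _ f, of s]
    by simp
  finally show "lin_ext Z f (r \<oplus>\<^bsub>free_space B\<^esub> s) = lin_ext Z f r \<oplus>\<^bsub>Z\<^esub> lin_ext Z f s" .
qed

lemma lin_ext_map:
  assumes "vspace Z" "vspace Z'" "linear_map Z Z' g" "r \<in> carrier (free_space B)" "f \<in> B \<rightarrow> carrier Z"
  shows "g (lin_ext Z f r) = lin_ext Z' (\<lambda>b. g (f b)) r"
proof -
  interpret Z': module cplx Z' by fact
  have "g (lin_ext Z f r) = finsum Z' (\<lambda>b. g (r b \<odot>\<^bsub>Z\<^esub> f b)) {b. r b \<noteq> 0}"
    unfolding lin_ext_def using assms
    by (intro linear_map_finsum[of Z Z' g]) (auto intro: vs_smult_closed)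
  also have "\<dots> = lin_ext Z' (\<lambda>b. g (f b)) r"
    unfolding lin_ext_def using assms
    by (intro Z'.M.finsum_cong') (auto simp: linear_map_smult[OF assms(3)] Pi_iff
      vs_smult_closed linear_map_closed[OF assms(3)])
  finally show ?thesis .
qed

lemma lin_ext_cong:
  assumes "vspace Z" "r \<in> carrier (free_space B)" "\<And>b. b \<in> B \<Longrightarrow> f b = g b"
    "\<And>b. b \<in> B \<Longrightarrow> g b \<in> carrier Z"
  shows "lin_ext Z f r = lin_ext Z g r"
proof -
  interpret Z: module cplx Z by fact
  show ?thesis unfolding lin_ext_def
    using assms by (intro Z.M.finsum_cong') (auto intro!: Z.smult_closed)
qed

lemma lin_ext_family:
  assumes "vspace V" "vspace Z" "r \<in> carrier (free_space B)"
    "\<And>b. b \<in> B \<Longrightarrow> linear_map V Z (\<lambda>v. F v b)"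
  shows "linear_map V Z (\<lambda>v. lin_ext Z (F v) r)"
  unfolding lin_ext_def using assms
  by (intro linear_map_finsum_family linear_map_scale) auto

lemma lin_ext_swap:
  assumes "vspace Z" "r \<in> carrier (free_space A)" "s \<in> carrier (free_space B)"
    "\<And>a b. a \<in> A \<Longrightarrow> b \<in> B \<Longrightarrow> F a b \<in> carrier Z"
  shows "lin_ext Z (\<lambda>a. lin_ext Z (\<lambda>b. F a b) s) r = lin_ext Z (\<lambda>b. lin_ext Z (\<lambda>a. F a b) r) s"
proof -
  interpret Z: module cplx Z by fact
  let ?A = "{a. r a \<noteq> 0}" and ?B = "{b. s b \<noteq> 0}"
  have AB: "finite ?A" "finite ?B" "?A \<subseteq> A" "?B \<subseteq> B" using assms by auto
  have F: "F a b \<in> carrier Z" if "a \<in> ?A" "b \<in> ?B" for a b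
    using that AB assms(4) by blast
  have "lin_ext Z (\<lambda>a. lin_ext Z (\<lambda>b. F a b) s) r =
      finsum Z (\<lambda>a. finsum Z (\<lambda>b. r a \<odot>\<^bsub>Z\<^esub> (s b \<odot>\<^bsub>Z\<^esub> F a b)) ?B) ?A"
    unfolding lin_ext_def using AB F
    by (intro Z.M.finsum_cong' refl) (auto simp: Pi_iff intro!: Z.finsum_smult_ldistr)
  also have "\<dots> = finsum Z (\<lambda>b. finsum Z (\<lambda>a. r a \<odot>\<^bsub>Z\<^esub> (s b \<odot>\<^bsub>Z\<^esub> F a b)) ?A) ?B"
    using AB F by (intro finsum_swap assms(1)) auto
  also have "\<dots> = finsum Z (\<lambda>b. finsum Z (\<lambda>a. s b \<odot>\<^bsub>Z\<^esub> (r a \<odot>\<^bsub>Z\<^esub> F a b)) ?A) ?B"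
    using AB F by (intro Z.M.finsum_cong' refl) (auto simp: Pi_iff vs_smult_smult[OF assms(1)] mult.commute)
  also have "\<dots> = lin_ext Z (\<lambda>b. lin_ext Z (\<lambda>a. F a b) r) s"
    unfolding lin_ext_def using AB F
    by (intro Z.M.finsum_cong' refl) (auto simp: Pi_iff intro!: Z.finsum_smult_ldistr[symmetric])
  finally show ?thesis .
qed

lemma lin_ext_free_delta:
  assumes "r \<in> carrier (free_space B)"
  shows "lin_ext (free_space B) delta r = r"
proof
  fix b
  interpret c: module cplx cplx by (rule vs_cplx)
  have ev: "linear_map (free_space B) cplx (\<lambda>s. s b)"
    by (simp add: linear_map_def)
  have "lin_ext (free_space B) delta r b = lin_ext cplx (\<lambda>b'. delta b' b) r"
    by (rule lin_ext_map[OF vs_free_space vs_cplx ev assms]) (simp add: Pi_iff delta_def)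
  also have "\<dots> = finsum cplx (\<lambda>b'. if b = b' then r b' else 0) (insert b {b. r b \<noteq> 0})"
    using assms
    by (subst lin_ext_superset[of _ "insert b {b. r b \<noteq> 0}"])
      (auto simp: vs_cplx delta_def intro!: c.R.finsum_cong')
  also have "\<dots> = r b"
    using c.R.add.finprod_singleton[of b "insert b {b. r b \<noteq> 0}" r] assms
    by (simp cong: if_cong)
  finally show "lin_ext (free_space B) delta r b = r b" .
qed

text \<open>
  Uniqueness of linear extensions; it becomes the principle that linear maps out of a tensor product
  are compared on pure tensors.
\<close>

lemma linear_map_free_space:
  assumes "vspace Z" "linear_map (free_space B) Z g" "r \<in> carrier (free_space B)"
  shows "g r = lin_ext Z (\<lambda>b. g (delta b)) r"
  using lin_ext_map[OF vs_free_space assms(1,2,3), of delta]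
    delta_carrier[of _ B]
  by (simp add: lin_ext_free_delta[OF assms(3)] Pi_iff del: free_space_simps(1))


section \<open>Values of linear maps at combinations of generators\<close>

text \<open>
  This is all that has to be known about a coset \<open>t\<close> in order to compute with \<open>lift Z t f\<close> as with a finite
  sum over \<open>B\<close>: changing summands, moving linear maps inside and interchanging sums work for the chosen
  representative.  Multilinearity of \<open>f\<close> enters only when the value of the sum is to depend linearly on
  \<open>t\<close>.  The notion covers tensor products and tensor powers at once.
\<close>

definition combination :: "'b set \<Rightarrow> ('b \<Rightarrow> complex) set \<Rightarrow> bool" where
  "combination B t \<longleftrightarrow> t \<noteq> {} \<and> t \<subseteq> carrier (free_space B)"

lemma combination_some: "combination B t \<Longrightarrow> (SOME r. r \<in> t) \<in> carrier (free_space B)"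
  unfolding combination_def by (metis some_in_eq subsetD)

lemma lift_closed:
  assumes "combination B t" "vspace Z" "\<And>b. b \<in> B \<Longrightarrow> f b \<in> carrier Z"
  shows "lift Z t f \<in> carrier Z"
  unfolding lift_eq_lin_ext using assms by (intro lin_ext_closed[OF _ combination_some]) auto

lemma lift_cong:
  assumes "combination B t" "vspace Z" "\<And>b. b \<in> B \<Longrightarrow> f b = g b"
    "\<And>b. b \<in> B \<Longrightarrow> g b \<in> carrier Z"
  shows "lift Z t f = lift Z t g"
  unfolding lift_eq_lin_ext using assms by (intro lin_ext_cong[OF _ combination_some]) auto

lemma linear_map_lift:
  assumes "combination B t" "vspace Z" "vspace Z'" "linear_map Z Z' g" "\<And>b. b \<in> B \<Longrightarrow> f b \<in> carrier Z"
  shows "g (lift Z t f) = lift Z' t (\<lambda>b. g (f b))"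
  unfolding lift_eq_lin_ext using assms by (intro lin_ext_map[OF _ _ _ combination_some]) auto

lemma lift_family:
  assumes "combination B t" "vspace V" "vspace Z" "\<And>b. b \<in> B \<Longrightarrow> linear_map V Z (\<lambda>v. F v b)"
  shows "linear_map V Z (\<lambda>v. lift Z t (F v))"
  unfolding lift_eq_lin_ext using assms by (intro lin_ext_family[OF _ _ combination_some]) auto

lemma lift_swap:
  assumes "combination A s" "combination B t" "vspace Z"
    "\<And>a b. a \<in> A \<Longrightarrow> b \<in> B \<Longrightarrow> F a b \<in> carrier Z"
  shows "lift Z s (\<lambda>a. lift Z t (\<lambda>b. F a b)) = lift Z t (\<lambda>b. lift Z s (\<lambda>a. F a b))"
  unfolding lift_eq_lin_ext using assms
  by (intro lin_ext_swap[OF _ combination_some combination_some]) auto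

text \<open>
  A vector space presented by generators \<open>B\<close> and relators \<open>G\<close>.  Tensor products and tensor powers
  are both of this kind, and their universal properties are instances of the facts below.
\<close>

context
  fixes B :: "'b set" and G :: "('b \<Rightarrow> complex) set"
  assumes G: "G \<subseteq> carrier (free_space B)"
begin

private abbreviation "F \<equiv> free_space B"
private abbreviation "R \<equiv> lin_span (free_space B) G"

lemma submodule_relations: "submodule R cplx F"
  by (rule submodule_lin_span[OF vs_free_space G])

lemma vs_presented: "vspace (quot_space F R)"
  by (rule vs_quot_space[OF vs_free_space submodule_relations])

lemma combination_presented: "t \<in> carrier (quot_space F R) \<Longrightarrow> combination B t"
  unfolding combination_def carrier_quot_space[OF vs_free_space submodule_relations]
  using coset_self[OF vs_free_space submodule_relations]
    coset_mem_iff[OF vs_free_space submodule_relations] by blast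

lemma lift_presented:
  assumes Z: "vspace Z" and f: "\<And>b. b \<in> B \<Longrightarrow> f b \<in> carrier Z"
    and zero: "\<And>x. x \<in> G \<Longrightarrow> lin_ext Z f x = \<zero>\<^bsub>Z\<^esub>" and r: "r \<in> carrier F"
  shows "lift Z (R +>\<^bsub>F\<^esub> r) f = lin_ext Z f r"
proof -
  have lin: "linear_map F Z (lin_ext Z f)"
    using f by (intro linear_map_lin_ext[OF Z]) auto
  define s where "s = (SOME s. s \<in> R +>\<^bsub>F\<^esub> r)"
  have "s \<in> R +>\<^bsub>F\<^esub> r"
    unfolding s_def
    by (rule someI[where P = "\<lambda>s. s \<in> R +>\<^bsub>F\<^esub> r"]) (rule coset_self[OF vs_free_space submodule_relations r])
  then have s: "s \<in> carrier F" "s \<ominus>\<^bsub>F\<^esub> r \<in> R"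
    using coset_mem_iff[OF vs_free_space submodule_relations r] by auto
  have "lin_ext Z f (s \<ominus>\<^bsub>F\<^esub> r) \<in> {\<zero>\<^bsub>Z\<^esub>}"
    by (rule linear_map_lin_span[OF vs_free_space Z lin submodule_zero_space[OF Z] G _ s(2)])
      (simp add: zero)
  then have "lin_ext Z f s \<ominus>\<^bsub>Z\<^esub> lin_ext Z f r = \<zero>\<^bsub>Z\<^esub>"
    using linear_map_minus[OF vs_free_space Z lin s(1) r] by simp
  then have "lin_ext Z f s = lin_ext Z f r"
    using vs_minus_zero_iff[OF Z] linear_map_closed[OF lin s(1)] linear_map_closed[OF lin r] by blast
  then show ?thesis by (simp add: lift_eq_lin_ext s_def)
qed

lemma linear_map_lift_presented:
  assumes Z: "vspace Z" and f: "\<And>b. b \<in> B \<Longrightarrow> f b \<in> carrier Z"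
    and zero: "\<And>x. x \<in> G \<Longrightarrow> lin_ext Z f x = \<zero>\<^bsub>Z\<^esub>"
  shows "linear_map (quot_space F R) Z (\<lambda>t. lift Z t f)"
proof -
  have lin: "linear_map F Z (lin_ext Z f)"
    using f by (intro linear_map_lin_ext[OF Z]) auto
  note car = carrier_quot_space[OF vs_free_space submodule_relations]
  have lp: "lift Z (R +>\<^bsub>F\<^esub> r) f = lin_ext Z f r" if "r \<in> carrier F" for r
    by (rule lift_presented[OF Z f zero that])
  show ?thesis
  proof (rule linear_mapI)
    fix X assume "X \<in> carrier (quot_space F R)"
    then obtain r where r: "r \<in> carrier F" "X = R +>\<^bsub>F\<^esub> r" unfolding car by blast
    show "lift Z X f \<in> carrier Z" using lp[OF r(1)] r linear_map_closed[OF lin r(1)] by simp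
    show "lift Z (a \<odot>\<^bsub>quot_space F R\<^esub> X) f = a \<odot>\<^bsub>Z\<^esub> lift Z X f" for a
      unfolding r(2) smult_quot_space[OF vs_free_space submodule_relations r(1)] lp[OF r(1)]
        lp[OF vs_smult_closed[OF vs_free_space r(1)]]
      by (rule linear_map_smult[OF lin r(1)])
    fix Y assume "Y \<in> carrier (quot_space F R)"
    then obtain s where s: "s \<in> carrier F" "Y = R +>\<^bsub>F\<^esub> s" unfolding car by blast
    show "lift Z (X \<oplus>\<^bsub>quot_space F R\<^esub> Y) f = lift Z X f \<oplus>\<^bsub>Z\<^esub> lift Z Y f"
      unfolding r(2) s(2) add_quot_space[OF vs_free_space submodule_relations r(1) s(1)]
        lp[OF r(1)] lp[OF s(1)] lp[OF vs_add_closed[OF vs_free_space r(1) s(1)]]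
      by (rule linear_map_add[OF lin r(1) s(1)])
  qed
qed

lemma linear_map_presented_ext:
  assumes Z: "vspace Z" and "linear_map (quot_space F R) Z f" "linear_map (quot_space F R) Z g"
    and eq: "\<And>b. b \<in> B \<Longrightarrow> f (R +>\<^bsub>F\<^esub> delta b) = g (R +>\<^bsub>F\<^esub> delta b)"
    and X: "X \<in> carrier (quot_space F R)"
  shows "f X = g X"
proof -
  note q = linear_map_coset[OF vs_free_space submodule_relations]
  note f = linear_map_compose[OF assms(2) q] and g = linear_map_compose[OF assms(3) q]
  obtain r where r: "r \<in> carrier F" "X = R +>\<^bsub>F\<^esub> r"
    using X unfolding carrier_quot_space[OF vs_free_space submodule_relations] by blast
  have "f X = lin_ext Z (\<lambda>b. f (R +>\<^bsub>F\<^esub> delta b)) r"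
    unfolding r(2) by (rule linear_map_free_space[OF Z f r(1)])
  also have "\<dots> = lin_ext Z (\<lambda>b. g (R +>\<^bsub>F\<^esub> delta b)) r"
    by (rule lin_ext_cong[OF Z r(1)]) (rule eq linear_map_closed[OF g delta_carrier], assumption)+
  also have "\<dots> = g X"
    unfolding r(2) by (rule linear_map_free_space[OF Z g r(1), symmetric])
  finally show ?thesis .
qed

lemma coset_eqI:
  assumes "r \<in> carrier F" "s \<in> carrier F" "x \<in> R" "\<And>b. x b = r b - s b"
  shows "R +>\<^bsub>F\<^esub> r = R +>\<^bsub>F\<^esub> s"
proof -
  have "r \<ominus>\<^bsub>F\<^esub> s = x"
    using assms(4) by (subst vs_minus_eq[OF vs_free_space assms(1,2)]) (simp add: fun_eq_iff)
  then show ?thesis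
    using coset_eq_iff[OF vs_free_space submodule_relations assms(1,2)] assms(3) by simp
qed

end

section \<open>Tensor products and tensor powers\<close>

definition bilin ::
    "(complex, 'v, 'x) module_scheme \<Rightarrow> (complex, 'w, 'y) module_scheme \<Rightarrow>
     (complex, 'z, 'u) module_scheme \<Rightarrow> ('v \<Rightarrow> 'w \<Rightarrow> 'z) \<Rightarrow> bool" where
  "bilin V W Z f \<longleftrightarrow> (\<forall>w\<in>carrier W. linear_map V Z (\<lambda>v. f v w)) \<and> (\<forall>v\<in>carrier V. linear_map W Z (f v))"

lemma bilinI:
  assumes "\<And>w. w \<in> carrier W \<Longrightarrow> linear_map V Z (\<lambda>v. f v w)"
    and "\<And>v. v \<in> carrier V \<Longrightarrow> linear_map W Z (f v)"
  shows "bilin V W Z f"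
  using assms by (simp add: bilin_def)

lemma
  assumes "bilin V W Z f"
  shows bilin_left: "w \<in> carrier W \<Longrightarrow> linear_map V Z (\<lambda>v. f v w)"
    and bilin_right: "v \<in> carrier V \<Longrightarrow> linear_map W Z (f v)"
    and bilin_closed: "v \<in> carrier V \<Longrightarrow> w \<in> carrier W \<Longrightarrow> f v w \<in> carrier Z"
  using assms by (auto simp: bilin_def linear_map_def)

definition tensor_gens ::
    "(complex, 'v, 'x) module_scheme \<Rightarrow> (complex, 'w, 'y) module_scheme \<Rightarrow> ('v \<times> 'w \<Rightarrow> complex) set"
  where
  "tensor_gens V W =
     {\<lambda>p. delta (v \<oplus>\<^bsub>V\<^esub> v', w) p - delta (v, w) p - delta (v', w) p | v v' w.
         v \<in> carrier V \<and> v' \<in> carrier V \<and> w \<in> carrier W} \<union>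
      {\<lambda>p. delta (v, w \<oplus>\<^bsub>W\<^esub> w') p - delta (v, w) p - delta (v, w') p | v w w'.
         v \<in> carrier V \<and> w \<in> carrier W \<and> w' \<in> carrier W} \<union>
      {\<lambda>p. delta (a \<odot>\<^bsub>V\<^esub> v, w) p - a * delta (v, w) p | a v w. v \<in> carrier V \<and> w \<in> carrier W} \<union>
      {\<lambda>p. delta (v, a \<odot>\<^bsub>W\<^esub> w) p - a * delta (v, w) p | a v w. v \<in> carrier V \<and> w \<in> carrier W}"

lemma tensor_relations_eq:
  "tensor_relations V W = lin_span (free_space (carrier V \<times> carrier W)) (tensor_gens V W)"
  by (simp add: tensor_relations_def tensor_gens_def)

lemma delta_diff_carrier:
  assumes "a \<in> B" "b \<in> B" "c \<in> B"
  shows "(\<lambda>p. delta a p - delta b p - delta c p) \<in> carrier (free_space B)"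
    and "(\<lambda>p. delta a p - z * delta b p) \<in> carrier (free_space B)"
proof -
  have "{p. delta a p - delta b p - delta c p \<noteq> 0} \<subseteq> {a, b, c}"
    and "{p. delta a p - z * delta b p \<noteq> 0} \<subseteq> {a, b}"
    by (auto simp: delta_def split: if_splits)
  then show "(\<lambda>p. delta a p - delta b p - delta c p) \<in> carrier (free_space B)"
    and "(\<lambda>p. delta a p - z * delta b p) \<in> carrier (free_space B)"
    using assms by (auto intro: finite_subset)
qed

text \<open>
  Every relator of a tensor product or of a tensor power has one of these two shapes, expressing
  additivity or homogeneity in one argument.
\<close>

lemma lin_ext_delta_diff:
  assumes Z: "vspace Z" and B: "a \<in> B" "b \<in> B" "c \<in> B" and f: "\<And>b. b \<in> B \<Longrightarrow> f b \<in> carrier Z"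
  shows "f a = f b \<oplus>\<^bsub>Z\<^esub> f c \<Longrightarrow> lin_ext Z f (\<lambda>p. delta a p - delta b p - delta c p) = \<zero>\<^bsub>Z\<^esub>"
    and "f a = z \<odot>\<^bsub>Z\<^esub> f b \<Longrightarrow> lin_ext Z f (\<lambda>p. delta a p - z * delta b p) = \<zero>\<^bsub>Z\<^esub>"
proof -
  interpret Z: module cplx Z by (rule Z)
  let ?F = "free_space B"
  have lin: "linear_map ?F Z (lin_ext Z f)" using f by (intro linear_map_lin_ext[OF Z]) auto
  note d = delta_carrier[OF B(1)] delta_carrier[OF B(2)] delta_carrier[OF B(3)]
  note fs = lin_ext_delta[of Z f a, OF Z f[OF B(1)]] lin_ext_delta[of Z f b, OF Z f[OF B(2)]]
    lin_ext_delta[of Z f c, OF Z f[OF B(3)]]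
  have bc: "delta b \<oplus>\<^bsub>?F\<^esub> delta c \<in> carrier ?F" using d vs_add_closed[OF vs_free_space] by blast
  have zb: "z \<odot>\<^bsub>?F\<^esub> delta b \<in> carrier ?F" using d vs_smult_closed[OF vs_free_space] by blast
  have 1: "(\<lambda>p. delta a p - delta b p - delta c p) = delta a \<ominus>\<^bsub>?F\<^esub> (delta b \<oplus>\<^bsub>?F\<^esub> delta c)"
    by (subst vs_minus_eq[OF vs_free_space d(1) bc]) (simp add: fun_eq_iff)
  have 2: "(\<lambda>p. delta a p - z * delta b p) = delta a \<ominus>\<^bsub>?F\<^esub> (z \<odot>\<^bsub>?F\<^esub> delta b)"
    by (subst vs_minus_eq[OF vs_free_space d(1) zb]) (simp add: fun_eq_iff)
  have zero: "x \<ominus>\<^bsub>Z\<^esub> x = \<zero>\<^bsub>Z\<^esub>" if "x \<in> carrier Z" for x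
    using vs_minus_zero_iff[OF Z that that] by simp
  show "lin_ext Z f (\<lambda>p. delta a p - delta b p - delta c p) = \<zero>\<^bsub>Z\<^esub>" if "f a = f b \<oplus>\<^bsub>Z\<^esub> f c"
    unfolding 1 linear_map_minus[OF vs_free_space Z lin d(1) bc] linear_map_add[OF lin d(2,3)] fs
    using that zero[OF f[OF B(1)]] by simp
  show "lin_ext Z f (\<lambda>p. delta a p - z * delta b p) = \<zero>\<^bsub>Z\<^esub>" if "f a = z \<odot>\<^bsub>Z\<^esub> f b"
    unfolding 2 linear_map_minus[OF vs_free_space Z lin d(1) zb] linear_map_smult[OF lin d(2)] fs
    using that zero[OF f[OF B(1)]] by simp
qed

text \<open>
  Conversely, the cosets of basis elements in a presented space satisfy the identities that the
  relators express, because the two sides differ by an element of the span.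
\<close>

lemma coset_delta_diff:
  assumes G: "G \<subseteq> carrier (free_space B)" and B: "a \<in> B" "b \<in> B" "c \<in> B"
  shows "(\<lambda>p. delta a p - delta b p - delta c p) \<in> G \<Longrightarrow>
      lin_span (free_space B) G +>\<^bsub>free_space B\<^esub> delta a =
      (lin_span (free_space B) G +>\<^bsub>free_space B\<^esub> delta b)
        \<oplus>\<^bsub>quot_space (free_space B) (lin_span (free_space B) G)\<^esub>
      (lin_span (free_space B) G +>\<^bsub>free_space B\<^esub> delta c)"
    and "(\<lambda>p. delta a p - z * delta b p) \<in> G \<Longrightarrow>
      lin_span (free_space B) G +>\<^bsub>free_space B\<^esub> delta a =
      z \<odot>\<^bsub>quot_space (free_space B) (lin_span (free_space B) G)\<^esub>
        (lin_span (free_space B) G +>\<^bsub>free_space B\<^esub> delta b)"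
proof -
  let ?F = "free_space B"
  note sub = submodule_relations[OF G]
  note d = delta_carrier[OF B(1)] delta_carrier[OF B(2)] delta_carrier[OF B(3)]
  show "lin_span ?F G +>\<^bsub>?F\<^esub> delta a = (lin_span ?F G +>\<^bsub>?F\<^esub> delta b)
      \<oplus>\<^bsub>quot_space ?F (lin_span ?F G)\<^esub> (lin_span ?F G +>\<^bsub>?F\<^esub> delta c)"
    if "(\<lambda>p. delta a p - delta b p - delta c p) \<in> G"
    unfolding add_quot_space[OF vs_free_space sub d(2,3)]
    by (rule coset_eqI[OF G d(1) vs_add_closed[OF vs_free_space d(2,3)] subsetD[OF lin_span_superset that]])
      simp
  show "lin_span ?F G +>\<^bsub>?F\<^esub> delta a =
      z \<odot>\<^bsub>quot_space ?F (lin_span ?F G)\<^esub> (lin_span ?F G +>\<^bsub>?F\<^esub> delta b)"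
    if "(\<lambda>p. delta a p - z * delta b p) \<in> G"
    unfolding smult_quot_space[OF vs_free_space sub d(2)]
    by (rule coset_eqI[OF G d(1) vs_smult_closed[OF vs_free_space d(2)] subsetD[OF lin_span_superset that]])
      simp
qed

context
  fixes V :: "(complex, 'v, 'x) module_scheme" and W :: "(complex, 'w, 'y) module_scheme"
  assumes V: "vspace V" and W: "vspace W"
begin

lemma tensor_gens_carrier: "tensor_gens V W \<subseteq> carrier (free_space (carrier V \<times> carrier W))"
  unfolding tensor_gens_def
  by (auto simp del: free_space_simps(1)
      intro!: delta_diff_carrier simp: vs_add_closed vs_smult_closed V W)

lemma vs_tensor: "vspace (tensor V W)"
  unfolding tensor_def tensor_relations_eq by (rule vs_presented[OF tensor_gens_carrier])

lemma combination_tensor: "t \<in> carrier (tensor V W) \<Longrightarrow> combination (carrier V \<times> carrier W) t"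
  unfolding tensor_def tensor_relations_eq by (rule combination_presented[OF tensor_gens_carrier])

lemma bilin_pure_tensor: "bilin V W (tensor V W) (pure_tensor V W)"
proof -
  note eqs = coset_delta_diff[OF tensor_gens_carrier]
  have closed: "pure_tensor V W v w \<in> carrier (tensor V W)" if "v \<in> carrier V" "w \<in> carrier W" for v w
    unfolding pure_tensor_def tensor_def tensor_relations_eq
      carrier_quot_space[OF vs_free_space submodule_relations[OF tensor_gens_carrier]]
    using that by (intro imageI delta_carrier) simp
  have gens:
    "(\<lambda>p. delta (v \<oplus>\<^bsub>V\<^esub> v', w) p - delta (v, w) p - delta (v', w) p) \<in> tensor_gens V W"
    "(\<lambda>p. delta (a \<odot>\<^bsub>V\<^esub> v, w) p - a * delta (v, w) p) \<in> tensor_gens V W"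
    "(\<lambda>p. delta (v, w \<oplus>\<^bsub>W\<^esub> w') p - delta (v, w) p - delta (v, w') p) \<in> tensor_gens V W"
    "(\<lambda>p. delta (v, a \<odot>\<^bsub>W\<^esub> w) p - a * delta (v, w) p) \<in> tensor_gens V W"
    if "v \<in> carrier V" "v' \<in> carrier V" "w \<in> carrier W" "w' \<in> carrier W" for v v' w w' a
    using that unfolding tensor_gens_def by blast+
  show ?thesis
  proof (intro bilinI linear_mapI closed; (assumption)?)
    fix v v' w a assume "v \<in> carrier V" "v' \<in> carrier V" "w \<in> carrier W"
    then show "pure_tensor V W (v \<oplus>\<^bsub>V\<^esub> v') w =
        pure_tensor V W v w \<oplus>\<^bsub>tensor V W\<^esub> pure_tensor V W v' w"
      unfolding pure_tensor_def tensor_def tensor_relations_eq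
      by (intro eqs(1) gens(1)[of v v' w w]) (simp_all add: V vs_add_closed)
  next
    fix v w a assume "v \<in> carrier V" "w \<in> carrier W"
    then show "pure_tensor V W (a \<odot>\<^bsub>V\<^esub> v) w = a \<odot>\<^bsub>tensor V W\<^esub> pure_tensor V W v w"
      unfolding pure_tensor_def tensor_def tensor_relations_eq
      by (intro eqs(2)[where c = "(v, w)"] gens(2)[of v v w w]) (simp_all add: V vs_smult_closed)
  next
    fix v w w' assume "v \<in> carrier V" "w \<in> carrier W" "w' \<in> carrier W"
    then show "pure_tensor V W v (w \<oplus>\<^bsub>W\<^esub> w') =
        pure_tensor V W v w \<oplus>\<^bsub>tensor V W\<^esub> pure_tensor V W v w'"
      unfolding pure_tensor_def tensor_def tensor_relations_eq
      by (intro eqs(1) gens(3)[of v v w w']) (simp_all add: W vs_add_closed)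
  next
    fix v w a assume "v \<in> carrier V" "w \<in> carrier W"
    then show "pure_tensor V W v (a \<odot>\<^bsub>W\<^esub> w) = a \<odot>\<^bsub>tensor V W\<^esub> pure_tensor V W v w"
      unfolding pure_tensor_def tensor_def tensor_relations_eq
      by (intro eqs(2)[where c = "(v, w)"] gens(4)[of v v w w]) (simp_all add: W vs_smult_closed)
  qed
qed

lemma pure_tensor_closed:
  "v \<in> carrier V \<Longrightarrow> w \<in> carrier W \<Longrightarrow> pure_tensor V W v w \<in> carrier (tensor V W)"
  using bilin_pure_tensor by (rule bilin_closed)

context
  fixes Z :: "(complex, 'z, 'u) module_scheme" and f
  assumes Z: "vspace Z" and f: "bilin V W Z f"
begin

lemma lin_ext_tensor_gens:
  assumes "x \<in> tensor_gens V W"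
  shows "lin_ext Z (case_prod f) x = \<zero>\<^bsub>Z\<^esub>"
proof -
  have car: "case_prod f b \<in> carrier Z" if "b \<in> carrier V \<times> carrier W" for b
    using that bilin_closed[OF f] by auto
  have l: "f (v \<oplus>\<^bsub>V\<^esub> v') w = f v w \<oplus>\<^bsub>Z\<^esub> f v' w" "f (a \<odot>\<^bsub>V\<^esub> v) w = a \<odot>\<^bsub>Z\<^esub> f v w"
    if "v \<in> carrier V" "v' \<in> carrier V" "w \<in> carrier W" for v v' w a
    using bilin_left[OF f that(3)] that by (simp_all add: linear_map_def)
  have r: "f v (w \<oplus>\<^bsub>W\<^esub> w') = f v w \<oplus>\<^bsub>Z\<^esub> f v w'" "f v (a \<odot>\<^bsub>W\<^esub> w) = a \<odot>\<^bsub>Z\<^esub> f v w"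
    if "v \<in> carrier V" "w \<in> carrier W" "w' \<in> carrier W" for v w w' a
    using bilin_right[OF f that(1)] that by (simp_all add: linear_map_def)
  note rules = lin_ext_delta_diff[where B = "carrier V \<times> carrier W" and f = "case_prod f", OF Z _ _ _ car]
  consider
      (1) v v' w where "x = (\<lambda>p. delta (v \<oplus>\<^bsub>V\<^esub> v', w) p - delta (v, w) p - delta (v', w) p)"
        "v \<in> carrier V" "v' \<in> carrier V" "w \<in> carrier W"
    | (2) v w w' where "x = (\<lambda>p. delta (v, w \<oplus>\<^bsub>W\<^esub> w') p - delta (v, w) p - delta (v, w') p)"
        "v \<in> carrier V" "w \<in> carrier W" "w' \<in> carrier W"
    | (3) a v w where "x = (\<lambda>p. delta (a \<odot>\<^bsub>V\<^esub> v, w) p - a * delta (v, w) p)"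
        "v \<in> carrier V" "w \<in> carrier W"
    | (4) a v w where "x = (\<lambda>p. delta (v, a \<odot>\<^bsub>W\<^esub> w) p - a * delta (v, w) p)"
        "v \<in> carrier V" "w \<in> carrier W"
    using assms unfolding tensor_gens_def by blast
  then show ?thesis
  proof cases
    case 1
    show ?thesis unfolding 1(1) by (rule rules(1)) (use 1 in \<open>simp_all add: l V vs_add_closed\<close>)
  next
    case 2
    show ?thesis unfolding 2(1) by (rule rules(1)) (use 2 in \<open>simp_all add: r W vs_add_closed\<close>)
  next
    case 3
    show ?thesis unfolding 3(1)
      by (rule rules(2)[where c = "(v, w)"]) (use 3 in \<open>auto simp: l V vs_smult_closed\<close>)
  next
    case 4
    show ?thesis unfolding 4(1)
      by (rule rules(2)[where c = "(v, w)"]) (use 4 in \<open>auto simp: r W vs_smult_closed\<close>)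
  qed
qed

lemma bilin_case_prod_closed: "p \<in> carrier V \<times> carrier W \<Longrightarrow> case_prod f p \<in> carrier Z"
  using bilin_closed[OF f] by auto

lemma linear_map_lift_tensor: "linear_map (tensor V W) Z (\<lambda>t. lift Z t (case_prod f))"
  unfolding tensor_def tensor_relations_eq
  by (rule linear_map_lift_presented[OF tensor_gens_carrier Z])
    (rule bilin_case_prod_closed lin_ext_tensor_gens, assumption)+

lemma lift_pure_tensor:
  assumes "v \<in> carrier V" "w \<in> carrier W"
  shows "lift Z (pure_tensor V W v w) (case_prod f) = f v w"
proof -
  have vw: "(v, w) \<in> carrier V \<times> carrier W" using assms by simp
  have "lift Z (pure_tensor V W v w) (case_prod f) = lin_ext Z (case_prod f) (delta (v, w))"
    unfolding pure_tensor_def tensor_relations_eq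
    by (rule lift_presented[OF tensor_gens_carrier Z _ _ delta_carrier[OF vw]])
      (rule bilin_case_prod_closed lin_ext_tensor_gens, assumption)+
  also have "\<dots> = f v w"
    using bilin_closed[OF f] assms by (subst lin_ext_delta[OF Z]) auto
  finally show ?thesis .
qed

end

lemma tensor_ext:
  assumes "vspace Z" "linear_map (tensor V W) Z f" "linear_map (tensor V W) Z g"
    "\<And>v w. v \<in> carrier V \<Longrightarrow> w \<in> carrier W \<Longrightarrow> f (pure_tensor V W v w) = g (pure_tensor V W v w)"
    "t \<in> carrier (tensor V W)"
  shows "f t = g t"
  using assms(4)
  by (intro linear_map_presented_ext[OF tensor_gens_carrier assms(1)
        assms(2,3)[unfolded tensor_def tensor_relations_eq] _
        assms(5)[unfolded tensor_def tensor_relations_eq]])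
    (auto simp: pure_tensor_def tensor_relations_eq)

lemma lift_tensor_closed:
  assumes "t \<in> carrier (tensor V W)" "vspace Z"
    "\<And>v w. v \<in> carrier V \<Longrightarrow> w \<in> carrier W \<Longrightarrow> f v w \<in> carrier Z"
  shows "lift Z t (case_prod f) \<in> carrier Z"
  using assms by (intro lift_closed[OF combination_tensor]) auto

lemma lift_tensor_cong:
  assumes "t \<in> carrier (tensor V W)" "vspace Z"
    "\<And>v w. v \<in> carrier V \<Longrightarrow> w \<in> carrier W \<Longrightarrow> f v w = g v w"
    "\<And>v w. v \<in> carrier V \<Longrightarrow> w \<in> carrier W \<Longrightarrow> g v w \<in> carrier Z"
  shows "lift Z t (case_prod f) = lift Z t (case_prod g)"
  using assms by (intro lift_cong[OF combination_tensor]) auto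

lemma lift_tensor_push:
  assumes "linear_map Z Z' g" "vspace Z" "vspace Z'" "t \<in> carrier (tensor V W)"
    "\<And>v w. v \<in> carrier V \<Longrightarrow> w \<in> carrier W \<Longrightarrow> f v w \<in> carrier Z"
  shows "g (lift Z t (case_prod f)) = lift Z' t (\<lambda>(v, w). g (f v w))"
  using assms by (subst linear_map_lift[OF combination_tensor, of t Z Z' g]) (auto simp: case_prod_unfold)

lemma lift_tensor_family:
  assumes "t \<in> carrier (tensor V W)" "vspace U" "vspace Z"
    "\<And>v w. v \<in> carrier V \<Longrightarrow> w \<in> carrier W \<Longrightarrow> linear_map U Z (\<lambda>u. F u v w)"
  shows "linear_map U Z (\<lambda>u. lift Z t (case_prod (F u)))"
  using assms by (intro lift_family[OF combination_tensor]) (auto simp: case_prod_unfold)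

lemma tensor_eta: "t \<in> carrier (tensor V W) \<Longrightarrow> lift (tensor V W) t (case_prod (pure_tensor V W)) = t"
  by (rule tensor_ext[of "tensor V W" "\<lambda>t. lift (tensor V W) t (case_prod (pure_tensor V W))" "\<lambda>t. t"])
    (assumption | rule vs_tensor linear_map_lift_tensor bilin_pure_tensor linear_map_id lift_pure_tensor)+

end

text \<open>
  Two Sweedler sums over independent tensors commute: for the chosen representatives both sides are the
  same finite double sum.
\<close>

lemma lift_tensor_swap:
  assumes "vspace V" "vspace W" "vspace V'" "vspace W'" "s \<in> carrier (tensor V W)" "t \<in> carrier (tensor V' W')" "vspace Z"
    "\<And>v w v' w'. v \<in> carrier V \<Longrightarrow> w \<in> carrier W \<Longrightarrow> v' \<in> carrier V' \<Longrightarrow> w' \<in> carrier W' \<Longrightarrow>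
      F v w v' w' \<in> carrier Z"
  shows "lift Z s (\<lambda>(v, w). lift Z t (\<lambda>(v', w'). F v w v' w')) =
    lift Z t (\<lambda>(v', w'). lift Z s (\<lambda>(v, w). F v w v' w'))"
  using lift_swap[OF combination_tensor[OF assms(1,2,5)] combination_tensor[OF assms(3,4,6)] assms(7),
      of "\<lambda>p q. F (fst p) (snd p) (fst q) (snd q)"] assms(8)
  by (force simp: case_prod_unfold)

definition power_gens :: "(complex, 'v, 'x) module_scheme \<Rightarrow> nat \<Rightarrow> ('v list \<Rightarrow> complex) set" where
  "power_gens V n =
     {\<lambda>p. delta (vs[i := v \<oplus>\<^bsub>V\<^esub> v']) p - delta (vs[i := v]) p - delta (vs[i := v']) p | vs i v v'.
         vs \<in> power_lists V n \<and> i < n \<and> v \<in> carrier V \<and> v' \<in> carrier V} \<union>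
      {\<lambda>p. delta (vs[i := a \<odot>\<^bsub>V\<^esub> v]) p - a * delta (vs[i := v]) p | vs i a v.
         vs \<in> power_lists V n \<and> i < n \<and> v \<in> carrier V}"

lemma power_relations_eq:
  "power_relations V n = lin_span (free_space (power_lists V n)) (power_gens V n)"
  by (simp add: power_relations_def power_gens_def)

lemma
  assumes "vs \<in> power_lists V n" "i < n" "v \<in> carrier V"
  shows power_gens_add: "v' \<in> carrier V \<Longrightarrow>
      (\<lambda>p. delta (vs[i := v \<oplus>\<^bsub>V\<^esub> v']) p - delta (vs[i := v]) p - delta (vs[i := v']) p) \<in> power_gens V n"
    and power_gens_smult:
      "(\<lambda>p. delta (vs[i := a \<odot>\<^bsub>V\<^esub> v]) p - a * delta (vs[i := v]) p) \<in> power_gens V n"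
  using assms unfolding power_gens_def by blast+

lemma power_lists_update: "vs \<in> power_lists V n \<Longrightarrow> v \<in> carrier V \<Longrightarrow> vs[i := v] \<in> power_lists V n"
  using set_update_subset_insert[of vs i v] by (auto simp: power_lists_def)

text \<open>
  The varying entry is displayed by splitting the list instead of by \<^const>\<open>list_update\<close>, because
  the lists that occur are built by consing and appending.
\<close>

definition mlin ::
    "(complex, 'v, 'x) module_scheme \<Rightarrow> nat \<Rightarrow> (complex, 'z, 'u) module_scheme \<Rightarrow> ('v list \<Rightarrow> 'z) \<Rightarrow> bool"
  where
  "mlin V n Z f \<longleftrightarrow>
     (\<forall>vs\<in>power_lists V n. f vs \<in> carrier Z) \<and>
     (\<forall>xs ys. set xs \<subseteq> carrier V \<longrightarrow> set ys \<subseteq> carrier V \<longrightarrow> n = Suc (length xs + length ys) \<longrightarrow>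
        linear_map V Z (\<lambda>v. f (xs @ v # ys)))"

lemma mlinI:
  assumes "\<And>vs. vs \<in> power_lists V n \<Longrightarrow> f vs \<in> carrier Z"
    and "\<And>xs ys. set xs \<subseteq> carrier V \<Longrightarrow> set ys \<subseteq> carrier V \<Longrightarrow> n = Suc (length xs + length ys) \<Longrightarrow>
      linear_map V Z (\<lambda>v. f (xs @ v # ys))"
  shows "mlin V n Z f"
  using assms by (simp add: mlin_def)

lemma mlin_closed: "mlin V n Z f \<Longrightarrow> vs \<in> power_lists V n \<Longrightarrow> f vs \<in> carrier Z"
  by (simp add: mlin_def)

lemma mlin_update:
  assumes "mlin V n Z f" "vs \<in> power_lists V n" "i < n"
  shows "linear_map V Z (\<lambda>v. f (vs[i := v]))"
proof -
  have "set (take i vs) \<subseteq> carrier V" "set (drop (Suc i) vs) \<subseteq> carrier V"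
    "n = Suc (length (take i vs) + length (drop (Suc i) vs))"
    using assms(2,3) set_take_subset[of i vs] set_drop_subset[of "Suc i" vs]
    by (auto simp: power_lists_def)
  then have "linear_map V Z (\<lambda>v. f (take i vs @ v # drop (Suc i) vs))"
    using assms(1) unfolding mlin_def by blast
  then show ?thesis
    using assms(2,3) by (simp add: upd_conv_take_nth_drop power_lists_def)
qed

context
  fixes V :: "(complex, 'v, 'x) module_scheme"
  assumes V: "vspace V"
begin

lemma power_gens_carrier: "power_gens V n \<subseteq> carrier (free_space (power_lists V n))"
  unfolding power_gens_def
  by (auto simp del: free_space_simps(1)
      intro!: delta_diff_carrier power_lists_update simp: vs_add_closed vs_smult_closed V)

lemma vs_tensor_power: "vspace (tensor_power V n)"
  unfolding tensor_power_def power_relations_eq by (rule vs_presented[OF power_gens_carrier])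

lemma combination_power: "t \<in> carrier (tensor_power V n) \<Longrightarrow> combination (power_lists V n) t"
  unfolding tensor_power_def power_relations_eq by (rule combination_presented[OF power_gens_carrier])

lemma pure_power_closed: "vs \<in> power_lists V n \<Longrightarrow> pure_power V vs \<in> carrier (tensor_power V n)"
proof -
  assume vs: "vs \<in> power_lists V n"
  then have "length vs = n" by (simp add: power_lists_def)
  show ?thesis
    unfolding pure_power_def tensor_power_def power_relations_eq \<open>length vs = n\<close>
      carrier_quot_space[OF vs_free_space submodule_relations[OF power_gens_carrier]]
    by (intro imageI delta_carrier vs)
qed

lemma mlin_pure_power: "mlin V n (tensor_power V n) (pure_power V)"
proof (rule mlinI)
  fix xs ys assume xy: "set xs \<subseteq> carrier V" "set ys \<subseteq> carrier V" and n: "n = Suc (length xs + length ys)"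
  define ws where "ws v = xs @ v # ys" for v
  have ws: "ws v \<in> power_lists V n" if "v \<in> carrier V" for v
    using xy n that by (simp add: ws_def power_lists_def)
  have upd: "ws v = (ws \<zero>\<^bsub>V\<^esub>)[length xs := v]" for v by (simp add: ws_def)
  have len: "length (ws v) = n" for v by (simp add: ws_def n)
  have ws0: "ws \<zero>\<^bsub>V\<^esub> \<in> power_lists V n" using V by (intro ws vs_zero_closed)
  note eqs = coset_delta_diff[OF power_gens_carrier ws ws ws]
  show "linear_map V (tensor_power V n) (\<lambda>v. pure_power V (xs @ v # ys))"
    unfolding ws_def[symmetric]
  proof (rule linear_mapI)
    fix v assume v: "v \<in> carrier V"
    show "pure_power V (ws v) \<in> carrier (tensor_power V n)" by (rule pure_power_closed[OF ws[OF v]])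
    show "pure_power V (ws (a \<odot>\<^bsub>V\<^esub> v)) = a \<odot>\<^bsub>tensor_power V n\<^esub> pure_power V (ws v)" for a
    proof -
      have "(\<lambda>p. delta (ws (a \<odot>\<^bsub>V\<^esub> v)) p - a * delta (ws v) p) \<in> power_gens V n"
        using power_gens_smult[OF ws0 _ v, of "length xs" a] upd[symmetric] n by simp
      then show ?thesis
        unfolding pure_power_def tensor_power_def power_relations_eq len
        using V v by (intro eqs(2)) (auto simp: vs_smult_closed)
    qed
    fix v' assume v': "v' \<in> carrier V"
    have "(\<lambda>p. delta (ws (v \<oplus>\<^bsub>V\<^esub> v')) p - delta (ws v) p - delta (ws v') p) \<in> power_gens V n"
      using power_gens_add[OF ws0 _ v v', of "length xs"] upd[symmetric] n by simp
    then show "pure_power V (ws (v \<oplus>\<^bsub>V\<^esub> v')) =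
        pure_power V (ws v) \<oplus>\<^bsub>tensor_power V n\<^esub> pure_power V (ws v')"
      unfolding pure_power_def tensor_power_def power_relations_eq len
      using V v v' by (intro eqs(1)) (auto simp: vs_add_closed)
  qed
qed (rule pure_power_closed)

context
  fixes Z :: "(complex, 'z, 'u) module_scheme" and f n
  assumes Z: "vspace Z" and f: "mlin V n Z f"
begin

lemma lin_ext_power_gens:
  assumes "x \<in> power_gens V n"
  shows "lin_ext Z f x = \<zero>\<^bsub>Z\<^esub>"
proof -
  have l: "f (vs[i := v \<oplus>\<^bsub>V\<^esub> v']) = f (vs[i := v]) \<oplus>\<^bsub>Z\<^esub> f (vs[i := v'])"
    "f (vs[i := a \<odot>\<^bsub>V\<^esub> v]) = a \<odot>\<^bsub>Z\<^esub> f (vs[i := v])"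
    if "vs \<in> power_lists V n" "i < n" "v \<in> carrier V" "v' \<in> carrier V" for vs i v v' a
    using mlin_update[OF f that(1,2)] that by (simp_all add: linear_map_def)
  note rules = lin_ext_delta_diff[where B = "power_lists V n" and f = f, OF Z _ _ _ mlin_closed[OF f]]
  consider
      (1) vs i v v' where
        "x = (\<lambda>p. delta (vs[i := v \<oplus>\<^bsub>V\<^esub> v']) p - delta (vs[i := v]) p - delta (vs[i := v']) p)"
        "vs \<in> power_lists V n" "i < n" "v \<in> carrier V" "v' \<in> carrier V"
    | (2) vs i a v where "x = (\<lambda>p. delta (vs[i := a \<odot>\<^bsub>V\<^esub> v]) p - a * delta (vs[i := v]) p)"
        "vs \<in> power_lists V n" "i < n" "v \<in> carrier V"
    using assms unfolding power_gens_def by blast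
  then show ?thesis
  proof cases
    case 1
    show ?thesis unfolding 1(1)
      by (rule rules(1)) (use 1 in \<open>simp_all add: l power_lists_update V vs_add_closed\<close>)
  next
    case 2
    show ?thesis unfolding 2(1)
      by (rule rules(2)[where c = "vs[i := v]"])
        (use 2 in \<open>simp_all add: l power_lists_update V vs_smult_closed\<close>)
  qed
qed

lemma linear_map_lift_power: "linear_map (tensor_power V n) Z (\<lambda>t. lift Z t f)"
  unfolding tensor_power_def power_relations_eq
  by (rule linear_map_lift_presented[OF power_gens_carrier Z])
    (rule mlin_closed[OF f] lin_ext_power_gens, assumption)+

lemma lift_pure_power:
  assumes "vs \<in> power_lists V n"
  shows "lift Z (pure_power V vs) f = f vs"
proof -
  have n: "length vs = n" using assms by (simp add: power_lists_def)
  have "lift Z (pure_power V vs) f = lin_ext Z f (delta vs)"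
    unfolding pure_power_def power_relations_eq n
    by (rule lift_presented[OF power_gens_carrier Z _ _ delta_carrier[OF assms]])
      (rule mlin_closed[OF f] lin_ext_power_gens, assumption)+
  also have "\<dots> = f vs"
    using mlin_closed[OF f] assms by (subst lin_ext_delta[OF Z]) auto
  finally show ?thesis .
qed

end

lemma power_ext:
  assumes "vspace Z" "linear_map (tensor_power V n) Z f" "linear_map (tensor_power V n) Z g"
    "\<And>vs. vs \<in> power_lists V n \<Longrightarrow> f (pure_power V vs) = g (pure_power V vs)"
    "t \<in> carrier (tensor_power V n)"
  shows "f t = g t"
proof -
  have "f (power_relations V n +>\<^bsub>free_space (power_lists V n)\<^esub> delta vs) =
      g (power_relations V n +>\<^bsub>free_space (power_lists V n)\<^esub> delta vs)" if "vs \<in> power_lists V n" for vs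
    using assms(4)[OF that] that by (simp add: pure_power_def power_lists_def)
  then show ?thesis
    by (intro linear_map_presented_ext[OF power_gens_carrier assms(1)
          assms(2,3)[unfolded tensor_power_def power_relations_eq] _
          assms(5)[unfolded tensor_power_def power_relations_eq]])
      (simp add: power_relations_eq)
qed

lemma lift_power_closed:
  assumes "t \<in> carrier (tensor_power V n)" "vspace Z" "\<And>vs. vs \<in> power_lists V n \<Longrightarrow> f vs \<in> carrier Z"
  shows "lift Z t f \<in> carrier Z"
  using assms by (intro lift_closed[OF combination_power]) auto

lemma lift_power_cong:
  assumes "t \<in> carrier (tensor_power V n)" "vspace Z" "\<And>vs. vs \<in> power_lists V n \<Longrightarrow> f vs = g vs"
    "\<And>vs. vs \<in> power_lists V n \<Longrightarrow> g vs \<in> carrier Z"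
  shows "lift Z t f = lift Z t g"
  using assms by (intro lift_cong[OF combination_power]) auto

lemma lift_power_push:
  assumes "linear_map Z Z' g" "vspace Z" "vspace Z'" "t \<in> carrier (tensor_power V n)"
    "\<And>vs. vs \<in> power_lists V n \<Longrightarrow> f vs \<in> carrier Z"
  shows "g (lift Z t f) = lift Z' t (\<lambda>vs. g (f vs))"
  using assms by (intro linear_map_lift[OF combination_power]) auto

lemma lift_power_family:
  assumes "t \<in> carrier (tensor_power V n)" "vspace U" "vspace Z"
    "\<And>vs. vs \<in> power_lists V n \<Longrightarrow> linear_map U Z (\<lambda>u. F u vs)"
  shows "linear_map U Z (\<lambda>u. lift Z t (F u))"
  using assms by (intro lift_family[OF combination_power]) auto

lemma power_eta: "t \<in> carrier (tensor_power V n) \<Longrightarrow> lift (tensor_power V n) t (pure_power V) = t"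
  by (rule power_ext[of "tensor_power V n" n "\<lambda>t. lift (tensor_power V n) t (pure_power V)" "\<lambda>t. t"])
    (assumption | rule vs_tensor_power linear_map_lift_power mlin_pure_power linear_map_id lift_pure_power)+

end

lemma lift_tensor_power_swap:
  assumes "vspace V" "vspace W" "vspace V'" "s \<in> carrier (tensor V W)" "t \<in> carrier (tensor_power V' n)" "vspace Z"
    "\<And>v w vs. v \<in> carrier V \<Longrightarrow> w \<in> carrier W \<Longrightarrow> vs \<in> power_lists V' n \<Longrightarrow> F v w vs \<in> carrier Z"
  shows "lift Z s (\<lambda>(v, w). lift Z t (\<lambda>vs. F v w vs)) = lift Z t (\<lambda>vs. lift Z s (\<lambda>(v, w). F v w vs))"
  using lift_swap[OF combination_tensor[OF assms(1,2,4)] combination_power[OF assms(3,5)] assms(6),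
      of "\<lambda>p vs. F (fst p) (snd p) vs"] assms(7)
  by (force simp: case_prod_unfold)

lemma lift_power_swap:
  assumes "vspace V" "vspace V'" "s \<in> carrier (tensor_power V m)" "t \<in> carrier (tensor_power V' n)" "vspace Z"
    "\<And>us vs. us \<in> power_lists V m \<Longrightarrow> vs \<in> power_lists V' n \<Longrightarrow> F us vs \<in> carrier Z"
  shows "lift Z s (\<lambda>us. lift Z t (\<lambda>vs. F us vs)) = lift Z t (\<lambda>vs. lift Z s (\<lambda>us. F us vs))"
  using assms(6) by (intro lift_swap[OF combination_power[OF assms(1,3)] combination_power[OF assms(2,4)] assms(5)])

section \<open>Rules for closedness and linearity\<close>

text \<open>
  The rules in both collections are directed by syntax: the outermost operation and the position of the
  bound variable determine the rule, so that repeated resolution proves closedness and linearity of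
  nested Sweedler sums.  Premises are ordered such that the one that fixes an intermediate space comes
  first.
\<close>

named_theorems closed_rules
named_theorems linear_rules

lemmas [closed_rules] =
  vs_cplx vs_tensor vs_tensor_power vs_zero_closed vs_add_closed vs_minus_closed vs_smult_closed
  lift_tensor_closed[rotated 2] lift_power_closed[rotated 1]
  pure_tensor_closed[rotated 2] pure_power_closed[rotated 1]

lemmas [linear_rules] =
  bilinI linear_map_id linear_map_plus[rotated 1] linear_map_scale[rotated 1]
  linear_map_smult_left[rotated 1]
  lift_tensor_family[rotated 2] lift_power_family[rotated 1]

lemma linear_map_lift_tensor_compose [linear_rules]:
  assumes "linear_map U (tensor V W) g" "bilin V W Z F" "vspace V" "vspace W" "vspace Z"
  shows "linear_map U Z (\<lambda>u. lift Z (g u) (case_prod F))"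
  by (rule linear_map_compose[OF linear_map_lift_tensor[OF assms(3,4,5,2)] assms(1)])

lemma linear_map_lift_power_compose [linear_rules]:
  assumes "linear_map U (tensor_power V n) g" "mlin V n Z F" "vspace V" "vspace Z"
  shows "linear_map U Z (\<lambda>u. lift Z (g u) F)"
  by (rule linear_map_compose[OF linear_map_lift_power[OF assms(3,4,2)] assms(1)])

lemma linear_map_pure_tensor_left [linear_rules]:
  assumes "linear_map U V g" "w \<in> carrier W" "vspace V" "vspace W"
  shows "linear_map U (tensor V W) (\<lambda>u. pure_tensor V W (g u) w)"
  by (rule linear_map_compose[OF bilin_left[OF bilin_pure_tensor[OF assms(3,4)] assms(2)] assms(1)])

lemma linear_map_pure_tensor_right [linear_rules]:
  assumes "linear_map U W g" "v \<in> carrier V" "vspace V" "vspace W"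
  shows "linear_map U (tensor V W) (\<lambda>u. pure_tensor V W v (g u))"
  by (rule linear_map_compose[OF bilin_right[OF bilin_pure_tensor[OF assms(3,4)] assms(2)] assms(1)])

text \<open>
  A list depending linearly on \<open>u\<close> in exactly one position.  A multilinear map turns it into a linear
  map, and the rules for list operations locate the position by syntax.
\<close>

definition slot ::
    "(complex, 'u, 'x) module_scheme \<Rightarrow> (complex, 'v, 'y) module_scheme \<Rightarrow> nat \<Rightarrow> ('u \<Rightarrow> 'v list) \<Rightarrow> bool"
  where
  "slot U V n F \<longleftrightarrow> (\<exists>xs g ys. F = (\<lambda>u. xs @ g u # ys) \<and> linear_map U V g \<and>
     set xs \<subseteq> carrier V \<and> set ys \<subseteq> carrier V \<and> n = Suc (length xs + length ys))"

lemma slot_middle: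
  assumes "set xs \<subseteq> carrier V" "set ys \<subseteq> carrier V" "n = Suc (length xs + length ys)"
  shows "slot V V n (\<lambda>v. xs @ v # ys)"
  unfolding slot_def using assms
  by (intro exI[of _ xs] exI[of _ "\<lambda>v. v"] exI[of _ ys]) (simp add: linear_map_id)

lemma slot_head [linear_rules]:
  assumes "linear_map U V g" "ys \<in> power_lists V m" "n = Suc m"
  shows "slot U V n (\<lambda>u. g u # ys)"
  unfolding slot_def using assms by (intro exI[of _ "[]"] exI[of _ g] exI[of _ ys]) (simp add: power_lists_def)

lemma slot_Cons [linear_rules]:
  assumes "slot U V m F" "x \<in> carrier V" "n = Suc m"
  shows "slot U V n (\<lambda>u. x # F u)"
proof -
  obtain xs g ys where "F = (\<lambda>u. xs @ g u # ys)" "linear_map U V g"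
    "set xs \<subseteq> carrier V" "set ys \<subseteq> carrier V" "m = Suc (length xs + length ys)"
    using assms(1) by (auto simp: slot_def)
  then show ?thesis unfolding slot_def using assms(2,3)
    by (intro exI[of _ "x # xs"] exI[of _ g] exI[of _ ys]) simp
qed

lemma slot_append_right [linear_rules]:
  assumes "slot U V m F" "zs \<in> power_lists V k" "n = k + m"
  shows "slot U V n (\<lambda>u. zs @ F u)"
proof -
  obtain xs g ys where "F = (\<lambda>u. xs @ g u # ys)" "linear_map U V g"
    "set xs \<subseteq> carrier V" "set ys \<subseteq> carrier V" "m = Suc (length xs + length ys)"
    using assms(1) by (auto simp: slot_def)
  then show ?thesis unfolding slot_def using assms(2,3)
    by (intro exI[of _ "zs @ xs"] exI[of _ g] exI[of _ ys]) (simp add: power_lists_def)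
qed

lemma mlin_slot:
  assumes "mlin V n Z f" "slot U V n F"
  shows "linear_map U Z (\<lambda>u. f (F u))"
proof -
  obtain xs g ys where F: "F = (\<lambda>u. xs @ g u # ys)" "linear_map U V g"
    "set xs \<subseteq> carrier V" "set ys \<subseteq> carrier V" "n = Suc (length xs + length ys)"
    using assms(2) by (auto simp: slot_def)
  then have "linear_map V Z (\<lambda>v. f (xs @ v # ys))" using assms(1) by (simp add: mlin_def)
  from linear_map_compose[OF this F(2)] show ?thesis by (simp add: F(1))
qed

lemma mlin_compose:
  assumes "linear_map Z Z' g" "mlin V n Z f"
  shows "mlin V n Z' (\<lambda>vs. g (f vs))"
proof (rule mlinI)
  show "g (f vs) \<in> carrier Z'" if "vs \<in> power_lists V n" for vs
    by (rule linear_map_closed[OF assms(1) mlin_closed[OF assms(2) that]])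
qed (rule linear_map_compose[OF assms(1) mlin_slot[OF assms(2) slot_middle]])

lemma linear_map_pure_power [linear_rules]:
  "slot U V n F \<Longrightarrow> vspace V \<Longrightarrow> linear_map U (tensor_power V n) (\<lambda>u. pure_power V (F u))"
  by (rule mlin_slot[OF mlin_pure_power])

lemma power_lists_simps [simp]:
  "[] \<in> power_lists V n \<longleftrightarrow> n = 0"
  "x # xs \<in> power_lists V (Suc n) \<longleftrightarrow> x \<in> carrier V \<and> xs \<in> power_lists V n"
  by (auto simp: power_lists_def)

lemma power_lists_ConsI [closed_rules]:
  "x \<in> carrier V \<Longrightarrow> xs \<in> power_lists V n \<Longrightarrow> x # xs \<in> power_lists V (Suc n)"
  by simp

lemma power_lists_length: "xs \<in> power_lists V n \<Longrightarrow> length xs = n"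
  by (simp add: power_lists_def)

lemma power_lists_set: "set xs \<subseteq> carrier V \<Longrightarrow> xs \<in> power_lists V (length xs)"
  by (simp add: power_lists_def)

lemma power_lists_take: "xs \<in> power_lists V n \<Longrightarrow> k \<le> n \<Longrightarrow> take k xs \<in> power_lists V k"
  by (auto simp: power_lists_def dest: in_set_takeD)

lemma power_lists_drop: "xs \<in> power_lists V n \<Longrightarrow> m = n - k \<Longrightarrow> drop k xs \<in> power_lists V m"
  by (auto simp: power_lists_def dest: in_set_dropD)

lemma power_lists_nth: "xs \<in> power_lists V n \<Longrightarrow> i < n \<Longrightarrow> xs ! i \<in> carrier V"
  by (auto simp: power_lists_def)

lemma power_lists_SucE:
  assumes "xs \<in> power_lists V (Suc n)"
  obtains y ys where "xs = y # ys" "y \<in> carrier V" "ys \<in> power_lists V n"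
  using assms by (cases xs) (auto simp: power_lists_def)

definition trilin ::
    "(complex, 'v, 'x) module_scheme \<Rightarrow> (complex, 'w, 'y) module_scheme \<Rightarrow> (complex, 'r, 't) module_scheme \<Rightarrow>
     (complex, 'z, 'u) module_scheme \<Rightarrow> ('v \<Rightarrow> 'w \<Rightarrow> 'r \<Rightarrow> 'z) \<Rightarrow> bool" where
  "trilin V W R Z f \<longleftrightarrow>
    (\<forall>w\<in>carrier W. \<forall>r\<in>carrier R. linear_map V Z (\<lambda>v. f v w r)) \<and>
    (\<forall>v\<in>carrier V. \<forall>r\<in>carrier R. linear_map W Z (\<lambda>w. f v w r)) \<and>
    (\<forall>v\<in>carrier V. \<forall>w\<in>carrier W. linear_map R Z (\<lambda>r. f v w r))"

lemma trilinI [linear_rules]: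
  assumes "\<And>w r. w \<in> carrier W \<Longrightarrow> r \<in> carrier R \<Longrightarrow> linear_map V Z (\<lambda>v. f v w r)"
    and "\<And>v r. v \<in> carrier V \<Longrightarrow> r \<in> carrier R \<Longrightarrow> linear_map W Z (\<lambda>w. f v w r)"
    and "\<And>v w. v \<in> carrier V \<Longrightarrow> w \<in> carrier W \<Longrightarrow> linear_map R Z (\<lambda>r. f v w r)"
  shows "trilin V W R Z f"
  using assms by (simp add: trilin_def)

lemma trilin_closed:
  "trilin V W R Z f \<Longrightarrow> v \<in> carrier V \<Longrightarrow> w \<in> carrier W \<Longrightarrow> r \<in> carrier R \<Longrightarrow> f v w r \<in> carrier Z"
  by (auto simp: trilin_def linear_map_def)

lemma trilin_linear:
  assumes "trilin V W R Z f"
  shows "w \<in> carrier W \<Longrightarrow> r \<in> carrier R \<Longrightarrow> linear_map V Z (\<lambda>v. f v w r)"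
    and "v \<in> carrier V \<Longrightarrow> r \<in> carrier R \<Longrightarrow> linear_map W Z (\<lambda>w. f v w r)"
    and "v \<in> carrier V \<Longrightarrow> w \<in> carrier W \<Longrightarrow> linear_map R Z (\<lambda>r. f v w r)"
  using assms by (simp_all add: trilin_def)


section \<open>Sweedler calculus in a coalgebra\<close>

context coalgebra
begin

lemmas vs_C [simp, closed_rules] = vector_space

lemma comult_closed [simp, closed_rules]: "c \<in> carrier C \<Longrightarrow> comult C c \<in> carrier (tensor C C)"
  by (rule linear_map_closed[OF comult_linear])

lemmas comult_cong = lift_tensor_cong[OF vs_C vs_C comult_closed]

lemma linear_map_comult [linear_rules]:
  "linear_map U C g \<Longrightarrow> linear_map U (tensor C C) (\<lambda>u. comult C (g u))"
  by (rule linear_map_compose[OF comult_linear])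

text \<open>
  The coassociativity axiom is an equation in the threefold tensor power.  A trilinear expression \<open>F\<close>
  extends to a linear map on that space, and this map is applied to both sides.  The counit axioms and the
  axioms of module coalgebras and comodules are transported in the same way.
\<close>

lemma lift_coassoc:
  assumes Z: "vspace Z" and F: "trilin C C C Z F" and c: "c \<in> carrier C"
  shows "lift Z (comult C c) (\<lambda>(a, b). lift Z (comult C a) (\<lambda>(a1, a2). F a1 a2 b)) =
    lift Z (comult C c) (\<lambda>(a, b). lift Z (comult C b) (\<lambda>(b1, b2). F a b1 b2))"
proof -
  define f where "f l = F (l ! 0) (l ! 1) (l ! 2)" for l
  define g where "g t = lift Z t f" for t
  have f3 [simp]: "f [a, b, c] = F a b c" for a b c by (simp add: f_def numeral_2_eq_2)
  have f: "mlin C 3 Z f"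
  proof (rule mlinI)
    fix l assume "l \<in> power_lists C 3"
    then show "f l \<in> carrier Z"
      by (auto simp: f_def power_lists_def intro!: trilin_closed[OF F])
  next
    fix xs ys assume *: "set xs \<subseteq> carrier C" "set ys \<subseteq> carrier C" "3 = Suc (length xs + length ys)"
    then consider x y where "xs = []" "ys = [x, y]" | x y where "xs = [x]" "ys = [y]"
      | x y where "xs = [x, y]" "ys = []"
      by (cases xs rule: list.exhaust; cases "tl xs"; cases ys; cases "tl ys"; auto)
    then show "linear_map C Z (\<lambda>v. f (xs @ v # ys))"
      by cases (use * in \<open>auto intro: trilin_linear[OF F]\<close>)
  qed
  have g: "linear_map (tensor_power C 3) Z g"
    unfolding g_def by (rule linear_map_lift_power[OF vs_C Z f])
  have gp: "g (pure_power C [a, b, c]) = F a b c" if "a \<in> carrier C" "b \<in> carrier C" "c \<in> carrier C" for a b c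
    unfolding g_def using that lift_pure_power[OF vs_C Z f, of "[a, b, c]"]
    by (simp add: power_lists_def)
  note closed = closed_rules Z trilin_closed[OF F]
  have p3: "pure_power C [a, b, c] \<in> carrier (tensor_power C 3)"
    if "a \<in> carrier C" "b \<in> carrier C" "c \<in> carrier C" for a b c
    using that by (intro pure_power_closed) (auto simp: power_lists_def)
  note push = lift_tensor_push[OF vs_C vs_C g vs_tensor_power[OF vs_C] Z]
  have 1: "g (lift (tensor_power C 3) (comult C c) (\<lambda>(a, b).
        lift (tensor_power C 3) (comult C a) (\<lambda>(a1, a2). pure_power C [a1, a2, b]))) =
      lift Z (comult C c) (\<lambda>(a, b). lift Z (comult C a) (\<lambda>(a1, a2). F a1 a2 b))"
    apply (subst push)
      apply (assumption | rule c p3 closed_rules)+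
    apply (rule lift_tensor_cong[OF vs_C vs_C comult_closed[OF c] Z])
     apply (subst push)
       apply (assumption | rule c p3 closed_rules)+
     apply (rule lift_tensor_cong[OF vs_C vs_C _ Z])
       apply (assumption | rule c p3 gp closed)+
    done
  have 2: "g (lift (tensor_power C 3) (comult C c) (\<lambda>(a, b).
        lift (tensor_power C 3) (comult C b) (\<lambda>(b1, b2). pure_power C [a, b1, b2]))) =
      lift Z (comult C c) (\<lambda>(a, b). lift Z (comult C b) (\<lambda>(b1, b2). F a b1 b2))"
    apply (subst push)
      apply (assumption | rule c p3 closed_rules)+
    apply (rule lift_tensor_cong[OF vs_C vs_C comult_closed[OF c] Z])
     apply (subst push)
       apply (assumption | rule c p3 closed_rules)+
     apply (rule lift_tensor_cong[OF vs_C vs_C _ Z])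
       apply (assumption | rule c p3 gp closed)+
    done
  show ?thesis using coassoc[OF c] 1 2 by simp
qed

lemma lift_counit_left:
  assumes "vspace Z" "linear_map C Z f" "c \<in> carrier C"
  shows "lift Z (comult C c) (\<lambda>(a, b). counit C a \<odot>\<^bsub>Z\<^esub> f b) = f c"
proof -
  have "f (lift C (comult C c) (\<lambda>(a, b). counit C a \<odot>\<^bsub>C\<^esub> b)) =
      lift Z (comult C c) (\<lambda>(a, b). f (counit C a \<odot>\<^bsub>C\<^esub> b))"
    by (rule lift_tensor_push[OF vs_C vs_C assms(2) vs_C assms(1)])
      (assumption | rule closed_rules assms)+
  also have "\<dots> = lift Z (comult C c) (\<lambda>(a, b). counit C a \<odot>\<^bsub>Z\<^esub> f b)"
    by (rule lift_tensor_cong[OF vs_C vs_C _ assms(1)])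
      (assumption | rule closed_rules assms linear_map_smult[OF assms(2)] linear_map_closed[OF assms(2)])+
  finally show ?thesis using counit_left[OF assms(3)] by simp
qed

lemma lift_counit_right:
  assumes "vspace Z" "linear_map C Z f" "c \<in> carrier C"
  shows "lift Z (comult C c) (\<lambda>(a, b). counit C b \<odot>\<^bsub>Z\<^esub> f a) = f c"
proof -
  have "f (lift C (comult C c) (\<lambda>(a, b). counit C b \<odot>\<^bsub>C\<^esub> a)) =
      lift Z (comult C c) (\<lambda>(a, b). f (counit C b \<odot>\<^bsub>C\<^esub> a))"
    by (rule lift_tensor_push[OF vs_C vs_C assms(2) vs_C assms(1)])
      (assumption | rule closed_rules assms)+
  also have "\<dots> = lift Z (comult C c) (\<lambda>(a, b). counit C b \<odot>\<^bsub>Z\<^esub> f a)"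
    by (rule lift_tensor_cong[OF vs_C vs_C _ assms(1)])
      (assumption | rule closed_rules assms linear_map_smult[OF assms(2)] linear_map_closed[OF assms(2)])+
  finally show ?thesis using counit_right[OF assms(3)] by simp
qed

end

section \<open>Hopf algebras\<close>

sublocale hopf_algebra \<subseteq> H: coalgebra H
  by (rule coalgebra)

sublocale hopf_algebra \<subseteq> H: ring H
  by (rule ring)

context hopf_algebra
begin

abbreviation hmult (infixl "\<cdot>" 70) where "h \<cdot> k \<equiv> h \<otimes>\<^bsub>H\<^esub> k"

lemma antipode_closed [closed_rules]: "h \<in> carrier H \<Longrightarrow> antipode H h \<in> carrier H"
  by (rule linear_map_closed[OF antipode_linear])

lemmas [closed_rules] = H.m_closed H.one_closed

lemma linear_map_antipode [linear_rules]:
  "linear_map U H g \<Longrightarrow> linear_map U H (\<lambda>u. antipode H (g u))"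
  by (rule linear_map_compose[OF antipode_linear])

lemma linear_map_mult_left [linear_rules]:
  assumes "linear_map U H g" "k \<in> carrier H"
  shows "linear_map U H (\<lambda>u. g u \<cdot> k)"
  using assms by (auto simp: linear_map_def H.l_distr smult_mult_left)

lemma linear_map_mult_right [linear_rules]:
  assumes "linear_map U H g" "k \<in> carrier H"
  shows "linear_map U H (\<lambda>u. k \<cdot> g u)"
  using assms by (auto simp: linear_map_def H.r_distr smult_mult_right)

text \<open>
  Multiplicativity of the coproduct in the form in which it is used: below a bilinear expression.
\<close>

lemma lift_comult_mult:
  assumes Z: "vspace Z" and F: "bilin H H Z F" and hk: "h \<in> carrier H" "k \<in> carrier H"
  shows "lift Z (comult H (h \<cdot> k)) (case_prod F) =
    lift Z (comult H h) (\<lambda>(h1, h2). lift Z (comult H k) (\<lambda>(k1, k2).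
      F (h1 \<cdot> k1) (h2 \<cdot> k2)))"
proof -
  define g where "g t = lift Z t (case_prod F)" for t
  have g: "linear_map (tensor H H) Z g"
    unfolding g_def by (rule linear_map_lift_tensor[OF H.vs_C H.vs_C Z F])
  have gp: "g (pure_tensor H H a b) = F a b" if "a \<in> carrier H" "b \<in> carrier H" for a b
    unfolding g_def by (rule lift_pure_tensor[OF H.vs_C H.vs_C Z F that])
  note push = lift_tensor_push[OF H.vs_C H.vs_C g vs_tensor[OF H.vs_C H.vs_C] Z]
  have "g (comult H (h \<cdot> k)) =
    lift Z (comult H h) (\<lambda>(h1, h2). lift Z (comult H k) (\<lambda>(k1, k2).
      F (h1 \<cdot> k1) (h2 \<cdot> k2)))"
    unfolding comult_mult[OF hk]
    apply (subst push)
      apply (assumption | rule hk closed_rules)+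
    apply (rule lift_tensor_cong[OF H.vs_C H.vs_C _ Z])
      apply (rule closed_rules hk)+
     apply (subst push)
       apply (assumption | rule hk closed_rules)+
     apply (rule lift_tensor_cong[OF H.vs_C H.vs_C _ Z])
       apply (assumption | rule hk gp closed_rules Z bilin_closed[OF F])+
    done
  then show ?thesis by (simp add: g_def)
qed

lemma lift_antipode_left:
  assumes Z: "vspace Z" and f: "linear_map H Z f" and h: "h \<in> carrier H"
  shows "lift Z (comult H h) (\<lambda>(a, b). f (antipode H a \<cdot> b)) = counit H h \<odot>\<^bsub>Z\<^esub> f \<one>\<^bsub>H\<^esub>"
proof -
  have "f (lift H (comult H h) (\<lambda>(a, b). antipode H a \<cdot> b)) =
      lift Z (comult H h) (\<lambda>(a, b). f (antipode H a \<cdot> b))"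
    by (rule lift_tensor_push[OF H.vs_C H.vs_C f H.vs_C Z]) (assumption | rule closed_rules h)+
  then show ?thesis
    using antipode_left[OF h] linear_map_smult[OF f H.one_closed] by simp
qed

lemma lift_antipode_right:
  assumes Z: "vspace Z" and f: "linear_map H Z f" and h: "h \<in> carrier H"
  shows "lift Z (comult H h) (\<lambda>(a, b). f (a \<cdot> antipode H b)) = counit H h \<odot>\<^bsub>Z\<^esub> f \<one>\<^bsub>H\<^esub>"
proof -
  have "f (lift H (comult H h) (\<lambda>(a, b). a \<cdot> antipode H b)) =
      lift Z (comult H h) (\<lambda>(a, b). f (a \<cdot> antipode H b))"
    by (rule lift_tensor_push[OF H.vs_C H.vs_C f H.vs_C Z]) (assumption | rule closed_rules h)+
  then show ?thesis
    using antipode_right[OF h] linear_map_smult[OF f H.one_closed] by simp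
qed

text \<open>
  The sum of \<open>S(k\<^sup>(\<^sup>1\<^sup>)) S(h\<^sup>(\<^sup>1\<^sup>)) h\<^sup>(\<^sup>2\<^sup>) k\<^sup>(\<^sup>2\<^sup>) S(h\<^sup>(\<^sup>3\<^sup>) k\<^sup>(\<^sup>3\<^sup>))\<close> is evaluated in two ways.  Cancelling the first four factors
  leaves \<open>S(h k)\<close>; cancelling the last three, which form \<open>x\<^sup>(\<^sup>1\<^sup>) S(x\<^sup>(\<^sup>2\<^sup>))\<close> for a product \<open>x\<close>, leaves
  \<open>S(k) S(h)\<close>.
\<close>

lemma antipode_mult:
  assumes hk: "h \<in> carrier H" "k \<in> carrier H"
  shows "antipode H (h \<cdot> k) = antipode H k \<cdot> antipode H h"
proof -
  let ?S = "antipode H"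
  note [simp] = H.m_closed antipode_closed
  note cong = lift_tensor_cong[OF H.vs_C H.vs_C _ H.vs_C]
  define T where "T h1 h2 h3 k1 k2 k3 = (?S k1 \<cdot> ?S h1) \<cdot> ((h2 \<cdot> k2) \<cdot> ?S (h3 \<cdot> k3))"
    for h1 h2 h3 k1 k2 k3
  have T_closed: "T h1 h2 h3 k1 k2 k3 \<in> carrier H"
    if "h1 \<in> carrier H" "h2 \<in> carrier H" "h3 \<in> carrier H" "k1 \<in> carrier H" "k2 \<in> carrier H" "k3 \<in> carrier H"
    for h1 h2 h3 k1 k2 k3 using that by (simp add: T_def)
  define E where "E = lift H (comult H h) (\<lambda>(h', h3). lift H (comult H h') (\<lambda>(h1, h2).
      lift H (comult H k) (\<lambda>(k', k3). lift H (comult H k') (\<lambda>(k1, k2). T h1 h2 h3 k1 k2 k3))))"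
  have "E = lift H (comult H h) (\<lambda>(h', h3). lift H (comult H k) (\<lambda>(k', k3).
      lift H (comult H k') (\<lambda>(k1, k2). lift H (comult H h') (\<lambda>(h1, h2). T h1 h2 h3 k1 k2 k3))))"
    unfolding E_def
    apply (rule cong, rule H.comult_closed[OF hk(1)])
     apply (subst lift_tensor_swap[OF H.vs_C H.vs_C H.vs_C H.vs_C _ _ H.vs_C])
        apply (assumption | rule closed_rules hk T_closed)+
     apply (rule cong, rule H.comult_closed[OF hk(2)])
      apply (subst lift_tensor_swap[OF H.vs_C H.vs_C H.vs_C H.vs_C _ _ H.vs_C])
         apply (assumption | rule closed_rules hk T_closed refl)+
    done
  \<comment> \<open>First evaluation: \<open>S(h1) h2\<close> cancels inside \<open>S(k1) \<dots> k2\<close>, then \<open>S(k1) k2\<close> cancels.\<close>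
  also have "\<dots> = lift H (comult H h) (\<lambda>(h', h3). lift H (comult H k) (\<lambda>(k', k3).
      counit H h' \<odot>\<^bsub>H\<^esub> (counit H k' \<odot>\<^bsub>H\<^esub> ?S (h3 \<cdot> k3))))"
  proof (rule cong, rule H.comult_closed[OF hk(1)], rule cong, rule H.comult_closed[OF hk(2)])
    fix h' h3 k' k3 assume c: "h' \<in> carrier H" "h3 \<in> carrier H" "k' \<in> carrier H" "k3 \<in> carrier H"
    let ?x = "?S (h3 \<cdot> k3)"
    have "lift H (comult H h') (\<lambda>(h1, h2). T h1 h2 h3 k1 k2 k3) =
        counit H h' \<odot>\<^bsub>H\<^esub> ((?S k1 \<cdot> k2) \<cdot> ?x)" if k12: "k1 \<in> carrier H" "k2 \<in> carrier H" for k1 k2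
    proof -
      have lin: "linear_map H H (\<lambda>y. ?S k1 \<cdot> (y \<cdot> (k2 \<cdot> ?x)))"
        using c k12 by (auto intro!: linear_rules)
      have "lift H (comult H h') (\<lambda>(h1, h2). T h1 h2 h3 k1 k2 k3) =
          lift H (comult H h') (\<lambda>(h1, h2). ?S k1 \<cdot> ((?S h1 \<cdot> h2) \<cdot> (k2 \<cdot> ?x)))"
        by (rule cong) (use c k12 in \<open>simp_all add: T_def H.m_assoc\<close>)
      also have "\<dots> = counit H h' \<odot>\<^bsub>H\<^esub> (?S k1 \<cdot> (\<one>\<^bsub>H\<^esub> \<cdot> (k2 \<cdot> ?x)))"
        by (rule lift_antipode_left[OF H.vs_C lin c(1)])
      finally show ?thesis using c k12 by (simp add: H.m_assoc)
    qed
    then have "lift H (comult H k') (\<lambda>(k1, k2). lift H (comult H h') (\<lambda>(h1, h2). T h1 h2 h3 k1 k2 k3)) =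
        lift H (comult H k') (\<lambda>(k1, k2). counit H h' \<odot>\<^bsub>H\<^esub> ((?S k1 \<cdot> k2) \<cdot> ?x))"
      by (intro cong) (use c in \<open>simp_all add: vs_smult_closed\<close>)
    also have "\<dots> = counit H k' \<odot>\<^bsub>H\<^esub> (counit H h' \<odot>\<^bsub>H\<^esub> (\<one>\<^bsub>H\<^esub> \<cdot> ?x))"
      by (rule lift_antipode_left[OF H.vs_C, of "\<lambda>y. counit H h' \<odot>\<^bsub>H\<^esub> (y \<cdot> ?x)"])
        (use c in \<open>auto intro!: linear_rules\<close>)
    finally show "lift H (comult H k') (\<lambda>(k1, k2). lift H (comult H h') (\<lambda>(h1, h2). T h1 h2 h3 k1 k2 k3)) =
        counit H h' \<odot>\<^bsub>H\<^esub> (counit H k' \<odot>\<^bsub>H\<^esub> ?x)"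
      using c by (simp add: vs_smult_smult[OF H.vs_C] mult.commute)
  qed (assumption | rule closed_rules hk)+
  also have "\<dots> = lift H (comult H h) (\<lambda>(h', h3). counit H h' \<odot>\<^bsub>H\<^esub> ?S (h3 \<cdot> k))"
  proof (rule cong, rule H.comult_closed[OF hk(1)])
    fix h' h3 assume c: "h' \<in> carrier H" "h3 \<in> carrier H"
    have "lift H (comult H k) (\<lambda>(k', k3). counit H h' \<odot>\<^bsub>H\<^esub> (counit H k' \<odot>\<^bsub>H\<^esub> ?S (h3 \<cdot> k3))) =
        lift H (comult H k) (\<lambda>(k', k3). counit H k' \<odot>\<^bsub>H\<^esub> (counit H h' \<odot>\<^bsub>H\<^esub> ?S (h3 \<cdot> k3)))"
      by (rule cong) (use c hk in \<open>simp_all add: vs_smult_smult[OF H.vs_C] vs_smult_closed[OF H.vs_C] mult.commute\<close>)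
    also have "\<dots> = counit H h' \<odot>\<^bsub>H\<^esub> ?S (h3 \<cdot> k)"
      by (rule H.lift_counit_left[OF H.vs_C _ hk(2)]) (use c hk in \<open>auto intro!: linear_rules\<close>)
    finally show "lift H (comult H k) (\<lambda>(k', k3). counit H h' \<odot>\<^bsub>H\<^esub> (counit H k' \<odot>\<^bsub>H\<^esub> ?S (h3 \<cdot> k3))) =
        counit H h' \<odot>\<^bsub>H\<^esub> ?S (h3 \<cdot> k)" .
  qed (assumption | rule closed_rules hk)+
  also have "\<dots> = ?S (h \<cdot> k)"
    by (rule H.lift_counit_left[OF H.vs_C _ hk(1)]) (use hk in \<open>auto intro!: linear_rules\<close>)
  finally have E1: "E = ?S (h \<cdot> k)" .

  have T_lin: "linear_map H H (\<lambda>x. T x h2 h3 k1 k2 k3)" "linear_map H H (\<lambda>x. T h1 x h3 k1 k2 k3)"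
    "linear_map H H (\<lambda>x. T h1 h2 x k1 k2 k3)" "linear_map H H (\<lambda>x. T h1 h2 h3 x k2 k3)"
    "linear_map H H (\<lambda>x. T h1 h2 h3 k1 x k3)" "linear_map H H (\<lambda>x. T h1 h2 h3 k1 k2 x)"
    if "h1 \<in> carrier H" "h2 \<in> carrier H" "h3 \<in> carrier H" "k1 \<in> carrier H" "k2 \<in> carrier H" "k3 \<in> carrier H"
    for h1 h2 h3 k1 k2 k3
    unfolding T_def by (assumption | rule linear_rules closed_rules that)+
  \<comment> \<open>Second evaluation: coassociativity groups the second and third components of \<open>h\<close> and of \<open>k\<close>.\<close>
  have "E = lift H (comult H h) (\<lambda>(h1, h''). lift H (comult H h'') (\<lambda>(h2, h3).
      lift H (comult H k) (\<lambda>(k', k3). lift H (comult H k') (\<lambda>(k1, k2). T h1 h2 h3 k1 k2 k3))))"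
    unfolding E_def
    by (rule H.lift_coassoc[OF H.vs_C _ hk(1)]) (assumption | rule linear_rules closed_rules T_closed T_lin hk)+
  also have "\<dots> = lift H (comult H h) (\<lambda>(h1, h''). lift H (comult H h'') (\<lambda>(h2, h3).
      lift H (comult H k) (\<lambda>(k1, k''). lift H (comult H k'') (\<lambda>(k2, k3). T h1 h2 h3 k1 k2 k3))))"
    apply (rule cong, rule H.comult_closed[OF hk(1)])
     apply (rule cong, erule H.comult_closed)
      apply (rule H.lift_coassoc[OF H.vs_C _ hk(2)])
      apply (assumption | rule linear_rules closed_rules T_closed T_lin hk)+
    done
  also have "\<dots> = lift H (comult H h) (\<lambda>(h1, h''). lift H (comult H k) (\<lambda>(k1, k'').
      lift H (comult H h'') (\<lambda>(h2, h3). lift H (comult H k'') (\<lambda>(k2, k3). T h1 h2 h3 k1 k2 k3))))"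
    apply (rule cong, rule H.comult_closed[OF hk(1)])
     apply (rule lift_tensor_swap[OF H.vs_C H.vs_C H.vs_C H.vs_C _ _ H.vs_C])
       apply (assumption | rule closed_rules hk T_closed)+
    done
  also have "\<dots> = lift H (comult H h) (\<lambda>(h1, h''). lift H (comult H k) (\<lambda>(k1, k'').
      counit H h'' \<odot>\<^bsub>H\<^esub> (counit H k'' \<odot>\<^bsub>H\<^esub> (?S k1 \<cdot> ?S h1))))"
  proof (rule cong, rule H.comult_closed[OF hk(1)], rule cong, rule H.comult_closed[OF hk(2)])
    fix h1 h'' k1 k'' assume c: "h1 \<in> carrier H" "h'' \<in> carrier H" "k1 \<in> carrier H" "k'' \<in> carrier H"
    let ?f = "\<lambda>x. (?S k1 \<cdot> ?S h1) \<cdot> x"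
    have "lift H (comult H h'') (\<lambda>(h2, h3). lift H (comult H k'') (\<lambda>(k2, k3). T h1 h2 h3 k1 k2 k3)) =
        lift H (comult H (h'' \<cdot> k'')) (\<lambda>(a, b). ?f (a \<cdot> ?S b))"
      unfolding T_def
      by (rule lift_comult_mult[OF H.vs_C, symmetric]) (assumption | rule linear_rules closed_rules c)+
    also have "\<dots> = counit H (h'' \<cdot> k'') \<odot>\<^bsub>H\<^esub> ?f \<one>\<^bsub>H\<^esub>"
      by (rule lift_antipode_right[OF H.vs_C]) (assumption | rule linear_rules closed_rules c)+
    also have "\<dots> = counit H h'' \<odot>\<^bsub>H\<^esub> (counit H k'' \<odot>\<^bsub>H\<^esub> (?S k1 \<cdot> ?S h1))"
      using c by (simp add: counit_mult vs_smult_smult[OF H.vs_C])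
    finally show "lift H (comult H h'') (\<lambda>(h2, h3). lift H (comult H k'') (\<lambda>(k2, k3). T h1 h2 h3 k1 k2 k3)) =
        counit H h'' \<odot>\<^bsub>H\<^esub> (counit H k'' \<odot>\<^bsub>H\<^esub> (?S k1 \<cdot> ?S h1))" .
  qed (assumption | rule closed_rules hk)+
  also have "\<dots> = lift H (comult H h) (\<lambda>(h1, h''). counit H h'' \<odot>\<^bsub>H\<^esub> (?S k \<cdot> ?S h1))"
  proof (rule cong, rule H.comult_closed[OF hk(1)])
    fix h1 h'' assume c: "h1 \<in> carrier H" "h'' \<in> carrier H"
    have "lift H (comult H k) (\<lambda>(k1, k''). counit H h'' \<odot>\<^bsub>H\<^esub> (counit H k'' \<odot>\<^bsub>H\<^esub> (?S k1 \<cdot> ?S h1))) =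
        lift H (comult H k) (\<lambda>(k1, k''). counit H k'' \<odot>\<^bsub>H\<^esub> (counit H h'' \<odot>\<^bsub>H\<^esub> (?S k1 \<cdot> ?S h1)))"
      by (rule cong) (use c hk in \<open>simp_all add: vs_smult_smult[OF H.vs_C] vs_smult_closed[OF H.vs_C] mult.commute\<close>)
    also have "\<dots> = counit H h'' \<odot>\<^bsub>H\<^esub> (?S k \<cdot> ?S h1)"
      by (rule H.lift_counit_right[OF H.vs_C _ hk(2)]) (use c hk in \<open>auto intro!: linear_rules\<close>)
    finally show "lift H (comult H k) (\<lambda>(k1, k''). counit H h'' \<odot>\<^bsub>H\<^esub> (counit H k'' \<odot>\<^bsub>H\<^esub> (?S k1 \<cdot> ?S h1))) =
        counit H h'' \<odot>\<^bsub>H\<^esub> (?S k \<cdot> ?S h1)" .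
  qed (assumption | rule closed_rules hk)+
  also have "\<dots> = ?S k \<cdot> ?S h"
    by (rule H.lift_counit_right[OF H.vs_C _ hk(1)]) (use hk in \<open>auto intro!: linear_rules\<close>)
  finally show ?thesis using E1 by simp
qed

end

section \<open>Iterated coproducts\<close>

text \<open>
  The coproduct applied to entry \<open>i\<close> keeps multilinearity.  The varying entry lies before, at or after
  position \<open>i\<close>; only in the second case does the coproduct depend on it.
\<close>

lemma mlin_split:
  assumes C: "coalgebra C" and Z: "vspace Z" and F: "mlin C (Suc n) Z F" and i: "i < n"
  shows "mlin C n Z (\<lambda>cs. lift Z (comult C (cs ! i)) (\<lambda>(a, b). F (take i cs @ [a, b] @ drop (Suc i) cs)))"
proof (rule mlinI)
  interpret C: coalgebra C by (rule C)
  have F_closed: "F (take i cs @ [a, b] @ drop (Suc i) cs) \<in> carrier Z"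
    if "cs \<in> power_lists C n" "a \<in> carrier C" "b \<in> carrier C" for cs a b
    using that i by (intro mlin_closed[OF F]) (auto simp: power_lists_def dest: in_set_takeD in_set_dropD)
  show "lift Z (comult C (cs ! i)) (\<lambda>(a, b). F (take i cs @ [a, b] @ drop (Suc i) cs)) \<in> carrier Z"
    if "cs \<in> power_lists C n" for cs
    using that by (intro lift_tensor_closed[OF C.vs_C C.vs_C C.comult_closed Z] F_closed power_lists_nth[OF that i])
  fix xs ys assume xy: "set xs \<subseteq> carrier C" "set ys \<subseteq> carrier C" and n: "n = Suc (length xs + length ys)"
  have cs: "xs @ v # ys \<in> power_lists C n" if "v \<in> carrier C" for v
    using that xy n by (simp add: power_lists_def)
  note pl = power_lists_set[OF xy(1)] power_lists_set[OF xy(2)]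
  consider (lt) "i < length xs" | (eq) "i = length xs" | (gt) "length xs < i" by linarith
  then show "linear_map C Z (\<lambda>v. lift Z (comult C ((xs @ v # ys) ! i))
      (\<lambda>(a, b). F (take i (xs @ v # ys) @ [a, b] @ drop (Suc i) (xs @ v # ys))))"
  proof cases
    case lt
    have t: "take i xs \<in> power_lists C i" "drop (Suc i) xs \<in> power_lists C (length xs - Suc i)"
      "xs ! i \<in> carrier C"
      using lt pl(1) by (auto intro: power_lists_take power_lists_drop power_lists_nth)
    have "linear_map C Z (\<lambda>v. lift Z (comult C (xs ! i))
      (\<lambda>(a, b). F (take i xs @ [a, b] @ drop (Suc i) xs @ v # ys)))"
      apply (rule lift_tensor_family[OF C.vs_C C.vs_C C.comult_closed[OF t(3)] C.vs_C Z])
      apply (rule mlin_slot[OF F])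
      using t pl lt n by (auto intro!: linear_rules)
    then show ?thesis using lt by (simp add: nth_append)
  next
    case eq
    have "linear_map C Z (\<lambda>v. lift Z (comult C v) (\<lambda>(a, b). F (xs @ [a, b] @ ys)))"
      apply (rule linear_map_lift_tensor_compose[OF C.comult_linear _ C.vs_C C.vs_C Z])
      apply (rule bilinI)
      subgoal for w
        using mlin_slot[OF F slot_middle[of xs C "w # ys"]] xy n by simp
      subgoal for v
        using mlin_slot[OF F slot_middle[of "xs @ [v]" C ys]] xy n by simp
      done
    then show ?thesis using eq by simp
  next
    case gt
    define j where "j = i - Suc (length xs)"
    have ij: "i = Suc (length xs + j)" and j: "j < length ys" using gt n i by (auto simp: j_def)
    have t: "take j ys \<in> power_lists C j" "drop (Suc j) ys \<in> power_lists C (length ys - Suc j)"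
      "ys ! j \<in> carrier C"
      using j pl(2) by (auto intro: power_lists_take power_lists_drop power_lists_nth)
    have "linear_map C Z (\<lambda>v. lift Z (comult C (ys ! j))
      (\<lambda>(a, b). F (xs @ v # take j ys @ [a, b] @ drop (Suc j) ys)))"
      apply (rule lift_tensor_family[OF C.vs_C C.vs_C C.comult_closed[OF t(3)] C.vs_C Z])
      apply (rule mlin_slot[OF F])
      apply (rule linear_rules pl)+
      using t pl j n by (auto simp: power_lists_def)
    then show ?thesis using ij by (simp add: nth_append)
  qed
qed

lemma mlin_Cons:
  assumes "mlin V (Suc n) Z F" "x \<in> carrier V"
  shows "mlin V n Z (\<lambda>vs. F (x # vs))"
proof (rule mlinI)
  show "F (x # vs) \<in> carrier Z" if "vs \<in> power_lists V n" for vs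
    using that assms by (intro mlin_closed[OF assms(1)]) simp
  show "linear_map V Z (\<lambda>v. F (x # xs @ v # ys))"
    if "set xs \<subseteq> carrier V" "set ys \<subseteq> carrier V" "n = Suc (length xs + length ys)" for xs ys
    by (rule mlin_slot[OF assms(1)])
      (use that assms(2) in \<open>auto intro!: linear_rules power_lists_set\<close>)
qed

lemma mlin_snoc:
  assumes "mlin V (Suc n) Z F" "x \<in> carrier V"
  shows "mlin V n Z (\<lambda>vs. F (vs @ [x]))"
proof (rule mlinI)
  show "F (vs @ [x]) \<in> carrier Z" if "vs \<in> power_lists V n" for vs
    using that assms by (intro mlin_closed[OF assms(1)]) (simp add: power_lists_def)
  show "linear_map V Z (\<lambda>v. F ((xs @ v # ys) @ [x]))"
    if "set xs \<subseteq> carrier V" "set ys \<subseteq> carrier V" "n = Suc (length xs + length ys)" for xs ys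
    using mlin_slot[OF assms(1) slot_middle[of xs V "ys @ [x]"]] that assms(2) by simp
qed

lemma linear_map_mlin_head:
  assumes "mlin V (Suc n) Z F" "vs \<in> power_lists V n"
  shows "linear_map V Z (\<lambda>x. F (x # vs))"
  by (rule mlin_slot[OF assms(1)]) (assumption | rule linear_rules assms refl)+

lemma linear_map_mlin_last:
  assumes "mlin V (Suc n) Z F" "vs \<in> power_lists V n"
  shows "linear_map V Z (\<lambda>x. F (vs @ [x]))"
  by (rule mlin_slot[OF assms(1)])
    (use assms(2) in \<open>auto intro!: linear_rules\<close>)

lemma set_map2_subset:
  assumes "set as \<subseteq> A" "set bs \<subseteq> B" "\<And>a b. a \<in> A \<Longrightarrow> b \<in> B \<Longrightarrow> f a b \<in> D"
  shows "set (map2 f as bs) \<subseteq> D"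
proof
  fix x assume "x \<in> set (map2 f as bs)"
  then obtain a b where "(a, b) \<in> set (zip as bs)" "x = f a b" by auto
  then show "x \<in> D" using assms set_zip_leftD[of a b as bs] set_zip_rightD[of a b as bs] by blast
qed

lemma slot_map2_right:
  assumes F: "slot U V n F" and hs: "hs \<in> power_lists W n"
    and f: "\<And>h. h \<in> carrier W \<Longrightarrow> linear_map V Z (f h)"
  shows "slot U Z n (\<lambda>u. map2 f hs (F u))"
proof -
  obtain xs g ys where *: "F = (\<lambda>u. xs @ g u # ys)" "linear_map U V g"
    "set xs \<subseteq> carrier V" "set ys \<subseteq> carrier V" "n = Suc (length xs + length ys)"
    using F by (auto simp: slot_def)
  define k where "k = length xs"
  have hs': "take k hs \<in> power_lists W k" "hs ! k \<in> carrier W" "drop (Suc k) hs \<in> power_lists W (length ys)"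
    "length hs = n"
    using hs * by (auto simp: k_def power_lists_length intro: power_lists_take power_lists_nth power_lists_drop)
  have hs_eq: "hs = take k hs @ hs ! k # drop (Suc k) hs"
    using hs'(4) *(5) by (simp add: k_def id_take_nth_drop)
  have len: "length (take k hs) = length xs" using hs'(4) *(5) by (simp add: k_def)
  have "map2 f hs (F u) = map2 f (take k hs) xs @ f (hs ! k) (g u) # map2 f (drop (Suc k) hs) ys" for u
    using len by (subst hs_eq) (simp add: *(1) del: length_take)
  moreover have "set (map2 f as bs) \<subseteq> carrier Z"
    if "set as \<subseteq> carrier W" "set bs \<subseteq> carrier V" for as bs
    using that linear_map_closed[OF f] by (intro set_map2_subset)
  ultimately show ?thesis
    unfolding slot_def using * hs'
    by (intro exI[of _ "map2 f (take k hs) xs"] exI[of _ "\<lambda>u. f (hs ! k) (g u)"]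
        exI[of _ "map2 f (drop (Suc k) hs) ys"])
      (auto simp: power_lists_def k_def intro: linear_map_compose[OF f])
qed

lemma slot_map2_left:
  assumes F: "slot U W n F" and cs: "cs \<in> power_lists V n"
    and f: "\<And>c. c \<in> carrier V \<Longrightarrow> linear_map W Z (\<lambda>h. f h c)"
  shows "slot U Z n (\<lambda>u. map2 f (F u) cs)"
proof -
  have "map2 f xs ys = map2 (\<lambda>c h. f h c) ys xs" for xs ys
    by (subst zip_commute) (simp add: case_prod_unfold)
  then show ?thesis using slot_map2_right[OF F cs, of Z "\<lambda>c h. f h c"] f by simp
qed

lemma map2_power_lists:
  assumes "hs \<in> power_lists W n" "cs \<in> power_lists V n"
    "\<And>h c. h \<in> carrier W \<Longrightarrow> c \<in> carrier V \<Longrightarrow> f h c \<in> carrier Z"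
  shows "map2 f hs cs \<in> power_lists Z n"
  using assms set_map2_subset[of hs "carrier W" cs "carrier V" f "carrier Z"]
  by (simp add: power_lists_def)

lemma mlin_map2_right:
  assumes F: "mlin Z n Y F" and hs: "hs \<in> power_lists W n"
    and f: "\<And>h. h \<in> carrier W \<Longrightarrow> linear_map V Z (f h)"
  shows "mlin V n Y (\<lambda>cs. F (map2 f hs cs))"
proof (rule mlinI)
  show "F (map2 f hs cs) \<in> carrier Y" if "cs \<in> power_lists V n" for cs
    using that hs linear_map_closed[OF f] by (intro mlin_closed[OF F] map2_power_lists)
qed (intro mlin_slot[OF F] slot_map2_right[OF _ hs f] slot_middle)

lemma mlin_map2_left:
  assumes F: "mlin Z n Y F" and cs: "cs \<in> power_lists V n"
    and f: "\<And>c. c \<in> carrier V \<Longrightarrow> linear_map W Z (\<lambda>h. f h c)"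
  shows "mlin W n Y (\<lambda>hs. F (map2 f hs cs))"
proof (rule mlinI)
  show "F (map2 f hs cs) \<in> carrier Y" if "hs \<in> power_lists W n" for hs
    using that cs linear_map_closed[OF f] by (intro mlin_closed[OF F] map2_power_lists)
qed (intro mlin_slot[OF F] slot_map2_left[OF _ cs f] slot_middle)

declare iter_comult.simps [simp del]

context hopf_algebra
begin

lemma iter_comult_linear: "linear_map H (tensor_power H (Suc n)) (iter_comult H n)"
proof (induction n)
  case 0
  have "linear_map H (tensor_power H (Suc 0)) (\<lambda>h. pure_power H [h])"
    by (rule linear_rules H.vs_C | simp)+
  then show ?case by (simp add: iter_comult.simps)
next
  case (Suc n)
  let ?Z = "tensor_power H (Suc (Suc n))"
  have m: "mlin H (Suc n) ?Z (\<lambda>hs. pure_power H (h # hs))" if "h \<in> carrier H" for h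
    by (rule mlin_Cons[OF mlin_pure_power[OF H.vs_C] that])
  have l: "linear_map H ?Z (\<lambda>h. pure_power H (h # hs))" if "hs \<in> power_lists H (Suc n)" for hs
    by (rule linear_map_mlin_head[OF mlin_pure_power[OF H.vs_C] that])
  have "linear_map H ?Z (\<lambda>h. lift ?Z (comult H h) (\<lambda>(h1, h2).
      lift ?Z (iter_comult H n h2) (\<lambda>hs. pure_power H (h1 # hs))))"
    by (assumption | rule linear_rules closed_rules H.comult_linear Suc.IH l m linear_map_closed[OF Suc.IH])+
  then show ?case by (simp add: iter_comult.simps)
qed

lemma iter_comult_closed [closed_rules]:
  "h \<in> carrier H \<Longrightarrow> iter_comult H n h \<in> carrier (tensor_power H (Suc n))"
  by (rule linear_map_closed[OF iter_comult_linear])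

lemma linear_map_iter_comult [linear_rules]:
  "linear_map U H g \<Longrightarrow> linear_map U (tensor_power H (Suc n)) (\<lambda>u. iter_comult H n (g u))"
  by (rule linear_map_compose[OF iter_comult_linear])

lemma lift_iter_0:
  assumes "vspace Z" "mlin H (Suc 0) Z F" "h \<in> carrier H"
  shows "lift Z (iter_comult H 0 h) F = F [h]"
  unfolding iter_comult.simps
  by (rule lift_pure_power[OF H.vs_C assms(1,2)]) (simp add: assms)

lemma lift_iter_Suc:
  assumes Z: "vspace Z" and F: "mlin H (Suc (Suc n)) Z F" and h: "h \<in> carrier H"
  shows "lift Z (iter_comult H (Suc n) h) F =
    lift Z (comult H h) (\<lambda>(a, b). lift Z (iter_comult H n b) (\<lambda>hs. F (a # hs)))"
proof -
  let ?P = "tensor_power H (Suc (Suc n))"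
  define g where "g t = lift Z t F" for t
  have g: "linear_map ?P Z g" unfolding g_def by (rule linear_map_lift_power[OF H.vs_C Z F])
  have gp: "g (pure_power H hs) = F hs" if "hs \<in> power_lists H (Suc (Suc n))" for hs
    unfolding g_def by (rule lift_pure_power[OF H.vs_C Z F that])
  have pc: "pure_power H (a # hs) \<in> carrier ?P" if "a \<in> carrier H" "hs \<in> power_lists H (Suc n)" for a hs
    by (rule pure_power_closed[OF H.vs_C]) (simp add: that)
  have "g (iter_comult H (Suc n) h) =
      lift Z (comult H h) (\<lambda>(a, b). lift Z (iter_comult H n b) (\<lambda>hs. F (a # hs)))"
    unfolding iter_comult.simps
    apply (subst lift_tensor_push[OF H.vs_C H.vs_C g vs_tensor_power[OF H.vs_C] Z])
      apply (assumption | rule h closed_rules pc)+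
    apply (rule H.comult_cong[OF h Z])
     apply (subst lift_power_push[OF H.vs_C g vs_tensor_power[OF H.vs_C] Z])
       apply (assumption | rule h closed_rules pc)+
     apply (rule lift_power_cong[OF H.vs_C _ Z])
       apply (assumption | rule h closed_rules pc)+
      apply (rule gp, simp)
     apply (assumption | rule h closed_rules Z mlin_closed[OF F])+
    done
  then show ?thesis by (simp add: g_def)
qed

text \<open>
  Generalised coassociativity.  The recursion for \<^const>\<open>iter_comult\<close> splits the last factor
  repeatedly; induction on \<open>i\<close> shows that any other factor may be split instead, and the case \<open>i = 0\<close> is
  coassociativity.
\<close>

lemma lift_iter_split:
  assumes "vspace Z" "mlin H (Suc (Suc n)) Z F" "h \<in> carrier H" "i \<le> n"
  shows "lift Z (iter_comult H (Suc n) h) F =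
    lift Z (iter_comult H n h) (\<lambda>hs. lift Z (comult H (hs ! i)) (\<lambda>(a, b).
      F (take i hs @ [a, b] @ drop (Suc i) hs)))"
  using assms
proof (induction i arbitrary: n h F)
  case 0
  note Z = \<open>vspace Z\<close> and F = 0(2) and h = 0(3)
  show ?case
  proof (cases n)
    case n: 0
    have F2: "F [a, b] \<in> carrier Z" if "a \<in> carrier H" "b \<in> carrier H" for a b
      using that n by (intro mlin_closed[OF F]) simp
    have "lift Z (iter_comult H (Suc 0) h) F = lift Z (comult H h) (\<lambda>(a, b). F [a, b])"
      apply (subst lift_iter_Suc[OF Z _ h])
       apply (use F n in simp)
      apply (rule H.comult_cong[OF h Z])
       apply (rule lift_iter_0[OF Z])
        apply (rule mlin_Cons)
         apply (use F n in simp)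
        apply (assumption | rule F2)+
      done
    also have "\<dots> = lift Z (iter_comult H 0 h) (\<lambda>hs. lift Z (comult H (hs ! 0)) (\<lambda>(a, b).
      F (take 0 hs @ [a, b] @ drop (Suc 0) hs)))"
      by (subst lift_iter_0[OF Z mlin_split[OF coalgebra Z] h]) (use F n in simp_all)
    finally show ?thesis using n by simp
  next
    case (Suc m)
    have F': "mlin H (Suc (Suc (Suc m))) Z F" using F Suc by simp
    have Fc: "F (a # c # hs) \<in> carrier Z" if "a \<in> carrier H" "c \<in> carrier H" "hs \<in> power_lists H (Suc m)" for a c hs
      using that by (intro mlin_closed[OF F']) simp
    note m = mlin_Cons[OF mlin_Cons[OF F']]
    have l: "linear_map H Z (\<lambda>a. F (a # c # hs))" if "c \<in> carrier H" "hs \<in> power_lists H (Suc m)" for c hs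
      using that by (intro linear_map_mlin_head[OF F']) simp
    have l2: "linear_map H Z (\<lambda>c. F (a # c # hs))" if "a \<in> carrier H" "hs \<in> power_lists H (Suc m)" for a hs
      using that by (intro linear_map_mlin_head[OF mlin_Cons[OF F']]) simp_all
    have "lift Z (iter_comult H (Suc (Suc m)) h) F = lift Z (comult H h) (\<lambda>(a, b).
        lift Z (comult H b) (\<lambda>(c, d). lift Z (iter_comult H m d) (\<lambda>hs. F (a # c # hs))))"
      apply (subst lift_iter_Suc[OF Z F' h])
      apply (rule H.comult_cong[OF h Z])
       apply (subst lift_iter_Suc[OF Z mlin_Cons[OF F']])
         apply (assumption | rule refl closed_rules Z Fc)+
      done
    also have "\<dots> = lift Z (comult H h) (\<lambda>(a, b).
        lift Z (comult H a) (\<lambda>(c, d). lift Z (iter_comult H m b) (\<lambda>hs. F (c # d # hs))))"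
      by (rule H.lift_coassoc[OF Z _ h, symmetric])
        (assumption | rule linear_rules closed_rules iter_comult_linear Z l l2 m)+
    also have "\<dots> = lift Z (comult H h) (\<lambda>(a, b).
        lift Z (iter_comult H m b) (\<lambda>hs. lift Z (comult H a) (\<lambda>(c, d). F (c # d # hs))))"
      apply (rule H.comult_cong[OF h Z])
       apply (rule lift_tensor_power_swap[OF H.vs_C H.vs_C H.vs_C _ _ Z])
         apply (assumption | rule refl closed_rules Z Fc)+
      done
    also have "\<dots> = lift Z (iter_comult H (Suc m) h) (\<lambda>hs. lift Z (comult H (hs ! 0)) (\<lambda>(a, b).
      F (take 0 hs @ [a, b] @ drop (Suc 0) hs)))"
      by (subst lift_iter_Suc[OF Z mlin_split[OF coalgebra Z] h]) (use F' in simp_all)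
    finally show ?thesis using Suc by simp
  qed
next
  case (Suc j)
  note Z = \<open>vspace Z\<close> and F = Suc.prems(2) and h = Suc.prems(3)
  obtain m where n: "n = Suc m" and j: "j \<le> m" using Suc.prems(4) by (cases n) auto
  have F': "mlin H (Suc (Suc (Suc m))) Z F" using F n by simp
  have Fc: "F (a # take j hs @ [c, d] @ drop (Suc j) hs) \<in> carrier Z"
    if "a \<in> carrier H" "hs \<in> power_lists H (Suc m)" "c \<in> carrier H" "d \<in> carrier H" for a hs c d
    using that j by (intro mlin_closed[OF F']) (auto simp: power_lists_def dest: in_set_takeD in_set_dropD)
  have nth: "hs ! j \<in> carrier H" if "hs \<in> power_lists H (Suc m)" for hs
    using that j by (intro power_lists_nth) auto
  have "lift Z (iter_comult H (Suc (Suc m)) h) F = lift Z (comult H h) (\<lambda>(a, b).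
      lift Z (iter_comult H m b) (\<lambda>hs. lift Z (comult H (hs ! j)) (\<lambda>(c, d).
        F (a # take j hs @ [c, d] @ drop (Suc j) hs))))"
    apply (subst lift_iter_Suc[OF Z F' h])
    apply (rule H.comult_cong[OF h Z])
     apply (rule Suc.IH[OF Z mlin_Cons[OF F'] _ j])
      apply (assumption | rule closed_rules Z Fc nth)+
    done
  also have "\<dots> = lift Z (iter_comult H (Suc m) h) (\<lambda>hs. lift Z (comult H (hs ! Suc j)) (\<lambda>(a, b).
      F (take (Suc j) hs @ [a, b] @ drop (Suc (Suc j)) hs)))"
    by (subst lift_iter_Suc[OF Z mlin_split[OF coalgebra Z] h]) (use F' j in simp_all)
  finally show ?case using n by simp
qed

text \<open>
  The recursion for \<^const>\<open>iter_comult\<close> separates the first factor.  Separating the last factor as well is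
  needed because the cyclic operator moves the first tensor factor to the end.
\<close>

lemma lift_iter_snoc:
  assumes "vspace Z" "mlin H (Suc (Suc n)) Z F" "h \<in> carrier H"
  shows "lift Z (iter_comult H (Suc n) h) F =
    lift Z (comult H h) (\<lambda>(a, b). lift Z (iter_comult H n a) (\<lambda>hs. F (hs @ [b])))"
  using assms
proof (induction n arbitrary: h F)
  case 0
  note Z = 0(1) and F = 0(2) and h = 0(3)
  have F2: "F [a, b] \<in> carrier Z" if "a \<in> carrier H" "b \<in> carrier H" for a b
    using that by (intro mlin_closed[OF F]) simp
  show ?case
    apply (subst lift_iter_Suc[OF Z F h])
    apply (rule H.comult_cong[OF h Z])
     apply (subst lift_iter_0[OF Z mlin_Cons[OF F]], assumption, assumption)
     apply (subst lift_iter_0[OF Z mlin_snoc[OF F]], assumption, assumption)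
     apply simp
    apply (subst lift_iter_0[OF Z mlin_snoc[OF F]], assumption, assumption)
    apply (simp add: F2)
    done
next
  case (Suc m)
  note Z = Suc.prems(1) and F = Suc.prems(2) and h = Suc.prems(3)
  have Fc: "F (a # hs @ [d]) \<in> carrier Z" if "a \<in> carrier H" "hs \<in> power_lists H (Suc m)" "d \<in> carrier H" for a hs d
    using that by (intro mlin_closed[OF F]) (auto simp: power_lists_def)
  have l1: "linear_map H Z (\<lambda>a. F (a # hs @ [d]))" if "hs \<in> power_lists H (Suc m)" "d \<in> carrier H" for hs d
    using that by (intro linear_map_mlin_head[OF F]) (simp add: power_lists_def)
  have l2: "linear_map H Z (\<lambda>d. F (a # hs @ [d]))" if "a \<in> carrier H" "hs \<in> power_lists H (Suc m)" for hs a
    using that by (intro linear_map_mlin_last[OF mlin_Cons[OF F]]) simp_all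
  note m = mlin_snoc[OF mlin_Cons[OF F]]
  have "lift Z (iter_comult H (Suc (Suc m)) h) F = lift Z (comult H h) (\<lambda>(a, b).
      lift Z (comult H b) (\<lambda>(c, d). lift Z (iter_comult H m c) (\<lambda>hs. F (a # hs @ [d]))))"
    apply (subst lift_iter_Suc[OF Z F h])
    apply (rule H.comult_cong[OF h Z])
     apply (rule Suc.IH[OF Z mlin_Cons[OF F]])
      apply (assumption | rule closed_rules Z Fc)+
    done
  also have "\<dots> = lift Z (comult H h) (\<lambda>(a, b).
      lift Z (comult H a) (\<lambda>(c, d). lift Z (iter_comult H m d) (\<lambda>hs. F (c # hs @ [b]))))"
    by (rule H.lift_coassoc[OF Z _ h, symmetric])
      (assumption | rule linear_rules closed_rules iter_comult_linear Z l1 l2 m)+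
  also have "\<dots> = lift Z (comult H h) (\<lambda>(a, b). lift Z (iter_comult H (Suc m) a) (\<lambda>hs. F (hs @ [b])))"
    apply (rule H.comult_cong[OF h Z])
     apply (subst lift_iter_Suc[OF Z mlin_snoc[OF F]], assumption, assumption)
     apply simp
    apply (assumption | rule closed_rules Z mlin_closed[OF mlin_snoc[OF F]])+
    done
  finally show ?case .
qed

text \<open>
  A factor \<open>i \<le> n\<close> arises by splitting, and the counit law undoes the splitting; the last factor is
  separated by \<open>lift_iter_snoc\<close> first.
\<close>

lemma lift_iter_counit:
  assumes Z: "vspace Z" and F: "mlin H (Suc n) Z F" and h: "h \<in> carrier H" and i: "i \<le> Suc n"
    and G: "mlin H (Suc (Suc n)) Z (\<lambda>hs. counit H (hs ! i) \<odot>\<^bsub>Z\<^esub> F (take i hs @ drop (Suc i) hs))"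
  shows "lift Z (iter_comult H (Suc n) h) (\<lambda>hs. counit H (hs ! i) \<odot>\<^bsub>Z\<^esub> F (take i hs @ drop (Suc i) hs)) =
    lift Z (iter_comult H n h) F"
proof (cases "i \<le> n")
  case True
  show ?thesis
    unfolding lift_iter_split[OF Z G h True]
  proof (rule lift_power_cong[OF H.vs_C iter_comult_closed[OF h] Z])
    fix hs assume hs: "hs \<in> power_lists H (Suc n)"
    then have len: "length hs = Suc n" by (simp add: power_lists_def)
    have upd: "take i hs @ b # drop (Suc i) hs = hs[i := b]" for b
      using len True by (simp add: upd_conv_take_nth_drop)
    have "lift Z (comult H (hs ! i)) (\<lambda>(a, b).
        counit H ((take i hs @ [a, b] @ drop (Suc i) hs) ! i) \<odot>\<^bsub>Z\<^esub>
          F (take i (take i hs @ [a, b] @ drop (Suc i) hs) @ drop (Suc i) (take i hs @ [a, b] @ drop (Suc i) hs))) =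
      lift Z (comult H (hs ! i)) (\<lambda>(a, b). counit H a \<odot>\<^bsub>Z\<^esub> F (hs[i := b]))"
      using len True by (simp add: nth_append upd)
    also have "\<dots> = F (hs[i := hs ! i])"
      by (rule H.lift_counit_left[OF Z mlin_update[OF F hs]])
        (use hs True in \<open>auto intro: power_lists_nth\<close>)
    finally show "lift Z (comult H (hs ! i)) (\<lambda>(a, b).
        counit H ((take i hs @ [a, b] @ drop (Suc i) hs) ! i) \<odot>\<^bsub>Z\<^esub>
          F (take i (take i hs @ [a, b] @ drop (Suc i) hs) @ drop (Suc i) (take i hs @ [a, b] @ drop (Suc i) hs))) = F hs"
      by simp
  qed (rule mlin_closed[OF F])
next
  case False
  then have i: "i = Suc n" using i by simp
  have lin: "linear_map H Z (\<lambda>b. lift Z (iter_comult H n b) F)"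
    by (assumption | rule linear_rules closed_rules iter_comult_linear Z F)+
  have push: "a \<odot>\<^bsub>Z\<^esub> lift Z (iter_comult H n b) F = lift Z (iter_comult H n b) (\<lambda>hs. a \<odot>\<^bsub>Z\<^esub> F hs)"
    if "b \<in> carrier H" for a b
    by (rule lift_power_push[OF H.vs_C linear_map_scale[OF Z linear_map_id] Z Z])
      (assumption | rule closed_rules that mlin_closed[OF F])+
  have "lift Z (iter_comult H (Suc n) h) (\<lambda>hs. counit H (hs ! i) \<odot>\<^bsub>Z\<^esub> F (take i hs @ drop (Suc i) hs)) =
      lift Z (comult H h) (\<lambda>(a, b). counit H b \<odot>\<^bsub>Z\<^esub> lift Z (iter_comult H n a) F)"
    unfolding lift_iter_snoc[OF Z G h]
    apply (rule H.comult_cong[OF h Z])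
     apply (subst push, assumption)
     apply (rule lift_power_cong[OF H.vs_C iter_comult_closed Z], assumption)
      apply (simp add: i power_lists_def nth_append)
     apply (assumption | rule closed_rules Z mlin_closed[OF F])+
    done
  also have "\<dots> = lift Z (iter_comult H n h) F"
    by (rule H.lift_counit_right[OF Z lin h])
  finally show ?thesis .
qed

text \<open>
  The iterated coproduct is multiplicative, because the coproduct is.  This is what makes the diagonal
  action compatible with products.
\<close>

lemma lift_iter_mult:
  assumes "vspace Z" "mlin H (Suc n) Z F" "h \<in> carrier H" "k \<in> carrier H"
  shows "lift Z (iter_comult H n (h \<cdot> k)) F =
    lift Z (iter_comult H n h) (\<lambda>hs. lift Z (iter_comult H n k) (\<lambda>ks. F (map2 (mult H) hs ks)))"
  using assms
proof (induction n arbitrary: h k F)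
  case 0
  note Z = 0(1) and F = 0(2) and h = 0(3) and k = 0(4)
  have f: "linear_map H H (mult H h)" if "h \<in> carrier H" for h
    by (assumption | rule linear_rules that)+
  have f': "linear_map H H (\<lambda>h. mult H h k)" if "k \<in> carrier H" for k
    by (assumption | rule linear_rules that)+
  have mk: "mlin H (Suc 0) Z (\<lambda>ks. F (map2 (mult H) hs ks))" if "hs \<in> power_lists H (Suc 0)" for hs
    by (rule mlin_map2_right[OF F that f])
  have mh: "mlin H (Suc 0) Z (\<lambda>hs. F (map2 (mult H) hs [k]))"
    using k by (intro mlin_map2_left[OF F _ f']) simp_all
  have "lift Z (iter_comult H 0 h) (\<lambda>hs. lift Z (iter_comult H 0 k) (\<lambda>ks. F (map2 (mult H) hs ks))) =
      lift Z (iter_comult H 0 h) (\<lambda>hs. F (map2 (mult H) hs [k]))"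
    by (rule lift_power_cong[OF H.vs_C iter_comult_closed[OF h] Z lift_iter_0[OF Z mk k] mlin_closed[OF mh]])
  then show ?case
    by (simp only: lift_iter_0[OF Z mh h]) (simp add: lift_iter_0[OF Z F] h k)
next
  case (Suc n)
  note Z = Suc.prems(1) and F = Suc.prems(2) and h = Suc.prems(3) and k = Suc.prems(4)
  have f: "linear_map H H (mult H h)" if "h \<in> carrier H" for h
    by (assumption | rule linear_rules that)+
  have f': "linear_map H H (\<lambda>h. mult H h k)" if "k \<in> carrier H" for k
    by (assumption | rule linear_rules that)+
  let ?n = "Suc (Suc n)"
  have Fc: "F (map2 (mult H) hs ks) \<in> carrier Z" if "hs \<in> power_lists H ?n" "ks \<in> power_lists H ?n" for hs ks
    using that by (intro mlin_closed[OF F] map2_power_lists) auto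
  have mk: "mlin H ?n Z (\<lambda>ks. F (map2 (mult H) hs ks))" if "hs \<in> power_lists H ?n" for hs
    by (rule mlin_map2_right[OF F that f])
  have mh: "mlin H ?n Z (\<lambda>hs. F (map2 (mult H) hs ks))" if "ks \<in> power_lists H ?n" for ks
    by (rule mlin_map2_left[OF F that f'])
  have Fc1: "F ((h1 \<cdot> k1) # map2 (mult H) hs ks) \<in> carrier Z"
    if "h1 \<in> carrier H" "k1 \<in> carrier H" "hs \<in> power_lists H (Suc n)" "ks \<in> power_lists H (Suc n)" for h1 k1 hs ks
    using Fc[of "h1 # hs" "k1 # ks"] that by simp
  have "lift Z (iter_comult H (Suc n) (h \<cdot> k)) F =
      lift Z (comult H (h \<cdot> k)) (\<lambda>(a, b). lift Z (iter_comult H n b) (\<lambda>hs. F (a # hs)))"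
    by (rule lift_iter_Suc[OF Z F]) (simp add: h k)
  also have "\<dots> = lift Z (comult H h) (\<lambda>(h1, h2). lift Z (comult H k) (\<lambda>(k1, k2).
      lift Z (iter_comult H n (h2 \<cdot> k2)) (\<lambda>hs. F ((h1 \<cdot> k1) # hs))))"
    by (rule lift_comult_mult[OF Z _ h k])
      (assumption | rule linear_rules closed_rules iter_comult_linear Z linear_map_mlin_head[OF F]
        mlin_Cons[OF F])+
  also have "\<dots> = lift Z (comult H h) (\<lambda>(h1, h2). lift Z (comult H k) (\<lambda>(k1, k2).
      lift Z (iter_comult H n h2) (\<lambda>hs. lift Z (iter_comult H n k2) (\<lambda>ks.
        F ((h1 \<cdot> k1) # map2 (mult H) hs ks)))))"
    apply (rule H.comult_cong[OF h Z])
     apply (rule H.comult_cong[OF k Z])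
      apply (rule Suc.IH[OF Z mlin_Cons[OF F]])
        apply (assumption | rule closed_rules Z Fc1 h k)+
    done
  also have "\<dots> = lift Z (comult H h) (\<lambda>(h1, h2). lift Z (iter_comult H n h2) (\<lambda>hs.
      lift Z (comult H k) (\<lambda>(k1, k2). lift Z (iter_comult H n k2) (\<lambda>ks.
        F ((h1 \<cdot> k1) # map2 (mult H) hs ks)))))"
    apply (rule H.comult_cong[OF h Z])
     apply (rule lift_tensor_power_swap[OF H.vs_C H.vs_C H.vs_C _ _ Z])
       apply (assumption | rule closed_rules Z Fc1 h k)+
    done
  also have "\<dots> = lift Z (iter_comult H (Suc n) h) (\<lambda>hs.
      lift Z (iter_comult H (Suc n) k) (\<lambda>ks. F (map2 (mult H) hs ks)))"
    apply (subst lift_iter_Suc[OF Z _ h])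
     apply (rule mlinI)
      apply (assumption | rule closed_rules Z Fc k)+
     apply (rule lift_power_family[OF H.vs_C _ H.vs_C Z])
      apply (assumption | rule closed_rules k)+
     apply (rule mlin_slot[OF mh])
      apply assumption
     apply (rule linear_rules power_lists_set | assumption | simp)+
    apply (rule H.comult_cong[OF h Z])
     apply (rule lift_power_cong[OF H.vs_C _ Z])
       apply (assumption | rule closed_rules)+
      apply (subst lift_iter_Suc[OF Z mk k])
       apply simp
      apply simp
     apply (rule closed_rules Z k Fc | assumption | simp)+
    done
  finally show ?case .
qed

end

section \<open>The diagonal action\<close>

locale hopf_module_coalgebra = hopf_algebra H + mc: module_coalgebra H C
  for H :: "('h, 'x) hopf_algebra_scheme" and C :: "('h, 'c, 'y) module_coalgebra_scheme"

sublocale hopf_module_coalgebra \<subseteq> C: coalgebra C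
  by (rule mc.coalgebra)

context hopf_module_coalgebra
begin

abbreviation P where "P n \<equiv> tensor_power C (Suc n)"

lemmas vs_P [simp] = vs_tensor_power[OF C.vs_C, of "Suc n" for n]

lemma lact_linear_right: "h \<in> carrier H \<Longrightarrow> linear_map C C (lact C h)"
  and lact_linear_left: "c \<in> carrier C \<Longrightarrow> linear_map H C (\<lambda>h. lact C h c)"
  and lact_mult: "h \<in> carrier H \<Longrightarrow> k \<in> carrier H \<Longrightarrow> c \<in> carrier C \<Longrightarrow>
    lact C (h \<cdot> k) c = lact C h (lact C k c)"
  using mc.action by (simp_all add: left_action_def)

lemma lact_closed [closed_rules]: "h \<in> carrier H \<Longrightarrow> c \<in> carrier C \<Longrightarrow> lact C h c \<in> carrier C"
  by (rule linear_map_closed[OF lact_linear_right])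

lemma linear_map_lact_left [linear_rules]:
  "linear_map U H g \<Longrightarrow> c \<in> carrier C \<Longrightarrow> linear_map U C (\<lambda>u. lact C (g u) c)"
  by (rule linear_map_compose[OF lact_linear_left])

lemma lift_comult_lact:
  assumes Z: "vspace Z" and F: "bilin C C Z F" and hc: "h \<in> carrier H" "c \<in> carrier C"
  shows "lift Z (comult C (lact C h c)) (case_prod F) =
    lift Z (comult H h) (\<lambda>(h1, h2). lift Z (comult C c) (\<lambda>(c1, c2).
      F (lact C h1 c1) (lact C h2 c2)))"
proof -
  define g where "g t = lift Z t (case_prod F)" for t
  have g: "linear_map (tensor C C) Z g"
    unfolding g_def by (rule linear_map_lift_tensor[OF C.vs_C C.vs_C Z F])
  have gp: "g (pure_tensor C C a b) = F a b" if "a \<in> carrier C" "b \<in> carrier C" for a b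
    unfolding g_def by (rule lift_pure_tensor[OF C.vs_C C.vs_C Z F that])
  note pushH = lift_tensor_push[OF H.vs_C H.vs_C g vs_tensor[OF C.vs_C C.vs_C] Z]
  note pushC = lift_tensor_push[OF C.vs_C C.vs_C g vs_tensor[OF C.vs_C C.vs_C] Z]
  have "g (comult C (lact C h c)) =
    lift Z (comult H h) (\<lambda>(h1, h2). lift Z (comult C c) (\<lambda>(c1, c2).
      F (lact C h1 c1) (lact C h2 c2)))"
    unfolding mc.comult_lact[OF hc]
    apply (subst pushH)
      apply (assumption | rule hc closed_rules)+
    apply (rule lift_tensor_cong[OF H.vs_C H.vs_C _ Z])
      apply (rule closed_rules hc)+
     apply (subst pushC)
       apply (assumption | rule hc closed_rules)+
     apply (rule lift_tensor_cong[OF C.vs_C C.vs_C _ Z])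
       apply (assumption | rule hc gp closed_rules Z bilin_closed[OF F])+
    done
  then show ?thesis by (simp add: g_def)
qed

lemma mlin_lact_left:
  "mlin C n Z F \<Longrightarrow> cs \<in> power_lists C n \<Longrightarrow> mlin H n Z (\<lambda>hs. F (map2 (lact C) hs cs))"
  by (rule mlin_map2_left[OF _ _ lact_linear_left])

lemma mlin_lact_right:
  "mlin C n Z F \<Longrightarrow> hs \<in> power_lists H n \<Longrightarrow> mlin C n Z (\<lambda>cs. F (map2 (lact C) hs cs))"
  by (rule mlin_map2_right[OF _ _ lact_linear_right])

lemma map2_lact_closed [closed_rules]:
  "hs \<in> power_lists H n \<Longrightarrow> cs \<in> power_lists C n \<Longrightarrow> map2 (lact C) hs cs \<in> power_lists C n"
  by (rule map2_power_lists[OF _ _ lact_closed])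

lemma mlin_diag_act:
  assumes "h \<in> carrier H"
  shows "mlin C (Suc n) (P n)
    (\<lambda>cs. lift (P n) (iter_comult H n h) (\<lambda>hs. pure_power C (map2 (lact C) hs cs)))"
proof (rule mlinI)
  fix xs ys assume "set xs \<subseteq> carrier C" "set ys \<subseteq> carrier C" "Suc n = Suc (length xs + length ys)"
  then have sl: "slot C C (Suc n) (\<lambda>v. xs @ v # ys)" by (rule slot_middle)
  show "linear_map C (P n) (\<lambda>v. lift (P n) (iter_comult H n h) (\<lambda>hs. pure_power C (map2 (lact C) hs (xs @ v # ys))))"
    by (rule lift_power_family[OF H.vs_C iter_comult_closed[OF assms] C.vs_C vs_P])
      (rule mlin_slot[OF mlin_lact_right[OF mlin_pure_power[OF C.vs_C]] sl])
qed (assumption | rule closed_rules assms)+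

lemma linear_map_diag_act: "h \<in> carrier H \<Longrightarrow> linear_map (P n) (P n) (diag_act H C n h)"
  unfolding diag_act_def
  by (rule linear_map_lift_power[OF C.vs_C vs_P mlin_diag_act])

lemma diag_act_closed [closed_rules]:
  "h \<in> carrier H \<Longrightarrow> d \<in> carrier (P n) \<Longrightarrow> diag_act H C n h d \<in> carrier (P n)"
  by (rule linear_map_closed[OF linear_map_diag_act])

lemma linear_map_diag_act_right [linear_rules]:
  "linear_map U (P n) g \<Longrightarrow> h \<in> carrier H \<Longrightarrow> linear_map U (P n) (\<lambda>u. diag_act H C n h (g u))"
  by (rule linear_map_compose[OF linear_map_diag_act])

lemma linear_map_diag_act_left [linear_rules]:
  assumes "linear_map U H g" "d \<in> carrier (P n)"
  shows "linear_map U (P n) (\<lambda>u. diag_act H C n (g u) d)"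
proof -
  have "linear_map H (P n) (\<lambda>h. diag_act H C n h d)"
    unfolding diag_act_def
    by (rule lift_power_family[OF C.vs_C assms(2) H.vs_C vs_P])
      (assumption | rule linear_rules closed_rules mlin_lact_left mlin_pure_power)+
  from linear_map_compose[OF this assms(1)] show ?thesis .
qed

lemma diag_act_pure:
  assumes "h \<in> carrier H" "cs \<in> power_lists C (Suc n)"
  shows "diag_act H C n h (pure_power C cs) =
    lift (P n) (iter_comult H n h) (\<lambda>hs. pure_power C (map2 (lact C) hs cs))"
  unfolding diag_act_def
  by (rule lift_pure_power[OF C.vs_C vs_P mlin_diag_act[OF assms(1)] assms(2)])

lemma linear_map_diag_act_pure:
  assumes Z: "vspace Z" and g: "linear_map (P n) Z g" and h: "h \<in> carrier H" and cs: "cs \<in> power_lists C (Suc n)"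
  shows "g (diag_act H C n h (pure_power C cs)) =
    lift Z (iter_comult H n h) (\<lambda>hs. g (pure_power C (map2 (lact C) hs cs)))"
  unfolding diag_act_pure[OF h cs]
  by (rule lift_power_push[OF H.vs_C g vs_P Z])
    (assumption | rule closed_rules h cs)+

lemma diag_act_mult:
  assumes "h \<in> carrier H" "k \<in> carrier H" "d \<in> carrier (P n)"
  shows "diag_act H C n (h \<cdot> k) d = diag_act H C n h (diag_act H C n k d)"
proof (rule power_ext[OF C.vs_C _ _ _ _ assms(3)])
  note Z = vs_P[of n]
  show "vspace (P n)" by (rule Z)
  show "linear_map (P n) (P n) (diag_act H C n (h \<cdot> k))"
    using assms by (intro linear_map_diag_act) simp
  show "linear_map (P n) (P n) (\<lambda>d. diag_act H C n h (diag_act H C n k d))"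
    by (rule linear_map_compose[OF linear_map_diag_act linear_map_diag_act]) (rule assms)+
  fix cs assume cs: "cs \<in> power_lists C (Suc n)"
  have act: "map2 (lact C) (map2 (mult H) hs ks) cs = map2 (lact C) hs (map2 (lact C) ks cs)"
    if "hs \<in> power_lists H (Suc n)" "ks \<in> power_lists H (Suc n)" for hs ks
  proof (rule nth_equalityI)
    fix i assume "i < length (map2 (lact C) (map2 (mult H) hs ks) cs)"
    then have "i < Suc n" using that cs by (simp add: power_lists_def)
    then show "map2 (lact C) (map2 (mult H) hs ks) cs ! i = map2 (lact C) hs (map2 (lact C) ks cs) ! i"
      using that cs power_lists_nth[of hs H "Suc n" i] power_lists_nth[of ks H "Suc n" i]
        power_lists_nth[of cs C "Suc n" i]
      by (simp add: lact_mult power_lists_length)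
  qed (use that cs in \<open>simp add: power_lists_def\<close>)
  have "diag_act H C n (h \<cdot> k) (pure_power C cs) =
      lift (P n) (iter_comult H n (h \<cdot> k)) (\<lambda>hs. pure_power C (map2 (lact C) hs cs))"
    using assms cs by (simp add: diag_act_pure)
  also have "\<dots> = lift (P n) (iter_comult H n h) (\<lambda>hs. lift (P n) (iter_comult H n k)
      (\<lambda>ks. pure_power C (map2 (lact C) (map2 (mult H) hs ks) cs)))"
    by (rule lift_iter_mult[OF Z mlin_lact_left[OF mlin_pure_power[OF C.vs_C] cs] assms(1,2)])
  also have "\<dots> = lift (P n) (iter_comult H n h) (\<lambda>hs. lift (P n) (iter_comult H n k)
      (\<lambda>ks. pure_power C (map2 (lact C) hs (map2 (lact C) ks cs))))"
    apply (rule lift_power_cong[OF H.vs_C iter_comult_closed[OF assms(1)] Z])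
     apply (rule lift_power_cong[OF H.vs_C iter_comult_closed[OF assms(2)] Z])
      apply (simp only: act)
     apply (assumption | rule closed_rules assms cs)+
    done
  also have "\<dots> = lift (P n) (iter_comult H n k) (\<lambda>ks. lift (P n) (iter_comult H n h)
      (\<lambda>hs. pure_power C (map2 (lact C) hs (map2 (lact C) ks cs))))"
    by (rule lift_power_swap[OF H.vs_C H.vs_C _ _ Z]) (assumption | rule closed_rules assms cs)+
  also have "\<dots> = lift (P n) (iter_comult H n k) (\<lambda>ks. diag_act H C n h (pure_power C (map2 (lact C) ks cs)))"
    apply (rule lift_power_cong[OF H.vs_C iter_comult_closed[OF assms(2)] Z])
     apply (rule diag_act_pure[symmetric])
      apply (assumption | rule closed_rules assms cs)+
    done
  also have "\<dots> = diag_act H C n h (diag_act H C n k (pure_power C cs))"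
    by (rule linear_map_diag_act_pure[OF Z linear_map_diag_act, symmetric]) (rule assms cs)+
  finally show "diag_act H C n (h \<cdot> k) (pure_power C cs) =
    diag_act H C n h (diag_act H C n k (pure_power C cs))" .
qed

text \<open>
  The coproduct and the counit of \<open>C\<close>, applied to one tensor factor.  Cofaces and codegeneracies are
  built from these maps, and everything that is needed about them follows from two properties: these
  maps are equivariant for the diagonal action, and they can be moved past a rotation.
\<close>

definition comult_at :: "nat \<Rightarrow> nat \<Rightarrow> ('c list \<Rightarrow> complex) set \<Rightarrow> ('c list \<Rightarrow> complex) set" where
  "comult_at n i d = lift (P (Suc n)) d (\<lambda>cs. lift (P (Suc n)) (comult C (cs ! i))
     (\<lambda>(a, b). pure_power C (take i cs @ [a, b] @ drop (Suc i) cs)))"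

definition counit_at :: "nat \<Rightarrow> nat \<Rightarrow> ('c list \<Rightarrow> complex) set \<Rightarrow> ('c list \<Rightarrow> complex) set" where
  "counit_at n i d = lift (P n) d (\<lambda>cs. counit C (cs ! i) \<odot>\<^bsub>P n\<^esub> pure_power C (take i cs @ drop (Suc i) cs))"

lemma comult_at_linear: "i \<le> n \<Longrightarrow> linear_map (P n) (P (Suc n)) (comult_at n i)"
  unfolding comult_at_def
  by (intro linear_map_lift_power C.vs_C vs_tensor_power mlin_split mlin_pure_power mc.coalgebra) simp

lemma comult_at_pure:
  assumes "i \<le> n" "cs \<in> power_lists C (Suc n)"
  shows "comult_at n i (pure_power C cs) = lift (P (Suc n)) (comult C (cs ! i))
     (\<lambda>(a, b). pure_power C (take i cs @ [a, b] @ drop (Suc i) cs))"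
  unfolding comult_at_def
  by (rule lift_pure_power[OF C.vs_C vs_P mlin_split[OF mc.coalgebra
        vs_P mlin_pure_power[OF C.vs_C]] assms(2)]) (use assms in simp)

lemma split_list_closed [closed_rules]:
  assumes "cs \<in> power_lists V (Suc n)" "i \<le> n" "a \<in> carrier V" "b \<in> carrier V"
  shows "take i cs @ [a, b] @ drop (Suc i) cs \<in> power_lists V (Suc (Suc n))"
  using assms by (auto simp: power_lists_def dest: in_set_takeD in_set_dropD)

lemma delete_list_closed [closed_rules]:
  assumes "cs \<in> power_lists V (Suc n)" "i \<le> n"
  shows "take i cs @ drop (Suc i) cs \<in> power_lists V n"
  using assms by (auto simp: power_lists_def dest: in_set_takeD in_set_dropD)

text \<open>
  By \<open>\<Delta>(h c) = h\<^sup>(\<^sup>1\<^sup>) c\<^sup>(\<^sup>1\<^sup>) \<otimes> h\<^sup>(\<^sup>2\<^sup>) c\<^sup>(\<^sup>2\<^sup>)\<close>, splitting factor \<open>i\<close> after acting splits factor \<open>i\<close> of the iterated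
  coproduct of \<open>h\<close> as well; by \<open>lift_iter_split\<close> this is the next iterated coproduct.
\<close>

lemma comult_at_diag_act:
  assumes i: "i \<le> n" and h: "h \<in> carrier H" and d: "d \<in> carrier (P n)"
  shows "comult_at n i (diag_act H C n h d) = diag_act H C (Suc n) h (comult_at n i d)"
proof (rule power_ext[OF C.vs_C _ _ _ _ d])
  note Z = vs_P[of "Suc n"]
  show "vspace (P (Suc n))" by (rule Z)
  show "linear_map (P n) (P (Suc n)) (\<lambda>d. comult_at n i (diag_act H C n h d))"
    by (rule linear_map_compose[OF comult_at_linear[OF i] linear_map_diag_act[OF h]])
  show "linear_map (P n) (P (Suc n)) (\<lambda>d. diag_act H C (Suc n) h (comult_at n i d))"
    by (rule linear_map_compose[OF linear_map_diag_act[OF h] comult_at_linear[OF i]])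
  fix cs assume cs: "cs \<in> power_lists C (Suc n)"
  have csi: "cs ! i \<in> carrier C" using power_lists_nth[OF cs] i by simp
  have nth: "hs ! i \<in> carrier H" if "hs \<in> power_lists H (Suc n)" for hs
    using power_lists_nth[OF that] i by simp
  let ?p = "\<lambda>hs a b. pure_power C (map2 (lact C) hs (take i cs @ [a, b] @ drop (Suc i) cs))"
  have eq: "pure_power C (take i (map2 (lact C) hs cs) @ [lact C x a, lact C y b] @ drop (Suc i) (map2 (lact C) hs cs))
      = ?p (take i hs @ [x, y] @ drop (Suc i) hs) a b"
    if "hs \<in> power_lists H (Suc n)" for hs x y a b
    using power_lists_length[OF that] power_lists_length[OF cs] i
    by (simp add: take_map drop_map take_zip drop_zip)
  have bil: "bilin C C (P (Suc n)) (\<lambda>a b. pure_power C (take i ds @ [a, b] @ drop (Suc i) ds))"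
    if ds: "ds \<in> power_lists C (Suc n)" for ds
  proof (rule bilinI)
    note t = power_lists_take[OF ds, of i] power_lists_drop[OF ds refl, of "Suc i"]
    have sub: "set (take i ds) \<subseteq> carrier C" "set (drop (Suc i) ds) \<subseteq> carrier C" "length ds = Suc n"
      using ds by (auto simp: power_lists_def dest: in_set_takeD in_set_dropD)
    fix a assume a: "a \<in> carrier C"
    show "linear_map C (P (Suc n)) (\<lambda>x. pure_power C (take i ds @ [x, a] @ drop (Suc i) ds))"
      using mlin_slot[OF mlin_pure_power[OF C.vs_C] slot_middle[of "take i ds" C "a # drop (Suc i) ds"]]
        sub a i by simp
    show "linear_map C (P (Suc n)) (\<lambda>x. pure_power C (take i ds @ [a, x] @ drop (Suc i) ds))"
      using mlin_slot[OF mlin_pure_power[OF C.vs_C] slot_middle[of "take i ds @ [a]" C "drop (Suc i) ds"]]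
        sub a i by simp
  qed
  have "comult_at n i (diag_act H C n h (pure_power C cs)) =
      lift (P (Suc n)) (iter_comult H n h) (\<lambda>hs. comult_at n i (pure_power C (map2 (lact C) hs cs)))"
    by (rule linear_map_diag_act_pure[OF Z comult_at_linear[OF i] h cs])
  also have "\<dots> = lift (P (Suc n)) (iter_comult H n h) (\<lambda>hs.
      lift (P (Suc n)) (comult C (lact C (hs ! i) (cs ! i))) (\<lambda>(a, b).
        pure_power C (take i (map2 (lact C) hs cs) @ [a, b] @ drop (Suc i) (map2 (lact C) hs cs))))"
    apply (rule lift_power_cong[OF H.vs_C iter_comult_closed[OF h] Z])
    subgoal for hs
      using comult_at_pure[OF i map2_lact_closed[of hs, OF _ cs]] i
        power_lists_length[of hs H "Suc n"] power_lists_length[OF cs] by simp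
    apply (assumption | rule closed_rules i cs csi nth)+
    done
  also have "\<dots> = lift (P (Suc n)) (iter_comult H n h) (\<lambda>hs.
      lift (P (Suc n)) (comult H (hs ! i)) (\<lambda>(x, y). lift (P (Suc n)) (comult C (cs ! i)) (\<lambda>(a, b).
        ?p (take i hs @ [x, y] @ drop (Suc i) hs) a b)))"
    apply (rule lift_power_cong[OF H.vs_C iter_comult_closed[OF h] Z])
     apply (subst lift_comult_lact[OF Z bil nth csi])
       apply (assumption | rule closed_rules i cs)+
     apply (rule lift_tensor_cong[OF H.vs_C H.vs_C _ Z])
       apply (assumption | rule closed_rules nth)+
      apply (rule lift_tensor_cong[OF C.vs_C C.vs_C _ Z])
        apply (assumption | rule closed_rules eq csi i cs nth)+
    done
  also have "\<dots> = lift (P (Suc n)) (iter_comult H n h) (\<lambda>hs.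
      lift (P (Suc n)) (comult C (cs ! i)) (\<lambda>(a, b). lift (P (Suc n)) (comult H (hs ! i)) (\<lambda>(x, y).
        ?p (take i hs @ [x, y] @ drop (Suc i) hs) a b)))"
    apply (rule lift_power_cong[OF H.vs_C iter_comult_closed[OF h] Z])
     apply (rule lift_tensor_swap[OF H.vs_C H.vs_C C.vs_C C.vs_C _ _ Z])
       apply (assumption | rule closed_rules csi i cs nth)+
    done
  also have "\<dots> = lift (P (Suc n)) (comult C (cs ! i)) (\<lambda>(a, b). lift (P (Suc n)) (iter_comult H n h) (\<lambda>hs.
      lift (P (Suc n)) (comult H (hs ! i)) (\<lambda>(x, y).
        ?p (take i hs @ [x, y] @ drop (Suc i) hs) a b)))"
    by (rule lift_tensor_power_swap[OF C.vs_C C.vs_C H.vs_C _ _ Z, symmetric])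
      (assumption | rule closed_rules csi i cs nth h)+
  also have "\<dots> = lift (P (Suc n)) (comult C (cs ! i)) (\<lambda>(a, b).
      lift (P (Suc n)) (iter_comult H (Suc n) h) (\<lambda>hs. ?p hs a b))"
    apply (rule C.comult_cong[OF csi Z])
     apply (rule lift_iter_split[OF Z mlin_lact_left[OF mlin_pure_power[OF C.vs_C]] h i, symmetric])
     apply (assumption | rule closed_rules csi i cs nth h)+
    done
  also have "\<dots> = lift (P (Suc n)) (comult C (cs ! i)) (\<lambda>(a, b).
      diag_act H C (Suc n) h (pure_power C (take i cs @ [a, b] @ drop (Suc i) cs)))"
    apply (rule C.comult_cong[OF csi Z])
     apply (rule diag_act_pure[OF h, symmetric])
     apply (assumption | rule closed_rules csi i cs nth h)+
    done
  also have "\<dots> = diag_act H C (Suc n) h (comult_at n i (pure_power C cs))"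
    unfolding comult_at_pure[OF i cs]
    by (rule lift_tensor_push[OF C.vs_C C.vs_C linear_map_diag_act[OF h] Z Z, symmetric])
      (assumption | rule closed_rules csi i cs)+
  finally show "comult_at n i (diag_act H C n h (pure_power C cs)) =
      diag_act H C (Suc n) h (comult_at n i (pure_power C cs))" .
qed

lemma mlin_delete:
  assumes Z: "vspace Z" and V: "vspace V" and F: "mlin V n Z F" and i: "i \<le> n"
    and e: "linear_map V cplx e"
  shows "mlin V (Suc n) Z (\<lambda>cs. e (cs ! i) \<odot>\<^bsub>Z\<^esub> F (take i cs @ drop (Suc i) cs))"
proof (rule mlinI)
  show "e (cs ! i) \<odot>\<^bsub>Z\<^esub> F (take i cs @ drop (Suc i) cs) \<in> carrier Z" if "cs \<in> power_lists V (Suc n)" for cs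
    using delete_list_closed[OF that i] by (intro vs_smult_closed Z mlin_closed[OF F])
  fix xs ys assume xy: "set xs \<subseteq> carrier V" "set ys \<subseteq> carrier V" "Suc n = Suc (length xs + length ys)"
  consider (lt) "i < length xs" | (eq) "i = length xs" | (gt) "length xs < i" by linarith
  then show "linear_map V Z (\<lambda>v. e ((xs @ v # ys) ! i) \<odot>\<^bsub>Z\<^esub> F (take i (xs @ v # ys) @ drop (Suc i) (xs @ v # ys)))"
  proof cases
    case lt
    have "slot V V n (\<lambda>v. (take i xs @ drop (Suc i) xs) @ v # ys)"
      using xy lt by (intro slot_middle) (auto dest: in_set_takeD in_set_dropD)
    from linear_map_scale[OF Z mlin_slot[OF F this], of "e (xs ! i)"] lt show ?thesis
      by (simp add: nth_append)
  next
    case eq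
    have "xs @ ys \<in> power_lists V n" using xy by (auto simp: power_lists_def)
    from linear_map_smult_left[OF Z e mlin_closed[OF F this]] eq show ?thesis by simp
  next
    case gt
    define j where "j = i - Suc (length xs)"
    have ij: "i = Suc (length xs + j)" and j: "j < length ys" using gt i xy(3) by (auto simp: j_def)
    have "slot V V n (\<lambda>v. xs @ v # (take j ys @ drop (Suc j) ys))"
      using xy j by (intro slot_middle) (auto dest: in_set_takeD in_set_dropD)
    from linear_map_scale[OF Z mlin_slot[OF F this], of "e (ys ! j)"] ij show ?thesis
      by (simp add: nth_append)
  qed
qed

lemma counit_at_linear: "i \<le> Suc n \<Longrightarrow> linear_map (P (Suc n)) (P n) (counit_at n i)"
  unfolding counit_at_def
  by (intro linear_map_lift_power C.vs_C vs_tensor_power mlin_delete mlin_pure_power C.counit_linear)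

lemma counit_at_pure:
  assumes "i \<le> Suc n" "cs \<in> power_lists C (Suc (Suc n))"
  shows "counit_at n i (pure_power C cs) = counit C (cs ! i) \<odot>\<^bsub>P n\<^esub> pure_power C (take i cs @ drop (Suc i) cs)"
  unfolding counit_at_def
  by (rule lift_pure_power) (use assms in \<open>auto intro!: C.vs_C vs_tensor_power mlin_delete mlin_pure_power C.counit_linear\<close>)

text \<open>
  By \<open>\<epsilon>(h c) = \<epsilon>(h) \<epsilon>(c)\<close>, the counit also hits factor \<open>i\<close> of the iterated coproduct of \<open>h\<close>, which it removes
  by \<open>lift_iter_counit\<close>.
\<close>

lemma counit_at_diag_act:
  assumes i: "i \<le> Suc n" and h: "h \<in> carrier H" and d: "d \<in> carrier (P (Suc n))"
  shows "counit_at n i (diag_act H C (Suc n) h d) = diag_act H C n h (counit_at n i d)"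
proof (rule power_ext[OF C.vs_C _ _ _ _ d])
  note Z = vs_P[of n]
  show "vspace (P n)" by (rule Z)
  show "linear_map (P (Suc n)) (P n) (\<lambda>d. counit_at n i (diag_act H C (Suc n) h d))"
    by (rule linear_map_compose[OF counit_at_linear[OF i] linear_map_diag_act[OF h]])
  show "linear_map (P (Suc n)) (P n) (\<lambda>d. diag_act H C n h (counit_at n i d))"
    by (rule linear_map_compose[OF linear_map_diag_act[OF h] counit_at_linear[OF i]])
  fix cs assume cs: "cs \<in> power_lists C (Suc (Suc n))"
  have csi: "cs ! i \<in> carrier C" using power_lists_nth[OF cs] i by simp
  let ?cs = "take i cs @ drop (Suc i) cs"
  let ?c = "counit C (cs ! i)"
  have cs': "?cs \<in> power_lists C (Suc n)" by (rule delete_list_closed[OF cs i])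
  define F where "F hs = ?c \<odot>\<^bsub>P n\<^esub> pure_power C (map2 (lact C) hs ?cs)" for hs
  have F: "mlin H (Suc n) (P n) F"
    unfolding F_def
    by (rule mlin_compose[OF linear_map_scale[OF Z linear_map_id] mlin_lact_left[OF mlin_pure_power[OF C.vs_C] cs']])
  have "counit_at n i (diag_act H C (Suc n) h (pure_power C cs)) =
      lift (P n) (iter_comult H (Suc n) h) (\<lambda>hs. counit_at n i (pure_power C (map2 (lact C) hs cs)))"
    by (rule linear_map_diag_act_pure[OF Z counit_at_linear[OF i] h cs])
  also have "\<dots> = lift (P n) (iter_comult H (Suc n) h) (\<lambda>hs. counit H (hs ! i) \<odot>\<^bsub>P n\<^esub> F (take i hs @ drop (Suc i) hs))"
  proof (rule lift_power_cong[OF H.vs_C iter_comult_closed[OF h] Z])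
    fix hs assume hs: "hs \<in> power_lists H (Suc (Suc n))"
    have hsi: "hs ! i \<in> carrier H" using power_lists_nth[OF hs] i by simp
    have kl: "take i hs @ drop (Suc i) hs \<in> power_lists H (Suc n)" by (rule delete_list_closed[OF hs i])
    have eq: "take i (map2 (lact C) hs cs) @ drop (Suc i) (map2 (lact C) hs cs) =
        map2 (lact C) (take i hs @ drop (Suc i) hs) ?cs"
      using power_lists_length[OF hs] power_lists_length[OF cs] i
      by (simp add: take_map drop_map take_zip drop_zip)
    have "pure_power C (map2 (lact C) (take i hs @ drop (Suc i) hs) ?cs) \<in> carrier (P n)"
      by (rule pure_power_closed[OF C.vs_C map2_lact_closed[OF kl cs']])
    then show "counit_at n i (pure_power C (map2 (lact C) hs cs)) = counit H (hs ! i) \<odot>\<^bsub>P n\<^esub> F (take i hs @ drop (Suc i) hs)"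
      unfolding counit_at_pure[OF i map2_lact_closed[OF hs cs]] eq F_def
      using i csi hsi power_lists_length[OF hs] power_lists_length[OF cs]
      by (simp add: mc.counit_lact vs_smult_smult[OF Z])
    show "counit H (hs ! i) \<odot>\<^bsub>P n\<^esub> F (take i hs @ drop (Suc i) hs) \<in> carrier (P n)"
      by (rule vs_smult_closed[OF Z mlin_closed[OF F kl]])
  qed
  also have "\<dots> = lift (P n) (iter_comult H n h) F"
    by (rule lift_iter_counit[OF Z F h i mlin_delete[OF Z H.vs_C F i H.counit_linear]])
  also have "\<dots> = ?c \<odot>\<^bsub>P n\<^esub> lift (P n) (iter_comult H n h) (\<lambda>hs. pure_power C (map2 (lact C) hs ?cs))"
    unfolding F_def
    by (rule lift_power_push[OF H.vs_C linear_map_scale[OF Z linear_map_id] Z Z, symmetric])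
      (assumption | rule closed_rules h cs i)+
  also have "\<dots> = diag_act H C n h (counit_at n i (pure_power C cs))"
    unfolding counit_at_pure[OF i cs] linear_map_smult[OF linear_map_diag_act[OF h] pure_power_closed[OF C.vs_C cs']]
      diag_act_pure[OF h cs'] ..
  finally show "counit_at n i (diag_act H C (Suc n) h (pure_power C cs)) =
      diag_act H C n h (counit_at n i (pure_power C cs))" .
qed

text \<open>
  The part of the cyclic operator that lives on the tensor power: it sends \<open>m \<otimes> d\<close> to the sum of
  \<open>m\<^sub>\<langle>\<^sub>0\<^sub>\<rangle> \<otimes> rotate m\<^sub>\<langle>\<^sub>-\<^sub>1\<^sub>\<rangle> d\<close>.  The commutation rules between the cyclic operator and the other operators are
  thereby reduced to identities that involve \<open>C\<close> and a single element of \<open>H\<close>.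
\<close>

definition rotate :: "nat \<Rightarrow> 'h \<Rightarrow> ('c list \<Rightarrow> complex) set \<Rightarrow> ('c list \<Rightarrow> complex) set" where
  "rotate n k d = lift (P n) d (\<lambda>cs. pure_power C (tl cs @ [lact C k (hd cs)]))"

lemma mlin_rotate:
  assumes k: "k \<in> carrier H"
  shows "mlin C (Suc n) (P n) (\<lambda>cs. pure_power C (tl cs @ [lact C k (hd cs)]))"
proof (rule mlinI)
  fix cs assume "cs \<in> power_lists C (Suc n)"
  then show "pure_power C (tl cs @ [lact C k (hd cs)]) \<in> carrier (P n)"
    by (rule power_lists_SucE) (use k in \<open>auto intro!: pure_power_closed C.vs_C simp: power_lists_def lact_closed\<close>)
next
  fix xs ys assume xy: "set xs \<subseteq> carrier C" "set ys \<subseteq> carrier C" "Suc n = Suc (length xs + length ys)"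
  note ml = mlin_pure_power[OF C.vs_C, of "Suc n"]
  show "linear_map C (P n) (\<lambda>v. pure_power C (tl (xs @ v # ys) @ [lact C k (hd (xs @ v # ys))]))"
  proof (cases xs)
    case Nil
    then have "ys \<in> power_lists C n" using xy by (simp add: power_lists_def)
    from linear_map_compose[OF linear_map_mlin_last[OF ml this] lact_linear_right[OF k]] show ?thesis
      using Nil by simp
  next
    case (Cons x zs)
    have "slot C C (Suc n) (\<lambda>v. zs @ v # (ys @ [lact C k x]))"
      using xy Cons k by (intro slot_middle) (auto simp: lact_closed)
    from mlin_slot[OF ml this] show ?thesis using Cons by simp
  qed
qed

lemma rotate_linear: "k \<in> carrier H \<Longrightarrow> linear_map (P n) (P n) (rotate n k)"
  unfolding rotate_def by (rule linear_map_lift_power[OF C.vs_C vs_P mlin_rotate])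

lemma rotate_closed [closed_rules]: "k \<in> carrier H \<Longrightarrow> d \<in> carrier (P n) \<Longrightarrow> rotate n k d \<in> carrier (P n)"
  by (rule linear_map_closed[OF rotate_linear])

lemma linear_map_rotate_right [linear_rules]:
  "linear_map U (P n) g \<Longrightarrow> k \<in> carrier H \<Longrightarrow> linear_map U (P n) (\<lambda>u. rotate n k (g u))"
  by (rule linear_map_compose[OF rotate_linear])

lemma linear_map_rotate_left [linear_rules]:
  assumes "linear_map U H g" "d \<in> carrier (P n)"
  shows "linear_map U (P n) (\<lambda>u. rotate n (g u) d)"
proof -
  have "linear_map H (P n) (\<lambda>k. pure_power C (tl cs @ [lact C k (hd cs)]))" if "cs \<in> power_lists C (Suc n)" for cs
    using that
    by (rule power_lists_SucE) (use linear_map_compose[OF linear_map_mlin_last[OF mlin_pure_power[OF C.vs_C]] lact_linear_left] in simp)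
  then have "linear_map H (P n) (\<lambda>k. rotate n k d)"
    unfolding rotate_def by (rule lift_power_family[OF C.vs_C assms(2) H.vs_C vs_P])
  from linear_map_compose[OF this assms(1)] show ?thesis .
qed

lemma rotate_pure:
  assumes "k \<in> carrier H" "c \<in> carrier C" "ds \<in> power_lists C n"
  shows "rotate n k (pure_power C (c # ds)) = pure_power C (ds @ [lact C k c])"
  unfolding rotate_def
  by (subst lift_pure_power[OF C.vs_C vs_P mlin_rotate]) (simp_all add: assms)

lemma rotate_lift_comult:
  assumes "k \<in> carrier H" "c \<in> carrier C" "\<And>a b. a \<in> carrier C \<Longrightarrow> b \<in> carrier C \<Longrightarrow> f a b \<in> carrier (P n)"
  shows "rotate n k (lift (P n) (comult C c) (case_prod f)) = lift (P n) (comult C c) (\<lambda>(a, b). rotate n k (f a b))"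
  by (rule lift_tensor_push[OF C.vs_C C.vs_C rotate_linear[OF assms(1)] vs_P
        vs_P C.comult_closed[OF assms(2)] assms(3)])

lemma rotate_ext:
  assumes "vspace Z" "linear_map (P n) Z f" "linear_map (P n) Z g"
    "\<And>c ds. c \<in> carrier C \<Longrightarrow> ds \<in> power_lists C n \<Longrightarrow> f (pure_power C (c # ds)) = g (pure_power C (c # ds))"
    "d \<in> carrier (P n)"
  shows "f d = g d"
proof (rule power_ext[OF C.vs_C assms(1-3) _ assms(5)])
  fix cs assume "cs \<in> power_lists C (Suc n)"
  then show "f (pure_power C cs) = g (pure_power C cs)" by (rule power_lists_SucE) (simp add: assms(4))
qed

lemma comult_at_rotate:
  assumes j: "j < n" and k: "k \<in> carrier H" and d: "d \<in> carrier (P n)"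
  shows "comult_at n j (rotate n k d) = rotate (Suc n) k (comult_at n (Suc j) d)"
proof (rule rotate_ext[OF vs_P _ _ _ d])
  have j': "j \<le> n" "Suc j \<le> n" using j by simp_all
  show "linear_map (P n) (P (Suc n)) (\<lambda>d. comult_at n j (rotate n k d))"
    by (rule linear_map_compose[OF comult_at_linear[OF j'(1)] rotate_linear[OF k]])
  show "linear_map (P n) (P (Suc n)) (\<lambda>d. rotate (Suc n) k (comult_at n (Suc j) d))"
    by (rule linear_map_compose[OF rotate_linear[OF k] comult_at_linear[OF j'(2)]])
  fix c ds assume c: "c \<in> carrier C" and ds: "ds \<in> power_lists C n"
  have len: "length ds = n" by (rule power_lists_length[OF ds])
  have dsj: "ds ! j \<in> carrier C" by (rule power_lists_nth[OF ds j])
  have sp: "take j ds @ [a, b] @ drop (Suc j) ds \<in> power_lists C (Suc n)" if "a \<in> carrier C" "b \<in> carrier C" for a b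
    using that ds j by (auto simp: power_lists_def dest: in_set_takeD in_set_dropD)
  have last: "ds @ [lact C k c] \<in> power_lists C (Suc n)" using ds k c by (simp add: power_lists_def lact_closed)
  let ?t = "\<lambda>a b. take j ds @ [a, b] @ drop (Suc j) ds @ [lact C k c]"
  have "rotate (Suc n) k (comult_at n (Suc j) (pure_power C (c # ds))) =
      rotate (Suc n) k (lift (P (Suc n)) (comult C (ds ! j)) (\<lambda>(a, b). pure_power C (c # take j ds @ [a, b] @ drop (Suc j) ds)))"
    using comult_at_pure[OF j'(2), of "c # ds"] c ds by simp
  also have "\<dots> = lift (P (Suc n)) (comult C (ds ! j))
      (\<lambda>(a, b). rotate (Suc n) k (pure_power C (c # take j ds @ [a, b] @ drop (Suc j) ds)))"
    by (rule rotate_lift_comult[OF k dsj]) (assumption | rule closed_rules sp c)+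
  also have "\<dots> = lift (P (Suc n)) (comult C (ds ! j)) (\<lambda>(a, b). pure_power C (?t a b))"
    apply (rule C.comult_cong[OF dsj vs_P])
    subgoal for a b using rotate_pure[OF k c sp[of a b]] by simp
    subgoal for a b using sp[of a b] k c by (intro pure_power_closed C.vs_C) (auto simp: power_lists_def lact_closed)
    done
  also have "\<dots> = comult_at n j (rotate n k (pure_power C (c # ds)))"
    using comult_at_pure[OF j'(1) last] rotate_pure[OF k c ds] len j by (simp add: nth_append)
  finally show "comult_at n j (rotate n k (pure_power C (c # ds))) = rotate (Suc n) k (comult_at n (Suc j) (pure_power C (c # ds)))" ..
qed

text \<open>
  The factor \<open>k c\<close> that a rotation puts at the end has coproduct \<open>k\<^sup>(\<^sup>1\<^sup>) c\<^sup>(\<^sup>1\<^sup>) \<otimes> k\<^sup>(\<^sup>2\<^sup>) c\<^sup>(\<^sup>2\<^sup>)\<close>, so it is also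
  obtained by splitting \<open>c\<close> first and rotating both halves.
\<close>

lemma comult_at_rotate_last:
  assumes k: "k \<in> carrier H" and d: "d \<in> carrier (P n)"
  shows "comult_at n n (rotate n k d) =
    lift (P (Suc n)) (comult H k) (\<lambda>(k1, k2). rotate (Suc n) k2 (rotate (Suc n) k1 (comult_at n 0 d)))"
proof (rule rotate_ext[OF vs_P _ _ _ d])
  note Z = vs_P[of "Suc n"]
  show "linear_map (P n) (P (Suc n)) (\<lambda>d. comult_at n n (rotate n k d))"
    by (rule linear_map_compose[OF comult_at_linear[OF order_refl] rotate_linear[OF k]])
  show "linear_map (P n) (P (Suc n)) (\<lambda>d. lift (P (Suc n)) (comult H k)
      (\<lambda>(k1, k2). rotate (Suc n) k2 (rotate (Suc n) k1 (comult_at n 0 d))))"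
    by (assumption | rule linear_rules closed_rules k comult_at_linear le0)+
  fix c ds assume c: "c \<in> carrier C" and ds: "ds \<in> power_lists C n"
  have nth: "(ds @ [v]) ! n = v" for v using power_lists_length[OF ds] by (simp add: nth_append)
  have last: "ds @ [v] \<in> power_lists C (Suc n)" if "v \<in> carrier C" for v
    using ds that by (simp add: power_lists_def)
  have last2: "ds @ [u, v] \<in> power_lists C (Suc (Suc n))" if "u \<in> carrier C" "v \<in> carrier C" for u v
    using ds that by (simp add: power_lists_def)
  have bil: "bilin C C (P (Suc n)) (\<lambda>u v. pure_power C (ds @ [u, v]))"
  proof (rule bilinI)
    fix v assume v: "v \<in> carrier C"
    show "linear_map C (P (Suc n)) (\<lambda>u. pure_power C (ds @ [u, v]))"
      using mlin_slot[OF mlin_pure_power[OF C.vs_C] slot_middle[of ds C "[v]"]] v ds by (simp add: power_lists_def)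
    show "linear_map C (P (Suc n)) (\<lambda>u. pure_power C (ds @ [v, u]))"
      using mlin_slot[OF mlin_pure_power[OF C.vs_C] slot_middle[of "ds @ [v]" C "[]"]] v ds by (simp add: power_lists_def)
  qed
  have rot: "rotate (Suc n) k2 (rotate (Suc n) k1 (pure_power C (c1 # c2 # ds))) = pure_power C (ds @ [lact C k1 c1, lact C k2 c2])"
    if "k1 \<in> carrier H" "k2 \<in> carrier H" "c1 \<in> carrier C" "c2 \<in> carrier C" for k1 k2 c1 c2
    using that ds rotate_pure[of k1 c1 "c2 # ds" "Suc n"] rotate_pure[of k2 c2 "ds @ [lact C k1 c1]" "Suc n"] last
    by (simp add: lact_closed)
  note rules = closed_rules k c ds last2
  have "comult_at n n (rotate n k (pure_power C (c # ds))) =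
      lift (P (Suc n)) (comult C (lact C k c)) (\<lambda>(a, b). pure_power C (ds @ [a, b]))"
    using comult_at_pure[OF order_refl last[OF lact_closed[OF k c]]] rotate_pure[OF k c ds] nth power_lists_length[OF ds]
    by simp
  also have "\<dots> = lift (P (Suc n)) (comult H k) (\<lambda>(k1, k2). lift (P (Suc n)) (comult C c)
      (\<lambda>(c1, c2). pure_power C (ds @ [lact C k1 c1, lact C k2 c2])))"
    by (rule lift_comult_lact[OF Z bil k c])
  also have "\<dots> = lift (P (Suc n)) (comult H k) (\<lambda>(k1, k2). rotate (Suc n) k2 (rotate (Suc n) k1
      (lift (P (Suc n)) (comult C c) (\<lambda>(c1, c2). pure_power C (c1 # c2 # ds)))))"
  proof (rule H.comult_cong[OF k Z])
    fix k1 k2 assume kk: "k1 \<in> carrier H" "k2 \<in> carrier H"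
    have "rotate (Suc n) k2 (rotate (Suc n) k1 (lift (P (Suc n)) (comult C c) (\<lambda>(c1, c2). pure_power C (c1 # c2 # ds)))) =
        lift (P (Suc n)) (comult C c) (\<lambda>(c1, c2). rotate (Suc n) k2 (rotate (Suc n) k1 (pure_power C (c1 # c2 # ds))))"
      by (rule lift_tensor_push[OF C.vs_C C.vs_C linear_map_compose[OF rotate_linear[OF kk(2)] rotate_linear[OF kk(1)]] Z Z])
        (assumption | rule rules)+
    also have "\<dots> = lift (P (Suc n)) (comult C c) (\<lambda>(c1, c2). pure_power C (ds @ [lact C k1 c1, lact C k2 c2]))"
      by (rule C.comult_cong[OF c Z]) (assumption | rule rot rules kk)+
    finally show "lift (P (Suc n)) (comult C c) (\<lambda>(c1, c2). pure_power C (ds @ [lact C k1 c1, lact C k2 c2])) =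
        rotate (Suc n) k2 (rotate (Suc n) k1 (lift (P (Suc n)) (comult C c) (\<lambda>(c1, c2). pure_power C (c1 # c2 # ds))))" ..
  qed (assumption | rule rules)+
  also have "\<dots> = lift (P (Suc n)) (comult H k)
      (\<lambda>(k1, k2). rotate (Suc n) k2 (rotate (Suc n) k1 (comult_at n 0 (pure_power C (c # ds)))))"
    using comult_at_pure[of 0 n "c # ds"] c ds by simp
  finally show "comult_at n n (rotate n k (pure_power C (c # ds))) = lift (P (Suc n)) (comult H k)
      (\<lambda>(k1, k2). rotate (Suc n) k2 (rotate (Suc n) k1 (comult_at n 0 (pure_power C (c # ds)))))" .
qed

lemma counit_at_rotate:
  assumes e: "e \<le> n" and k: "k \<in> carrier H" and d: "d \<in> carrier (P (Suc n))"
  shows "counit_at n e (rotate (Suc n) k d) = rotate n k (counit_at n (Suc e) d)"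
proof (rule rotate_ext[OF vs_P _ _ _ d])
  have e': "e \<le> Suc n" "Suc e \<le> Suc n" using e by simp_all
  show "linear_map (P (Suc n)) (P n) (\<lambda>d. counit_at n e (rotate (Suc n) k d))"
    by (rule linear_map_compose[OF counit_at_linear[OF e'(1)] rotate_linear[OF k]])
  show "linear_map (P (Suc n)) (P n) (\<lambda>d. rotate n k (counit_at n (Suc e) d))"
    by (rule linear_map_compose[OF rotate_linear[OF k] counit_at_linear[OF e'(2)]])
  fix c ds assume c: "c \<in> carrier C" and ds: "ds \<in> power_lists C (Suc n)"
  have kl: "take e ds @ drop (Suc e) ds \<in> power_lists C n" by (rule delete_list_closed[OF ds e])
  have "ds @ [lact C k c] \<in> power_lists C (Suc (Suc n))" "pure_power C (c # take e ds @ drop (Suc e) ds) \<in> carrier (P n)"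
    using ds k c kl by (auto simp: power_lists_def lact_closed intro!: pure_power_closed[OF C.vs_C])
  then show "counit_at n e (rotate (Suc n) k (pure_power C (c # ds))) = rotate n k (counit_at n (Suc e) (pure_power C (c # ds)))"
    using counit_at_pure[OF e'(1), of "ds @ [lact C k c]"] counit_at_pure[OF e'(2), of "c # ds"]
      rotate_pure[OF k c ds] rotate_pure[OF k c kl] power_lists_length[OF ds] e c ds
    by (simp add: nth_append linear_map_smult[OF rotate_linear[OF k]])
qed

lemma counit_at_rotate_last:
  assumes k: "k \<in> carrier H" and d: "d \<in> carrier (P (Suc n))"
  shows "counit_at n (Suc n) (rotate (Suc n) k d) = counit H k \<odot>\<^bsub>P n\<^esub> counit_at n 0 d"
proof (rule rotate_ext[OF vs_P _ _ _ d])
  note Z = vs_P[of n]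
  show "linear_map (P (Suc n)) (P n) (\<lambda>d. counit_at n (Suc n) (rotate (Suc n) k d))"
    by (rule linear_map_compose[OF counit_at_linear[OF order_refl] rotate_linear[OF k]])
  show "linear_map (P (Suc n)) (P n) (\<lambda>d. counit H k \<odot>\<^bsub>P n\<^esub> counit_at n 0 d)"
    by (rule linear_map_scale[OF Z counit_at_linear[OF le0]])
  fix c ds assume c: "c \<in> carrier C" and ds: "ds \<in> power_lists C (Suc n)"
  have "(ds @ [v]) ! Suc n = v" for v using power_lists_length[OF ds] by (simp add: nth_append)
  moreover have "ds @ [lact C k c] \<in> power_lists C (Suc (Suc n))" "pure_power C ds \<in> carrier (P n)"
    using ds k c by (auto simp: power_lists_def lact_closed intro!: pure_power_closed[OF C.vs_C])
  ultimately show "counit_at n (Suc n) (rotate (Suc n) k (pure_power C (c # ds))) =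
      counit H k \<odot>\<^bsub>P n\<^esub> counit_at n 0 (pure_power C (c # ds))"
    using counit_at_pure[OF order_refl, of "ds @ [lact C k c]"] counit_at_pure[of 0 n "c # ds"]
      rotate_pure[OF k c ds] power_lists_length[OF ds] c ds k
    by (simp add: mc.counit_lact vs_smult_smult[OF Z])
qed

end

section \<open>Cochains\<close>

locale sayd = hopf_module_coalgebra H C + sm: SAYD_module H C M
  for H :: "('h, 'x) hopf_algebra_scheme" and C :: "('h, 'c, 'y) module_coalgebra_scheme"
    and M :: "('h, 'm, 'z) module_comodule_scheme"

sublocale sayd \<subseteq> com: left_comodule H M
  by (rule sm.comodule)

context sayd
begin

abbreviation X where "X n \<equiv> cochains C M n"
abbreviation tens where "tens n \<equiv> pure_tensor M (P n)"
abbreviation L where "L n \<equiv> L_op H C M n"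
abbreviation tau where "tau n \<equiv> cochain_cyclic C M n"

lemmas vs_M [simp, closed_rules] = com.vector_space

lemma vs_X [simp, closed_rules]: "vspace (X n)"
  unfolding cochains_def by (rule vs_tensor[OF vs_M vs_P])

lemma pure_cochain_eq: "cs \<in> power_lists C (Suc n) \<Longrightarrow> pure_cochain C M m cs = tens n m (pure_power C cs)"
  by (simp add: pure_cochain_def power_lists_length)

lemma coact_closed [closed_rules]: "m \<in> carrier M \<Longrightarrow> coact M m \<in> carrier (tensor H M)"
  by (rule linear_map_closed[OF com.coact_linear])

lemmas coact_cong = lift_tensor_cong[OF H.vs_C vs_M coact_closed]

lemma linear_map_coact [linear_rules]:
  "linear_map U M g \<Longrightarrow> linear_map U (tensor H M) (\<lambda>u. coact M (g u))"
  by (rule linear_map_compose[OF com.coact_linear])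

lemma ract_linear_left: "h \<in> carrier H \<Longrightarrow> linear_map M M (\<lambda>m. ract M m h)"
  and ract_linear_right: "m \<in> carrier M \<Longrightarrow> linear_map H M (ract M m)"
  and ract_mult: "h \<in> carrier H \<Longrightarrow> k \<in> carrier H \<Longrightarrow> m \<in> carrier M \<Longrightarrow>
    ract M m (h \<cdot> k) = ract M (ract M m h) k"
  and ract_one: "m \<in> carrier M \<Longrightarrow> ract M m \<one>\<^bsub>H\<^esub> = m"
  using sm.action by (simp_all add: right_action_def)

lemma ract_closed [closed_rules]: "m \<in> carrier M \<Longrightarrow> h \<in> carrier H \<Longrightarrow> ract M m h \<in> carrier M"
  by (rule linear_map_closed[OF ract_linear_right])

lemma linear_map_ract_left [linear_rules]:
  "linear_map U M g \<Longrightarrow> h \<in> carrier H \<Longrightarrow> linear_map U M (\<lambda>u. ract M (g u) h)"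
  by (rule linear_map_compose[OF ract_linear_left])

lemma linear_map_ract_right [linear_rules]:
  "linear_map U H g \<Longrightarrow> m \<in> carrier M \<Longrightarrow> linear_map U M (\<lambda>u. ract M m (g u))"
  by (rule linear_map_compose[OF ract_linear_right])

lemma tens_closed [closed_rules]:
  "m \<in> carrier M \<Longrightarrow> d \<in> carrier (P n) \<Longrightarrow> tens n m d \<in> carrier (X n)"
  unfolding cochains_def by (rule pure_tensor_closed[OF vs_M vs_P])

lemma linear_map_tens_left [linear_rules]:
  "linear_map U M g \<Longrightarrow> d \<in> carrier (P n) \<Longrightarrow> linear_map U (X n) (\<lambda>u. tens n (g u) d)"
  unfolding cochains_def by (rule linear_map_pure_tensor_left[OF _ _ vs_M vs_P])

lemma linear_map_tens_right [linear_rules]: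
  "linear_map U (P n) g \<Longrightarrow> m \<in> carrier M \<Longrightarrow> linear_map U (X n) (\<lambda>u. tens n m (g u))"
  unfolding cochains_def by (rule linear_map_pure_tensor_right[OF _ _ vs_M vs_P])

lemma X_tens_ext:
  assumes "vspace Z" "linear_map (X n) Z f" "linear_map (X n) Z g"
    "\<And>m d. m \<in> carrier M \<Longrightarrow> d \<in> carrier (P n) \<Longrightarrow> f (tens n m d) = g (tens n m d)"
    "x \<in> carrier (X n)"
  shows "f x = g x"
  using assms unfolding cochains_def by (rule tensor_ext[OF vs_M vs_P])


lemma bilin_lift_linear: "bilin M (P n) (X n') f \<Longrightarrow> linear_map (X n) (X n') (\<lambda>x. lift (X n') x (case_prod f))"
  unfolding cochains_def by (rule linear_map_lift_tensor[OF vs_M vs_P vs_X[unfolded cochains_def]])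

lemma bilin_lift_tens:
  "bilin M (P n) (X n') f \<Longrightarrow> m \<in> carrier M \<Longrightarrow> d \<in> carrier (P n) \<Longrightarrow>
    lift (X n') (tens n m d) (case_prod f) = f m d"
  by (rule lift_pure_tensor[OF vs_M vs_P vs_X])

text \<open>
  Identifies an operator defined by a formula on pure cochains with a known linear map \<open>g\<close>.  The
  multilinearity on which the meaning of \<^const>\<open>cochain_lift\<close> depends is inherited from \<open>g\<close>: replacing
  \<open>F\<close> by \<open>g\<close> reduces both liftings to the identity.
\<close>

lemma cochain_lift_eqI:
  assumes g: "linear_map (X n) (X n') g"
    and F: "\<And>m cs. m \<in> carrier M \<Longrightarrow> cs \<in> power_lists C (Suc n) \<Longrightarrow> F m cs = g (tens n m (pure_power C cs))"
    and x: "x \<in> carrier (X n)"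
  shows "cochain_lift (X n') x F = g x"
proof -
  note xt = x[unfolded cochains_def]
  have gt: "g (tens n m d) \<in> carrier (X n')" if "m \<in> carrier M" "d \<in> carrier (P n)" for m d
    by (rule linear_map_closed[OF g tens_closed[OF that]])
  have "lift (X n') d (F m) = g (tens n m d)" if m: "m \<in> carrier M" and d: "d \<in> carrier (P n)" for m d
  proof -
    have t: "linear_map (P n) (X n') (\<lambda>d. g (tens n m d))"
      by (rule linear_map_compose[OF g linear_map_tens_right[OF linear_map_id m]])
    have "lift (X n') d (F m) = lift (X n') d (\<lambda>cs. g (tens n m (pure_power C cs)))"
      by (rule lift_power_cong[OF C.vs_C d vs_X F[OF m] gt[OF m pure_power_closed[OF C.vs_C]]])
    also have "\<dots> = g (tens n m (lift (P n) d (pure_power C)))"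
      by (rule lift_power_push[OF C.vs_C t vs_P vs_X d pure_power_closed[OF C.vs_C], symmetric])
    finally show ?thesis by (simp add: power_eta[OF C.vs_C d])
  qed
  then have "cochain_lift (X n') x F = lift (X n') x (\<lambda>(m, d). g (tens n m d))"
    unfolding cochain_lift_def by (intro lift_tensor_cong[OF vs_M vs_P xt vs_X] gt)
  also have "\<dots> = g (lift (X n) x (\<lambda>(m, d). tens n m d))"
    by (rule lift_tensor_push[OF vs_M vs_P g vs_X vs_X xt tens_closed, symmetric])
  also have "lift (X n) x (\<lambda>(m, d). tens n m d) = x"
    using tensor_eta[OF vs_M vs_P xt] by (simp add: cochains_def)
  finally show ?thesis .
qed

lemma linear_map_lift_coact:
  assumes "linear_map (X n) (X n') g" "m \<in> carrier M"
    "\<And>k m0. k \<in> carrier H \<Longrightarrow> m0 \<in> carrier M \<Longrightarrow> f k m0 \<in> carrier (X n)"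
  shows "g (lift (X n) (coact M m) (case_prod f)) = lift (X n') (coact M m) (\<lambda>(k, m0). g (f k m0))"
  by (rule lift_tensor_push[OF H.vs_C vs_M assms(1) vs_X vs_X coact_closed[OF assms(2)] assms(3)])

section \<open>Operators on the coalgebra factor\<close>

text \<open>
  The operator \<open>id \<otimes> f\<close> on cochains.
\<close>

definition tmap where "tmap n' f x = lift (X n') x (\<lambda>(m, d). tens n' m (f d))"

context
  fixes n n' f assumes f: "linear_map (P n) (P n') f"
begin

lemma bilin_tmap: "bilin M (P n) (X n') (\<lambda>m d. tens n' m (f d))"
  by (assumption | rule linear_rules f linear_map_closed[OF f])+

lemma tmap_linear: "linear_map (X n) (X n') (tmap n' f)"
  unfolding tmap_def by (rule bilin_lift_linear[OF bilin_tmap])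

lemma tmap_closed: "x \<in> carrier (X n) \<Longrightarrow> tmap n' f x \<in> carrier (X n')"
  by (rule linear_map_closed[OF tmap_linear])

lemma tmap_tens: "m \<in> carrier M \<Longrightarrow> d \<in> carrier (P n) \<Longrightarrow> tmap n' f (tens n m d) = tens n' m (f d)"
  unfolding tmap_def by (rule bilin_lift_tens[OF bilin_tmap])

end

lemma coface_eq:
  assumes i: "i \<le> n" and x: "x \<in> carrier (X n)"
  shows "cochain_coface C M n i x = tmap (Suc n) (comult_at n i) x"
proof -
  note lin = comult_at_linear[OF i]
  have "cochain_lift (X (Suc n)) x (\<lambda>m cs. lift (X (Suc n)) (comult C (cs ! i)) (\<lambda>(a, b).
      pure_cochain C M m (take i cs @ [a, b] @ drop (Suc i) cs))) = tmap (Suc n) (comult_at n i) x"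
  proof (rule cochain_lift_eqI[OF tmap_linear[OF lin] _ x])
    fix m cs assume m: "m \<in> carrier M" and cs: "cs \<in> power_lists C (Suc n)"
    have csi: "cs ! i \<in> carrier C" using power_lists_nth[OF cs] i by simp
    note rules = split_list_closed closed_rules m csi i cs
    have t: "linear_map (P (Suc n)) (X (Suc n)) (tens (Suc n) m)" by (assumption | rule linear_rules m)+
    have "tmap (Suc n) (comult_at n i) (tens n m (pure_power C cs)) = lift (X (Suc n)) (comult C (cs ! i))
        (\<lambda>(a, b). tens (Suc n) m (pure_power C (take i cs @ [a, b] @ drop (Suc i) cs)))"
      unfolding tmap_tens[OF lin m pure_power_closed[OF C.vs_C cs]] comult_at_pure[OF i cs]
      by (rule lift_tensor_push[OF C.vs_C C.vs_C t vs_P vs_X]) (assumption | rule rules)+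
    also have "\<dots> = lift (X (Suc n)) (comult C (cs ! i))
        (\<lambda>(a, b). pure_cochain C M m (take i cs @ [a, b] @ drop (Suc i) cs))"
      by (rule C.comult_cong[OF csi vs_X])
        (simp_all only: pure_cochain_eq[OF split_list_closed[OF cs i]] tens_closed[OF m]
          pure_power_closed[OF C.vs_C split_list_closed[OF cs i]])
    finally show "lift (X (Suc n)) (comult C (cs ! i)) (\<lambda>(a, b).
        pure_cochain C M m (take i cs @ [a, b] @ drop (Suc i) cs)) = tmap (Suc n) (comult_at n i) (tens n m (pure_power C cs))" ..
  qed
  then show ?thesis using i by (simp add: cochain_coface_def)
qed

lemma codegeneracy_eq:
  assumes i: "i < Suc n" and x: "x \<in> carrier (X (Suc n))"
  shows "cochain_codegeneracy C M (Suc n) i x = tmap n (counit_at n (Suc i)) x"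
  unfolding cochain_codegeneracy_def diff_Suc_1
proof (rule cochain_lift_eqI[OF tmap_linear _ x])
  have i': "Suc i \<le> Suc n" using i by simp
  show lin: "linear_map (P (Suc n)) (P n) (counit_at n (Suc i))" by (rule counit_at_linear[OF i'])
  fix m cs assume m: "m \<in> carrier M" and cs: "cs \<in> power_lists C (Suc (Suc n))"
  note dl = delete_list_closed[OF cs i']
  have t: "linear_map (P n) (X n) (tens n m)" by (assumption | rule linear_rules m)+
  show "counit C (cs ! Suc i) \<odot>\<^bsub>X n\<^esub> pure_cochain C M m (take (Suc i) cs @ drop (Suc (Suc i)) cs) =
      tmap n (counit_at n (Suc i)) (tens (Suc n) m (pure_power C cs))"
    unfolding pure_cochain_eq[OF dl] tmap_tens[OF lin m pure_power_closed[OF C.vs_C cs]] counit_at_pure[OF i' cs]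
    by (rule linear_map_smult[OF t pure_power_closed[OF C.vs_C dl], symmetric])
qed

section \<open>The cyclic operator\<close>

lemma bilin_tau: "bilin M (P n) (X n) (\<lambda>m d. lift (X n) (coact M m) (\<lambda>(k, m0). tens n m0 (rotate n k d)))"
  by (assumption | rule linear_rules closed_rules)+

lemma tau_eq:
  assumes x: "x \<in> carrier (X n)"
  shows "tau n x = lift (X n) x (\<lambda>(m, d). lift (X n) (coact M m) (\<lambda>(k, m0). tens n m0 (rotate n k d)))"
  unfolding cochain_cyclic_def
proof (rule cochain_lift_eqI[OF bilin_lift_linear[OF bilin_tau] _ x])
  fix m cs assume m: "m \<in> carrier M" and cs: "cs \<in> power_lists C (Suc n)"
  then obtain c ds where cs': "cs = c # ds" "c \<in> carrier C" "ds \<in> power_lists C n" by (elim power_lists_SucE)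
  have last: "ds @ [lact C k c] \<in> power_lists C (Suc n)" if "k \<in> carrier H" for k
    using cs' that by (simp add: power_lists_def lact_closed)
  show "lift (X n) (coact M m) (\<lambda>(k, m0). pure_cochain C M m0 (tl cs @ [lact C k (hd cs)])) =
      lift (X n) (tens n m (pure_power C cs)) (\<lambda>(m, d). lift (X n) (coact M m) (\<lambda>(k, m0). tens n m0 (rotate n k d)))"
    unfolding bilin_lift_tens[OF bilin_tau m pure_power_closed[OF C.vs_C cs]]
    unfolding cs' list.sel
    by (rule coact_cong[OF m vs_X])
      (simp_all add: pure_cochain_eq[OF last] rotate_pure cs' tens_closed pure_power_closed[OF C.vs_C last])
qed

lemma tau_linear: "linear_map (X n) (X n) (tau n)"
  by (rule linear_map_cong[OF bilin_lift_linear[OF bilin_tau] vs_X tau_eq])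

lemma tau_closed [closed_rules]: "x \<in> carrier (X n) \<Longrightarrow> tau n x \<in> carrier (X n)"
  by (rule linear_map_closed[OF tau_linear])

lemma tau_tens:
  "m \<in> carrier M \<Longrightarrow> d \<in> carrier (P n) \<Longrightarrow>
    tau n (tens n m d) = lift (X n) (coact M m) (\<lambda>(k, m0). tens n m0 (rotate n k d))"
  by (simp add: tau_eq tens_closed bilin_lift_tens[OF bilin_tau])

lemma tau_tau_tens:
  assumes m: "m \<in> carrier M" and d: "d \<in> carrier (P n)"
  shows "tau n (tau n (tens n m d)) = lift (X n) (coact M m) (\<lambda>(k, m0). lift (X n) (coact M m0)
    (\<lambda>(l, m1). tens n m1 (rotate n l (rotate n k d))))"
  unfolding tau_tens[OF m d]
  apply (subst linear_map_lift_coact[OF tau_linear m])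
   apply (assumption | rule closed_rules d)+
  apply (rule coact_cong[OF m vs_X])
   apply (rule tau_tens)
    apply (assumption | rule closed_rules d)+
  done

text \<open>
  All properties of the last coface are deduced from this factorisation.
\<close>

lemma coface_last_eq:
  assumes x: "x \<in> carrier (X n)"
  shows "cochain_coface C M n (Suc n) x = tau (Suc n) (tmap (Suc n) (comult_at n 0) x)"
proof -
  note lin = comult_at_linear[of 0 n, OF le0]
  have "cochain_lift (X (Suc n)) x (\<lambda>m cs. lift (X (Suc n)) (comult C (hd cs)) (\<lambda>(a, b). lift (X (Suc n)) (coact M m)
      (\<lambda>(k, m0). pure_cochain C M m0 (b # tl cs @ [lact C k a])))) = tau (Suc n) (tmap (Suc n) (comult_at n 0) x)"
  proof (rule cochain_lift_eqI[OF linear_map_compose[OF tau_linear tmap_linear[OF lin]] _ x])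
    fix m cs assume m: "m \<in> carrier M" and cs: "cs \<in> power_lists C (Suc n)"
    then obtain c ds where cs': "cs = c # ds" "c \<in> carrier C" "ds \<in> power_lists C n" by (elim power_lists_SucE)
    have l: "b # ds @ [lact C k a] \<in> power_lists C (Suc (Suc n))"
      if "a \<in> carrier C" "b \<in> carrier C" "k \<in> carrier H" for a b k
      using cs' that by (simp add: power_lists_def lact_closed)
    have t: "linear_map (P (Suc n)) (X (Suc n)) (\<lambda>d. tau (Suc n) (tens (Suc n) m d))"
      by (rule linear_map_compose[OF tau_linear linear_map_tens_right[OF linear_map_id m]])
    note rules = closed_rules m cs'
    have "tau (Suc n) (tmap (Suc n) (comult_at n 0) (tens n m (pure_power C cs))) =
        tau (Suc n) (tens (Suc n) m (lift (P (Suc n)) (comult C c) (\<lambda>(a, b). pure_power C (a # b # ds))))"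
      unfolding tmap_tens[OF lin m pure_power_closed[OF C.vs_C cs]] comult_at_pure[OF le0 cs] by (simp add: cs'(1))
    also have "\<dots> = lift (X (Suc n)) (comult C c) (\<lambda>(a, b). tau (Suc n) (tens (Suc n) m (pure_power C (a # b # ds))))"
      by (rule lift_tensor_push[OF C.vs_C C.vs_C t vs_P vs_X]) (assumption | rule rules)+
    also have "\<dots> = lift (X (Suc n)) (comult C c) (\<lambda>(a, b). lift (X (Suc n)) (coact M m)
        (\<lambda>(k, m0). pure_cochain C M m0 (b # ds @ [lact C k a])))"
    proof (rule C.comult_cong[OF cs'(2) vs_X])
      fix a b assume ab: "a \<in> carrier C" "b \<in> carrier C"
      have abd: "pure_power C (a # b # ds) \<in> carrier (P (Suc n))" by (assumption | rule rules ab)+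
      show "tau (Suc n) (tens (Suc n) m (pure_power C (a # b # ds))) =
          lift (X (Suc n)) (coact M m) (\<lambda>(k, m0). pure_cochain C M m0 (b # ds @ [lact C k a]))"
        unfolding tau_tens[OF m abd]
        by (rule coact_cong[OF m vs_X])
          (simp_all add: pure_cochain_eq[OF l[OF ab]] rotate_pure ab cs' tens_closed pure_power_closed[OF C.vs_C l[OF ab]])
      show "lift (X (Suc n)) (coact M m) (\<lambda>(k, m0). pure_cochain C M m0 (b # ds @ [lact C k a])) \<in> carrier (X (Suc n))"
        by (rule lift_tensor_closed[OF H.vs_C vs_M coact_closed[OF m] vs_X])
          (simp add: pure_cochain_eq[OF l[OF ab]] tens_closed pure_power_closed[OF C.vs_C l[OF ab]])
    qed
    finally show "lift (X (Suc n)) (comult C (hd cs)) (\<lambda>(a, b). lift (X (Suc n)) (coact M m)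
        (\<lambda>(k, m0). pure_cochain C M m0 (b # tl cs @ [lact C k a]))) =
      tau (Suc n) (tmap (Suc n) (comult_at n 0) (tens n m (pure_power C cs)))" by (simp add: cs'(1))
  qed
  then show ?thesis by (simp add: cochain_coface_def)
qed

lemma lift_coact_coassoc:
  assumes Z: "vspace Z" and F: "trilin H H M Z F" and m: "m \<in> carrier M"
  shows "lift Z (coact M m) (\<lambda>(k, m0). lift Z (comult H k) (\<lambda>(k1, k2). F k1 k2 m0)) =
    lift Z (coact M m) (\<lambda>(k, m0). lift Z (coact M m0) (\<lambda>(l, m1). F k l m1))"
proof -
  let ?T = "tensor H M"
  have vT: "vspace ?T" by (rule vs_tensor[OF H.vs_C vs_M])
  note vTT = vs_tensor[OF H.vs_C vT]
  have Fb: "bilin H M Z (F h)" if "h \<in> carrier H" for h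
    by (rule bilinI) (use that trilin_linear[OF F] in auto)
  define f where "f h s = lift Z s (case_prod (F h))" for h s
  have f: "bilin H ?T Z f"
    unfolding f_def
    by (rule bilinI, rule lift_tensor_family[OF H.vs_C vs_M _ H.vs_C Z])
      (assumption | rule trilin_linear[OF F] linear_map_lift_tensor[OF H.vs_C vs_M Z Fb])+
  define g where "g t = lift Z t (case_prod f)" for t
  have g: "linear_map (tensor H ?T) Z g"
    unfolding g_def by (rule linear_map_lift_tensor[OF H.vs_C vT Z f])
  have gp: "g (pure_tensor H ?T h s) = f h s" if "h \<in> carrier H" "s \<in> carrier ?T" for h s
    unfolding g_def by (rule lift_pure_tensor[OF H.vs_C vT Z f that])
  have fp: "f h (pure_tensor H M k m) = F h k m" if "h \<in> carrier H" "k \<in> carrier H" "m \<in> carrier M" for h k m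
    unfolding f_def by (rule lift_pure_tensor[OF H.vs_C vs_M Z Fb that(2,3)]) (rule that)
  have Fc: "F h k m \<in> carrier Z" if "h \<in> carrier H" "k \<in> carrier H" "m \<in> carrier M" for h k m
    by (rule trilin_closed[OF F that])
  note pushM = lift_tensor_push[OF H.vs_C vs_M g vTT Z]
  note pushH = lift_tensor_push[OF H.vs_C H.vs_C g vTT Z]
  have 1: "g (lift (tensor H ?T) (coact M m) (\<lambda>(h, m0).
        lift (tensor H ?T) (comult H h) (\<lambda>(h1, h2). pure_tensor H ?T h1 (pure_tensor H M h2 m0)))) =
      lift Z (coact M m) (\<lambda>(k, m0). lift Z (comult H k) (\<lambda>(k1, k2). F k1 k2 m0))"
    apply (subst pushM)
      apply (assumption | rule closed_rules m)+
    apply (rule lift_tensor_cong[OF H.vs_C vs_M _ Z])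
      apply (rule closed_rules m)+
     apply (subst pushH)
       apply (assumption | rule closed_rules)+
     apply (rule lift_tensor_cong[OF H.vs_C H.vs_C _ Z])
       apply (assumption | rule closed_rules)+
      apply (simp add: gp fp pure_tensor_closed[OF H.vs_C vs_M])
     apply (assumption | rule closed_rules Z Fc)+
    done
  have 2: "g (lift (tensor H ?T) (coact M m) (\<lambda>(h, m0). pure_tensor H ?T h (coact M m0))) =
      lift Z (coact M m) (\<lambda>(k, m0). lift Z (coact M m0) (\<lambda>(l, m1). F k l m1))"
    apply (subst pushM)
      apply (assumption | rule closed_rules m)+
    apply (rule lift_tensor_cong[OF H.vs_C vs_M _ Z])
      apply (rule closed_rules m)+
     apply (simp add: gp coact_closed f_def)
    apply (assumption | rule closed_rules Z Fc)+
    done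
  show ?thesis using com.coact_coassoc[OF m] 1 2 by simp
qed

lemma lift_coact_counit:
  assumes Z: "vspace Z" and f: "linear_map M Z f" and m: "m \<in> carrier M"
  shows "lift Z (coact M m) (\<lambda>(k, m0). counit H k \<odot>\<^bsub>Z\<^esub> f m0) = f m"
proof -
  have "f (lift M (coact M m) (\<lambda>(k, m0). counit H k \<odot>\<^bsub>M\<^esub> m0)) =
      lift Z (coact M m) (\<lambda>(k, m0). f (counit H k \<odot>\<^bsub>M\<^esub> m0))"
    by (rule lift_tensor_push[OF H.vs_C vs_M f vs_M Z])
      (assumption | rule closed_rules m)+
  also have "\<dots> = lift Z (coact M m) (\<lambda>(k, m0). counit H k \<odot>\<^bsub>Z\<^esub> f m0)"
    by (rule lift_tensor_cong[OF H.vs_C vs_M _ Z])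
      (assumption | rule closed_rules m Z linear_map_smult[OF f] linear_map_closed[OF f])+
  finally show ?thesis using com.coact_counit[OF m] by simp
qed

text \<open>
  The anti-Yetter-Drinfeld condition below a bilinear expression.
\<close>

lemma lift_AYD:
  assumes Z: "vspace Z" and F: "bilin C M Z F" and m: "m \<in> carrier M" and h: "h \<in> carrier H" and c: "c \<in> carrier C"
  shows "lift Z (coact M (ract M m h)) (\<lambda>(k, m0). F (lact C k c) m0) =
    lift Z (comult H h) (\<lambda>(h', h3). lift Z (comult H h') (\<lambda>(h1, h2). lift Z (coact M m) (\<lambda>(k, m0).
      F (lact C (antipode H h3 \<cdot> k \<cdot> h1) c) (ract M m0 h2))))"
proof -
  have vT: "vspace (tensor C M)" by (rule vs_tensor[OF C.vs_C vs_M])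
  define g where "g t = lift Z t (case_prod F)" for t
  have g: "linear_map (tensor C M) Z g"
    unfolding g_def by (rule linear_map_lift_tensor[OF C.vs_C vs_M Z F])
  have gp: "g (pure_tensor C M c m) = F c m" if "c \<in> carrier C" "m \<in> carrier M" for c m
    unfolding g_def by (rule lift_pure_tensor[OF C.vs_C vs_M Z F that])
  note pushM = lift_tensor_push[OF H.vs_C vs_M g vT Z]
  note pushH = lift_tensor_push[OF H.vs_C H.vs_C g vT Z]
  note congM = lift_tensor_cong[OF H.vs_C vs_M _ Z] and congH = lift_tensor_cong[OF H.vs_C H.vs_C _ Z]
  note rules = closed_rules m h c Z gp bilin_closed[OF F]
  have 1: "g (lift (tensor C M) (coact M (ract M m h)) (\<lambda>(k, m0). pure_tensor C M (lact C k c) m0)) =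
      lift Z (coact M (ract M m h)) (\<lambda>(k, m0). F (lact C k c) m0)"
    apply (subst pushM)
      apply (assumption | rule rules)+
    apply (rule congM)
      apply (assumption | rule rules)+
    done
  have 2: "g (lift (tensor C M) (comult H h) (\<lambda>(h', h3). lift (tensor C M) (comult H h') (\<lambda>(h1, h2).
          lift (tensor C M) (coact M m) (\<lambda>(k, m0).
            pure_tensor C M (lact C (antipode H h3 \<cdot> k \<cdot> h1) c) (ract M m0 h2))))) =
      lift Z (comult H h) (\<lambda>(h', h3). lift Z (comult H h') (\<lambda>(h1, h2). lift Z (coact M m) (\<lambda>(k, m0).
        F (lact C (antipode H h3 \<cdot> k \<cdot> h1) c) (ract M m0 h2))))"
    apply (subst pushH)
      apply (assumption | rule rules)+
    apply (rule congH)
      apply (assumption | rule rules)+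
     apply (subst pushH)
       apply (assumption | rule rules)+
     apply (rule congH)
       apply (assumption | rule rules)+
      apply (subst pushM)
        apply (assumption | rule rules)+
      apply (rule congM)
        apply (assumption | rule rules)+
    done
  show ?thesis using sm.AYD[OF m h c] 1 2 by simp
qed


lemma tmap_tau:
  assumes f: "linear_map (P n) (P n') f" and g: "linear_map (P n) (P n') g"
    and fg: "\<And>k d. k \<in> carrier H \<Longrightarrow> d \<in> carrier (P n) \<Longrightarrow> f (rotate n k d) = rotate n' k (g d)"
    and x: "x \<in> carrier (X n)"
  shows "tmap n' f (tau n x) = tau n' (tmap n' g x)"
proof (rule X_tens_ext[OF vs_X linear_map_compose[OF tmap_linear[OF f] tau_linear]
      linear_map_compose[OF tau_linear tmap_linear[OF g]] _ x])
  fix m d assume m: "m \<in> carrier M" and d: "d \<in> carrier (P n)"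
  note rules = closed_rules m d linear_map_closed[OF g]
  have "tmap n' f (tau n (tens n m d)) = lift (X n') (coact M m) (\<lambda>(k, m0). tmap n' f (tens n m0 (rotate n k d)))"
    unfolding tau_tens[OF m d]
    by (rule linear_map_lift_coact[OF tmap_linear[OF f] m]) (assumption | rule rules)+
  also have "\<dots> = lift (X n') (coact M m) (\<lambda>(k, m0). tens n' m0 (rotate n' k (g d)))"
    by (rule coact_cong[OF m vs_X])
      (simp_all add: tmap_tens[OF f] fg d rotate_closed tens_closed linear_map_closed[OF g])
  finally show "tmap n' f (tau n (tens n m d)) = tau n' (tmap n' g (tens n m d))"
    by (simp add: tmap_tens[OF g] tau_tens m d linear_map_closed[OF g])
qed

lemma coface_tau:
  "j < n \<Longrightarrow> x \<in> carrier (X n) \<Longrightarrow>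
    tmap (Suc n) (comult_at n j) (tau n x) = tau (Suc n) (tmap (Suc n) (comult_at n (Suc j)) x)"
  by (rule tmap_tau) (simp_all add: comult_at_linear comult_at_rotate)

lemma codegen_tau:
  "e \<le> n \<Longrightarrow> x \<in> carrier (X (Suc n)) \<Longrightarrow>
    tmap n (counit_at n e) (tau (Suc n) x) = tau n (tmap n (counit_at n (Suc e)) x)"
  by (rule tmap_tau) (simp_all add: counit_at_linear counit_at_rotate)

text \<open>
  Coassociativity of the coaction converts the two components \<open>k\<^sup>(\<^sup>1\<^sup>), k\<^sup>(\<^sup>2\<^sup>)\<close> in \<open>comult_at_rotate_last\<close> into the
  coefficients of two successive applications of \<open>\<tau>\<close>.
\<close>

lemma coface_tau_last:
  assumes x: "x \<in> carrier (X n)"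
  shows "tmap (Suc n) (comult_at n n) (tau n x) = tau (Suc n) (tau (Suc n) (tmap (Suc n) (comult_at n 0) x))"
proof -
  note lin = comult_at_linear[of n n, OF order_refl] and lin0 = comult_at_linear[of 0 n, OF le0]
  show ?thesis
  proof (rule X_tens_ext[OF vs_X linear_map_compose[OF tmap_linear[OF lin] tau_linear]
        linear_map_compose[OF tau_linear linear_map_compose[OF tau_linear tmap_linear[OF lin0]]] _ x])
    fix m d assume m: "m \<in> carrier M" and d: "d \<in> carrier (P n)"
    define d' where "d' = comult_at n 0 d"
    have d': "d' \<in> carrier (P (Suc n))" unfolding d'_def by (rule linear_map_closed[OF lin0 d])
    note rules = closed_rules m d d'
    let ?t = "\<lambda>k l m0. tens (Suc n) m0 (rotate (Suc n) l (rotate (Suc n) k d'))"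
    have "tmap (Suc n) (comult_at n n) (tau n (tens n m d)) =
        lift (X (Suc n)) (coact M m) (\<lambda>(k, m0). tmap (Suc n) (comult_at n n) (tens n m0 (rotate n k d)))"
      unfolding tau_tens[OF m d]
      by (rule linear_map_lift_coact[OF tmap_linear[OF lin] m]) (assumption | rule rules)+
    also have "\<dots> = lift (X (Suc n)) (coact M m) (\<lambda>(k, m0). lift (X (Suc n)) (comult H k) (\<lambda>(k1, k2). ?t k1 k2 m0))"
    proof (rule coact_cong[OF m vs_X])
      fix k m0 assume k: "k \<in> carrier H" and m0: "m0 \<in> carrier M"
      have t: "linear_map (P (Suc n)) (X (Suc n)) (tens (Suc n) m0)" by (assumption | rule linear_rules m0)+
      show "tmap (Suc n) (comult_at n n) (tens n m0 (rotate n k d)) =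
          lift (X (Suc n)) (comult H k) (\<lambda>(k1, k2). ?t k1 k2 m0)"
        unfolding tmap_tens[OF lin m0 rotate_closed[OF k d]] comult_at_rotate_last[OF k d] d'_def[symmetric]
        by (rule lift_tensor_push[OF H.vs_C H.vs_C t vs_P vs_X]) (assumption | rule rules k)+
    qed (assumption | rule rules)+
    also have "\<dots> = lift (X (Suc n)) (coact M m) (\<lambda>(k, m0). lift (X (Suc n)) (coact M m0) (\<lambda>(l, m1). ?t k l m1))"
      by (rule lift_coact_coassoc[OF vs_X _ m]) (assumption | rule linear_rules rules)+
    also have "\<dots> = tau (Suc n) (tau (Suc n) (tmap (Suc n) (comult_at n 0) (tens n m d)))"
      by (simp add: tmap_tens[OF lin0 m d] tau_tau_tens[OF m d'] d'_def[symmetric])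
    finally show "tmap (Suc n) (comult_at n n) (tau n (tens n m d)) =
        tau (Suc n) (tau (Suc n) (tmap (Suc n) (comult_at n 0) (tens n m d)))" .
  qed
qed

lemma codegen_tau_last:
  assumes x: "x \<in> carrier (X (Suc n))"
  shows "tmap n (counit_at n (Suc n)) (tau (Suc n) x) = tmap n (counit_at n 0) x"
proof -
  note lin = counit_at_linear[of "Suc n" n, OF order_refl] and lin0 = counit_at_linear[of 0 n, OF le0]
  show ?thesis
  proof (rule X_tens_ext[OF vs_X linear_map_compose[OF tmap_linear[OF lin] tau_linear] tmap_linear[OF lin0] _ x])
    fix m d assume m: "m \<in> carrier M" and d: "d \<in> carrier (P (Suc n))"
    define d' where "d' = counit_at n 0 d"
    have d': "d' \<in> carrier (P n)" unfolding d'_def by (rule linear_map_closed[OF lin0 d])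
    have t: "linear_map M (X n) (\<lambda>m. tens n m d')" by (assumption | rule linear_rules d')+
    have "tmap n (counit_at n (Suc n)) (tau (Suc n) (tens (Suc n) m d)) =
        lift (X n) (coact M m) (\<lambda>(k, m0). tmap n (counit_at n (Suc n)) (tens (Suc n) m0 (rotate (Suc n) k d)))"
      unfolding tau_tens[OF m d]
      by (rule linear_map_lift_coact[OF tmap_linear[OF lin] m]) (assumption | rule closed_rules d)+
    also have "\<dots> = lift (X n) (coact M m) (\<lambda>(k, m0). counit H k \<odot>\<^bsub>X n\<^esub> tens n m0 d')"
    proof (rule coact_cong[OF m vs_X])
      fix k m0 assume k: "k \<in> carrier H" and m0: "m0 \<in> carrier M"
      have "linear_map (P n) (X n) (tens n m0)" by (assumption | rule linear_rules m0)+
      from linear_map_smult[OF this d']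
      show "tmap n (counit_at n (Suc n)) (tens (Suc n) m0 (rotate (Suc n) k d)) = counit H k \<odot>\<^bsub>X n\<^esub> tens n m0 d'"
        by (simp add: tmap_tens[OF lin m0 rotate_closed[OF k d]] counit_at_rotate_last[OF k d] d'_def)
    qed (assumption | rule closed_rules d')+
    also have "\<dots> = tmap n (counit_at n 0) (tens (Suc n) m d)"
      using lift_coact_counit[OF vs_X t m] by (simp add: tmap_tens[OF lin0 m d] d'_def)
    finally show "tmap n (counit_at n (Suc n)) (tau (Suc n) (tens (Suc n) m d)) = tmap n (counit_at n 0) (tens (Suc n) m d)" .
  qed
qed

section \<open>The operators \<open>L\<close>\<close>

lemma bilin_L: "g \<in> carrier H \<Longrightarrow> bilin M (P n) (X n)
    (\<lambda>m d. lift (X n) (comult H g) (\<lambda>(a, b). tens n (ract M m (antipode H a)) (diag_act H C n b d)))"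
  by (assumption | rule linear_rules closed_rules)+

text \<open>
  By the recursion for the iterated coproduct, \<open>L\<^sub>g\<close> is made of the right action on \<open>M\<close> and the diagonal
  action only.
\<close>

lemma L_eq:
  assumes g: "g \<in> carrier H" and x: "x \<in> carrier (X n)"
  shows "L n g x = lift (X n) x (\<lambda>(m, d). lift (X n) (comult H g)
    (\<lambda>(a, b). tens n (ract M m (antipode H a)) (diag_act H C n b d)))"
  unfolding L_op_def
proof (rule cochain_lift_eqI[OF bilin_lift_linear[OF bilin_L[OF g]] _ x])
  fix m cs assume m: "m \<in> carrier M" and cs: "cs \<in> power_lists C (Suc n)"
  let ?F = "\<lambda>gs. pure_cochain C M (ract M m (antipode H (hd gs))) (map2 (lact C) (tl gs) cs)"
  let ?G = "\<lambda>a hs. tens n (ract M m (antipode H a)) (pure_power C (map2 (lact C) hs cs))"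
  have FG: "?F (a # hs) = ?G a hs" if "hs \<in> power_lists H (Suc n)" for a hs
    using pure_cochain_eq[OF map2_lact_closed[OF that cs]] by simp
  have t: "linear_map (P n) (X n) (tens n (ract M m (antipode H a)))" if "a \<in> carrier H" for a
    by (assumption | rule linear_rules closed_rules m that)+
  have G_mlin: "mlin H (Suc n) (X n) (?G a)" if "a \<in> carrier H" for a
    by (rule mlin_compose[OF t[OF that] mlin_lact_left[OF mlin_pure_power[OF C.vs_C] cs]])
  have F: "mlin H (Suc (Suc n)) (X n) ?F"
  proof (rule mlinI)
    show "?F gs \<in> carrier (X n)" if "gs \<in> power_lists H (Suc (Suc n))" for gs
      using that by (rule power_lists_SucE) (simp add: FG mlin_closed[OF G_mlin] del: list.sel)
    fix xs ys assume xy: "set xs \<subseteq> carrier H" "set ys \<subseteq> carrier H" "Suc (Suc n) = Suc (length xs + length ys)"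
    show "linear_map H (X n) (\<lambda>v. ?F (xs @ v # ys))"
    proof (cases xs)
      case Nil
      then have ys: "ys \<in> power_lists H (Suc n)" using xy by (simp add: power_lists_def)
      have "linear_map H (X n) (\<lambda>v. ?G v ys)" by (assumption | rule linear_rules closed_rules m cs ys)+
      then show ?thesis using FG[OF ys] Nil by simp
    next
      case (Cons a zs)
      have "linear_map H (X n) (\<lambda>v. ?G a (zs @ v # ys))"
        using xy Cons by (intro mlin_slot[OF G_mlin slot_middle]) auto
      then show ?thesis
        by (rule linear_map_cong[OF _ H.vs_C]) (use xy Cons FG[of "zs @ v # ys" a for v] in \<open>simp add: power_lists_def\<close>)
    qed
  qed
  have "lift (X n) (iter_comult H (Suc n) g) ?F =
      lift (X n) (comult H g) (\<lambda>(a, b). lift (X n) (iter_comult H n b) (\<lambda>hs. ?F (a # hs)))"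
    by (rule lift_iter_Suc[OF vs_X F g])
  also have "\<dots> = lift (X n) (comult H g) (\<lambda>(a, b). tens n (ract M m (antipode H a)) (diag_act H C n b (pure_power C cs)))"
  proof (rule H.comult_cong[OF g vs_X])
    fix a b assume ab: "a \<in> carrier H" "b \<in> carrier H"
    show "lift (X n) (iter_comult H n b) (\<lambda>hs. ?F (a # hs)) =
        tens n (ract M m (antipode H a)) (diag_act H C n b (pure_power C cs))"
      unfolding linear_map_diag_act_pure[OF vs_X t[OF ab(1)] ab(2) cs]
      by (rule lift_power_cong[OF H.vs_C iter_comult_closed[OF ab(2)] vs_X FG mlin_closed[OF G_mlin[OF ab(1)]]])
  qed (assumption | rule closed_rules m cs)+
  finally show "lift (X n) (iter_comult H (Suc n) g) ?F = lift (X n) (tens n m (pure_power C cs)) (\<lambda>(m, d).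
      lift (X n) (comult H g) (\<lambda>(a, b). tens n (ract M m (antipode H a)) (diag_act H C n b d)))"
    using bilin_lift_tens[OF bilin_L[OF g] m pure_power_closed[OF C.vs_C cs]] by simp
qed

lemma L_linear: "g \<in> carrier H \<Longrightarrow> linear_map (X n) (X n) (L n g)"
  by (rule linear_map_cong[OF bilin_lift_linear[OF bilin_L] vs_X L_eq])

lemma L_closed [closed_rules]: "g \<in> carrier H \<Longrightarrow> x \<in> carrier (X n) \<Longrightarrow> L n g x \<in> carrier (X n)"
  by (rule linear_map_closed[OF L_linear])

lemma L_tens:
  "g \<in> carrier H \<Longrightarrow> m \<in> carrier M \<Longrightarrow> d \<in> carrier (P n) \<Longrightarrow>
    L n g (tens n m d) = lift (X n) (comult H g) (\<lambda>(a, b). tens n (ract M m (antipode H a)) (diag_act H C n b d))"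
  by (simp add: L_eq tens_closed bilin_lift_tens[OF bilin_L])

text \<open>
  The antipode reverses products and turns the right action on \<open>M\<close> into a left action; together with the
  diagonal action this makes \<open>L\<close> a left action.
\<close>

lemma L_mult:
  assumes h: "h \<in> carrier H" and g: "g \<in> carrier H" and x: "x \<in> carrier (X n)"
  shows "L n (h \<cdot> g) x = L n h (L n g x)"
proof (rule X_tens_ext[OF vs_X _ _ _ x])
  show "linear_map (X n) (X n) (L n (h \<cdot> g))" using h g by (intro L_linear) simp
  show "linear_map (X n) (X n) (\<lambda>x. L n h (L n g x))"
    by (rule linear_map_compose[OF L_linear L_linear]) (rule h g)+
  fix m d assume m: "m \<in> carrier M" and d: "d \<in> carrier (P n)"
  let ?t = "\<lambda>g1 g2 h1 h2. tens n (ract M (ract M m (antipode H g1)) (antipode H h1)) (diag_act H C n h2 (diag_act H C n g2 d))"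
  have "L n (h \<cdot> g) (tens n m d) = lift (X n) (comult H (h \<cdot> g))
      (\<lambda>(a, b). tens n (ract M m (antipode H a)) (diag_act H C n b d))"
    using h g by (intro L_tens m d) simp
  also have "\<dots> = lift (X n) (comult H h) (\<lambda>(h1, h2). lift (X n) (comult H g) (\<lambda>(g1, g2).
      tens n (ract M m (antipode H (h1 \<cdot> g1))) (diag_act H C n (h2 \<cdot> g2) d)))"
    by (rule lift_comult_mult[OF vs_X _ h g]) (assumption | rule linear_rules closed_rules m d)+
  also have "\<dots> = lift (X n) (comult H h) (\<lambda>(h1, h2). lift (X n) (comult H g) (\<lambda>(g1, g2). ?t g1 g2 h1 h2))"
    apply (rule H.comult_cong[OF h vs_X])
     apply (rule H.comult_cong[OF g vs_X])
      apply (simp add: antipode_mult ract_mult diag_act_mult antipode_closed m d)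
     apply (assumption | rule closed_rules m d g)+
    done
  also have "\<dots> = lift (X n) (comult H g) (\<lambda>(g1, g2). lift (X n) (comult H h) (\<lambda>(h1, h2). ?t g1 g2 h1 h2))"
    by (rule lift_tensor_swap[OF H.vs_C H.vs_C H.vs_C H.vs_C _ _ vs_X]) (assumption | rule closed_rules m d g h)+
  also have "\<dots> = lift (X n) (comult H g) (\<lambda>(g1, g2). L n h (tens n (ract M m (antipode H g1)) (diag_act H C n g2 d)))"
    apply (rule H.comult_cong[OF g vs_X])
     apply (rule L_tens[symmetric])
       apply (assumption | rule closed_rules m d g h)+
    done
  also have "\<dots> = L n h (L n g (tens n m d))"
    unfolding L_tens[OF g m d]
    by (rule lift_tensor_push[OF H.vs_C H.vs_C L_linear[OF h] vs_X vs_X, symmetric])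
      (assumption | rule closed_rules m d g h)+
  finally show "L n (h \<cdot> g) (tens n m d) = L n h (L n g (tens n m d))" .
qed

definition equivariant where
  "equivariant n n' f \<longleftrightarrow> linear_map (P n) (P n') f \<and>
     (\<forall>h\<in>carrier H. \<forall>d\<in>carrier (P n). f (diag_act H C n h d) = diag_act H C n' h (f d))"

lemma equivariant_comult_at: "i \<le> n \<Longrightarrow> equivariant n (Suc n) (comult_at n i)"
  by (simp add: equivariant_def comult_at_linear comult_at_diag_act)

lemma equivariant_counit_at: "i \<le> Suc n \<Longrightarrow> equivariant (Suc n) n (counit_at n i)"
  by (simp add: equivariant_def counit_at_linear counit_at_diag_act)

lemma tmap_L:
  assumes f: "equivariant n n' f" and g: "g \<in> carrier H" and x: "x \<in> carrier (X n)"
  shows "tmap n' f (L n g x) = L n' g (tmap n' f x)"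
proof -
  have lin: "linear_map (P n) (P n') f" using f by (simp add: equivariant_def)
  note tl = tmap_linear[OF lin]
  show ?thesis
  proof (rule X_tens_ext[OF vs_X linear_map_compose[OF tl L_linear[OF g]] linear_map_compose[OF L_linear[OF g] tl] _ x])
    fix m d assume m: "m \<in> carrier M" and d: "d \<in> carrier (P n)"
    have "tmap n' f (L n g (tens n m d)) = lift (X n') (comult H g)
        (\<lambda>(a, b). tmap n' f (tens n (ract M m (antipode H a)) (diag_act H C n b d)))"
      unfolding L_tens[OF g m d]
      by (rule lift_tensor_push[OF H.vs_C H.vs_C tl vs_X vs_X]) (assumption | rule closed_rules m d g)+
    also have "\<dots> = lift (X n') (comult H g) (\<lambda>(a, b). tens n' (ract M m (antipode H a)) (diag_act H C n' b (f d)))"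
      by (rule H.comult_cong[OF g vs_X])
        (use f in \<open>simp_all add: equivariant_def tmap_tens m d ract_closed antipode_closed diag_act_closed
          tens_closed linear_map_closed[OF lin]\<close>)
    finally show "tmap n' f (L n g (tens n m d)) = L n' g (tmap n' f (tens n m d))"
      by (simp add: tmap_tens[OF lin] L_tens g m d linear_map_closed[OF lin])
  qed
qed

end

section \<open>The balanced quotient\<close>

context sayd
begin

abbreviation B where "B n \<equiv> CH_relations H C M n"
abbreviation Q where "Q n \<equiv> quot_space (X n) (B n)"
abbreviation q where "q n x \<equiv> B n +>\<^bsub>X n\<^esub> x"

lemma B_eq: "B n = lin_span (X n)
    {tens n (ract M m h) d \<ominus>\<^bsub>X n\<^esub> tens n m (diag_act H C n h d) | m h d.
      m \<in> carrier M \<and> h \<in> carrier H \<and> d \<in> carrier (P n)}"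
  by (simp add: CH_relations_def balancing_def cochains_def)

lemma B_gens_carrier: "{tens n (ract M m h) d \<ominus>\<^bsub>X n\<^esub> tens n m (diag_act H C n h d) | m h d.
      m \<in> carrier M \<and> h \<in> carrier H \<and> d \<in> carrier (P n)} \<subseteq> carrier (X n)"
  by (auto intro!: vs_minus_closed tens_closed ract_closed diag_act_closed)

lemma submodule_B: "submodule (B n) cplx (X n)"
  unfolding B_eq by (rule submodule_lin_span[OF vs_X B_gens_carrier])

lemmas vs_Q [simp, closed_rules] = vs_quot_space[OF vs_X submodule_B]

lemma q_linear: "linear_map (X n) (Q n) (q n)"
  by (rule linear_map_coset[OF vs_X submodule_B])

lemma q_closed [closed_rules]: "x \<in> carrier (X n) \<Longrightarrow> q n x \<in> carrier (Q n)"
  by (rule linear_map_closed[OF q_linear])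

lemma linear_map_q [linear_rules]: "linear_map U (X n) g \<Longrightarrow> linear_map U (Q n) (\<lambda>u. q n (g u))"
  by (rule linear_map_compose[OF q_linear])

definition balanced where
  "balanced n p \<longleftrightarrow> (\<forall>m\<in>carrier M. \<forall>h\<in>carrier H. \<forall>d\<in>carrier (P n).
     p (tens n (ract M m h) d) = p (tens n m (diag_act H C n h d)))"

lemma balancedD: "balanced n p \<Longrightarrow> m \<in> carrier M \<Longrightarrow> h \<in> carrier H \<Longrightarrow> d \<in> carrier (P n) \<Longrightarrow>
    p (tens n (ract M m h) d) = p (tens n m (diag_act H C n h d))"
  by (simp add: balanced_def)

lemma balanced_q: "balanced n (q n)"
  unfolding balanced_def
proof (intro ballI)
  fix m h d assume *: "m \<in> carrier M" "h \<in> carrier H" "d \<in> carrier (P n)"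
  then have "tens n (ract M m h) d \<ominus>\<^bsub>X n\<^esub> tens n m (diag_act H C n h d) \<in> B n"
    unfolding B_eq by (intro subsetD[OF lin_span_superset]) blast
  then show "q n (tens n (ract M m h) d) = q n (tens n m (diag_act H C n h d))"
    using * by (subst coset_eq_iff[OF vs_X submodule_B]) (auto intro!: closed_rules)
qed

text \<open>
  Together with \<open>balanced_if_zero\<close>: the balanced maps are those that factor through the quotient by \<open>B\<close>.
\<close>

lemma balanced_zero:
  assumes Z: "vspace Z" and p: "linear_map (X n) Z p" "balanced n p" and x: "x \<in> B n"
  shows "p x = \<zero>\<^bsub>Z\<^esub>"
proof -
  have "p x \<in> {\<zero>\<^bsub>Z\<^esub>}"
  proof (rule linear_map_lin_span[OF vs_X Z p(1) submodule_zero_space[OF Z] B_gens_carrier _ x[unfolded B_eq]])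
    fix y assume "y \<in> {tens n (ract M m h) d \<ominus>\<^bsub>X n\<^esub> tens n m (diag_act H C n h d) | m h d.
      m \<in> carrier M \<and> h \<in> carrier H \<and> d \<in> carrier (P n)}"
    then obtain m h d where y: "y = tens n (ract M m h) d \<ominus>\<^bsub>X n\<^esub> tens n m (diag_act H C n h d)"
      and c: "m \<in> carrier M" "h \<in> carrier H" "d \<in> carrier (P n)" by blast
    have t: "tens n (ract M m h) d \<in> carrier (X n)" "tens n m (diag_act H C n h d) \<in> carrier (X n)"
      using c by (auto intro!: closed_rules)
    show "p y \<in> {\<zero>\<^bsub>Z\<^esub>}"
      unfolding y linear_map_minus[OF vs_X Z p(1) t]
      using balancedD[OF p(2) c] vs_minus_zero_iff[OF Z linear_map_closed[OF p(1) t(1)] linear_map_closed[OF p(1) t(2)]]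
      by simp
  qed
  then show ?thesis by simp
qed

lemma balanced_if_zero:
  assumes p: "linear_map (X n) Z p" and Z: "vspace Z" and zero: "\<And>x. x \<in> B n \<Longrightarrow> p x = \<zero>\<^bsub>Z\<^esub>"
  shows "balanced n p"
  unfolding balanced_def
proof (intro ballI)
  fix m h d assume *: "m \<in> carrier M" "h \<in> carrier H" "d \<in> carrier (P n)"
  have t: "tens n (ract M m h) d \<in> carrier (X n)" "tens n m (diag_act H C n h d) \<in> carrier (X n)"
    using * by (auto intro!: closed_rules)
  have "tens n (ract M m h) d \<ominus>\<^bsub>X n\<^esub> tens n m (diag_act H C n h d) \<in> B n"
    unfolding B_eq using * by (intro subsetD[OF lin_span_superset]) blast
  then have "p (tens n (ract M m h) d) \<ominus>\<^bsub>Z\<^esub> p (tens n m (diag_act H C n h d)) = \<zero>\<^bsub>Z\<^esub>"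
    using zero linear_map_minus[OF vs_X Z p t] by metis
  then show "p (tens n (ract M m h) d) = p (tens n m (diag_act H C n h d))"
    using vs_minus_zero_iff[OF Z linear_map_closed[OF p t(1)] linear_map_closed[OF p t(2)]] by blast
qed

text \<open>
  A balanced map may move the factor \<open>g\<^sup>(\<^sup>2\<^sup>)\<close> of \<open>m S(g\<^sup>(\<^sup>1\<^sup>)) \<otimes> g\<^sup>(\<^sup>2\<^sup>) d\<close> to the left, where it cancels against
  \<open>S(g\<^sup>(\<^sup>1\<^sup>))\<close>.  With the converse below, this identifies the balanced tensor product with the coinvariants
  of \<open>L\<close>.
\<close>

lemma balanced_imp_L_invariant:
  assumes Z: "vspace Z" and p: "linear_map (X n) Z p" "balanced n p"
    and g: "g \<in> carrier H" and x: "x \<in> carrier (X n)"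
  shows "p (L n g x) = counit H g \<odot>\<^bsub>Z\<^esub> p x"
proof (rule X_tens_ext[OF Z _ _ _ x])
  show "linear_map (X n) Z (\<lambda>x. p (L n g x))" by (rule linear_map_compose[OF p(1) L_linear[OF g]])
  show "linear_map (X n) Z (\<lambda>x. counit H g \<odot>\<^bsub>Z\<^esub> p x)" by (rule linear_map_scale[OF Z p(1)])
  fix m d assume m: "m \<in> carrier M" and d: "d \<in> carrier (P n)"
  have lin: "linear_map H Z (\<lambda>y. p (tens n (ract M m y) d))"
    by (rule linear_map_compose[OF p(1)]) (assumption | rule linear_rules m d)+
  have "p (L n g (tens n m d)) = lift Z (comult H g) (\<lambda>(a, b). p (tens n (ract M m (antipode H a)) (diag_act H C n b d)))"
    unfolding L_tens[OF g m d]
    by (rule lift_tensor_push[OF H.vs_C H.vs_C p(1) vs_X Z]) (assumption | rule closed_rules m d g)+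
  also have "\<dots> = lift Z (comult H g) (\<lambda>(a, b). p (tens n (ract M m (antipode H a \<cdot> b)) d))"
    apply (rule H.comult_cong[OF g Z])
    subgoal for a b
      using balancedD[OF p(2), of "ract M m (antipode H a)" b d] m d
      by (simp add: ract_mult antipode_closed ract_closed)
    apply (rule linear_map_closed[OF p(1)])
    apply (assumption | rule closed_rules m d)+
    done
  also have "\<dots> = counit H g \<odot>\<^bsub>Z\<^esub> p (tens n (ract M m \<one>\<^bsub>H\<^esub>) d)"
    by (rule lift_antipode_left[OF Z lin g])
  finally show "p (L n g (tens n m d)) = counit H g \<odot>\<^bsub>Z\<^esub> p (tens n m d)"
    by (simp add: ract_one m)
qed

text \<open>
  Let \<open>\<Delta>(h) = a \<otimes> b\<close>.  Inserting \<open>\<epsilon>(b)\<close> and then \<open>L\<^sub>b\<close> into \<open>p(m h \<otimes> d)\<close> produces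
  \<open>p(m h\<^sup>(\<^sup>1\<^sup>) S(h\<^sup>(\<^sup>2\<^sup>)) \<otimes> h\<^sup>(\<^sup>3\<^sup>) d)\<close>, where the two factors next to \<open>m\<close> cancel.
\<close>

lemma L_invariant_imp_balanced:
  assumes Z: "vspace Z" and p: "linear_map (X n) Z p"
    and inv: "\<And>g x. g \<in> carrier H \<Longrightarrow> x \<in> carrier (X n) \<Longrightarrow> p (L n g x) = counit H g \<odot>\<^bsub>Z\<^esub> p x"
  shows "balanced n p"
  unfolding balanced_def
proof (intro ballI)
  fix m h d assume m: "m \<in> carrier M" and h: "h \<in> carrier H" and d: "d \<in> carrier (P n)"
  note cong = lift_tensor_cong[OF H.vs_C H.vs_C _ Z]
  note rules = closed_rules m h d Z linear_map_closed[OF p]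
  note lin = linear_map_compose[OF p]
  have lm: "linear_map H Z (\<lambda>a. p (tens n (ract M m a) d))"
    by (rule lin) (assumption | rule linear_rules m d)+
  have ld: "linear_map H Z (\<lambda>y. p (tens n m (diag_act H C n y d)))"
    by (rule lin) (assumption | rule linear_rules m d)+
  let ?G = "\<lambda>a x y. p (tens n (ract M m (a \<cdot> antipode H x)) (diag_act H C n y d))"
  have "p (tens n (ract M m h) d) = lift Z (comult H h) (\<lambda>(a, b). counit H b \<odot>\<^bsub>Z\<^esub> p (tens n (ract M m a) d))"
    by (rule H.lift_counit_right[OF Z lm h, symmetric])
  also have "\<dots> = lift Z (comult H h) (\<lambda>(a, b). lift Z (comult H b) (\<lambda>(x, y). ?G a x y))"
  proof (rule cong[OF H.comult_closed[OF h]])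
    fix a b assume ab: "a \<in> carrier H" "b \<in> carrier H"
    have "counit H b \<odot>\<^bsub>Z\<^esub> p (tens n (ract M m a) d) = p (L n b (tens n (ract M m a) d))"
      by (rule inv[symmetric]) (assumption | rule rules ab)+
    also have "\<dots> = lift Z (comult H b)
        (\<lambda>(x, y). p (tens n (ract M (ract M m a) (antipode H x)) (diag_act H C n y d)))"
      unfolding L_tens[OF ab(2) ract_closed[OF m ab(1)] d]
      by (rule lift_tensor_push[OF H.vs_C H.vs_C p vs_X Z]) (assumption | rule rules ab)+
    also have "\<dots> = lift Z (comult H b) (\<lambda>(x, y). ?G a x y)"
      apply (rule cong)
        apply (assumption | rule rules ab)+
       apply (simp add: ract_mult antipode_closed m ab)
      apply (assumption | rule rules ab)+
      done
    finally show "counit H b \<odot>\<^bsub>Z\<^esub> p (tens n (ract M m a) d) = lift Z (comult H b) (\<lambda>(x, y). ?G a x y)" .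
  qed (assumption | rule rules)+
  also have "\<dots> = lift Z (comult H h) (\<lambda>(b, y). lift Z (comult H b) (\<lambda>(a, x). ?G a x y))"
    by (rule H.lift_coassoc[OF Z _ h, symmetric], rule trilinI; rule lin)
      (assumption | rule linear_rules rules)+
  also have "\<dots> = lift Z (comult H h) (\<lambda>(b, y). counit H b \<odot>\<^bsub>Z\<^esub> p (tens n m (diag_act H C n y d)))"
  proof (rule cong[OF H.comult_closed[OF h]])
    fix b y assume by': "b \<in> carrier H" "y \<in> carrier H"
    have l: "linear_map H Z (\<lambda>z. p (tens n (ract M m z) (diag_act H C n y d)))"
      by (rule lin) (assumption | rule linear_rules rules by')+
    show "lift Z (comult H b) (\<lambda>(a, x). ?G a x y) = counit H b \<odot>\<^bsub>Z\<^esub> p (tens n m (diag_act H C n y d))"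
      using lift_antipode_right[OF Z l by'(1)] by (simp add: ract_one m)
  qed (assumption | rule rules)+
  also have "\<dots> = p (tens n m (diag_act H C n h d))"
    by (rule H.lift_counit_left[OF Z ld h])
  finally show "p (tens n (ract M m h) d) = p (tens n m (diag_act H C n h d))" .
qed

end

section \<open>The cyclic operator descends to the balanced quotient\<close>

context hopf_module_coalgebra
begin

text \<open>
  The tensor \<open>b ds \<otimes> c\<close>, where \<open>b\<close> acts diagonally on \<open>ds\<close> only.  The list \<open>ds\<close> may be empty, and on the
  empty tensor power \<open>H\<close> acts by the counit; this case is separate because iterated coproducts have at
  least one factor.  The diagonal action before and after a rotation is expressed through this tensor.
\<close>

definition front where
  "front n ds b c = (case n of
     0 \<Rightarrow> counit H b \<odot>\<^bsub>P 0\<^esub> pure_power C [c]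
   | Suc k \<Rightarrow> lift (P n) (iter_comult H k b) (\<lambda>hs. pure_power C (map2 (lact C) hs ds @ [c])))"

context
  fixes n ds assumes ds: "ds \<in> power_lists C n"
begin

lemma snoc_closed: "c \<in> carrier C \<Longrightarrow> ds @ [c] \<in> power_lists C (Suc n)"
  using ds by (simp add: power_lists_def)

lemma map2_snoc_closed:
  "n = Suc k \<Longrightarrow> hs \<in> power_lists H (Suc k) \<Longrightarrow> c \<in> carrier C \<Longrightarrow> map2 (lact C) hs ds @ [c] \<in> power_lists C (Suc n)"
  using map2_lact_closed[of hs n ds] ds by (auto simp: power_lists_def)

lemma front_linear_left: "c \<in> carrier C \<Longrightarrow> linear_map H (P n) (\<lambda>b. front n ds b c)"
proof (cases n)
  case 0
  assume "c \<in> carrier C"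
  then show ?thesis
    unfolding front_def 0 nat.case
    by (intro linear_map_smult_left vs_P H.counit_linear pure_power_closed C.vs_C) simp
next
  case (Suc k)
  assume c: "c \<in> carrier C"
  have "mlin H (Suc k) (P n) (\<lambda>hs. pure_power C (map2 (lact C) hs ds @ [c]))"
    using ds Suc c by (intro mlin_lact_left[where F = "\<lambda>cs. pure_power C (cs @ [c])"] mlin_snoc)
      (simp_all add: mlin_pure_power[OF C.vs_C])
  then show ?thesis
    unfolding front_def Suc nat.case
    by (intro linear_map_lift_power_compose[OF iter_comult_linear _ H.vs_C vs_P]) (simp add: Suc)
qed

lemma front_linear_right: "b \<in> carrier H \<Longrightarrow> linear_map C (P n) (\<lambda>c. front n ds b c)"
proof (cases n)
  case 0
  then show ?thesis
    unfolding front_def 0 nat.case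
    by (intro linear_map_scale vs_P) (rule linear_rules C.vs_C | simp)+
next
  case (Suc k)
  assume b: "b \<in> carrier H"
  show ?thesis
    unfolding front_def Suc nat.case
  proof (rule lift_power_family[OF H.vs_C iter_comult_closed[OF b] C.vs_C vs_P])
    fix hs assume "hs \<in> power_lists H (Suc k)"
    then have "map2 (lact C) hs ds \<in> power_lists C n"
      using ds Suc by (intro map2_lact_closed) simp_all
    from linear_map_mlin_last[OF mlin_pure_power[OF C.vs_C] this]
    show "linear_map C (P (Suc k)) (\<lambda>c. pure_power C (map2 (lact C) hs ds @ [c]))" by (simp add: Suc)
  qed
qed

lemma front_closed: "b \<in> carrier H \<Longrightarrow> c \<in> carrier C \<Longrightarrow> front n ds b c \<in> carrier (P n)"
  by (rule linear_map_closed[OF front_linear_left])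

lemma diag_act_snoc:
  assumes h: "h \<in> carrier H" and c: "c \<in> carrier C"
  shows "diag_act H C n h (pure_power C (ds @ [c])) =
    lift (P n) (comult H h) (\<lambda>(a, b). front n ds a (lact C b c))"
proof (cases n)
  case 0
  then have [simp]: "ds = []" using ds by (simp add: power_lists_def)
  have lin: "linear_map H (P 0) (\<lambda>b. pure_power C [lact C b c])"
    by (rule linear_rules C.vs_C c | simp)+
  have "diag_act H C 0 h (pure_power C [c]) = pure_power C [lact C h c]"
    using c lift_iter_0[OF vs_P mlin_lact_left[OF mlin_pure_power[OF C.vs_C]] h, of "[c]"]
    by (subst diag_act_pure[OF h]) simp_all
  then show ?thesis
    using H.lift_counit_left[OF vs_P lin h] by (simp add: front_def 0)
next
  case (Suc k)
  note rules = closed_rules h c map2_snoc_closed[OF Suc]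
  have pc: "pure_power C (map2 (lact C) hs ds @ [lact C b c]) \<in> carrier (P (Suc k))"
    if "hs \<in> power_lists H (Suc k)" "b \<in> carrier H" for hs b
    using map2_snoc_closed[OF Suc that(1) lact_closed[OF that(2) c]] Suc
    by (intro pure_power_closed C.vs_C) simp
  have d: "ds @ [c] \<in> power_lists C (Suc (Suc k))" using snoc_closed[OF c] Suc by simp
  have "diag_act H C (Suc k) h (pure_power C (ds @ [c])) =
      lift (P (Suc k)) (comult H h) (\<lambda>(a, b). lift (P (Suc k)) (iter_comult H k a)
        (\<lambda>hs. pure_power C (map2 (lact C) (hs @ [b]) (ds @ [c]))))"
    unfolding diag_act_pure[OF h d]
    by (rule lift_iter_snoc[OF vs_P mlin_lact_left[OF mlin_pure_power[OF C.vs_C] d] h])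
  also have "\<dots> = lift (P (Suc k)) (comult H h) (\<lambda>(a, b). front (Suc k) ds a (lact C b c))"
    unfolding front_def nat.case
    apply (rule H.comult_cong[OF h vs_P])
     apply (rule lift_power_cong[OF H.vs_C _ vs_P])
       apply (assumption | rule rules)+
    using ds Suc apply (simp add: power_lists_length)
     apply (assumption | rule pc rules)+
    done
  finally show ?thesis using Suc by simp
qed

lemma rotate_diag_act:
  assumes h: "h \<in> carrier H" and c: "c \<in> carrier C" and k: "k \<in> carrier H"
  shows "rotate n k (diag_act H C n h (pure_power C (c # ds))) =
    lift (P n) (comult H h) (\<lambda>(a, b). front n ds b (lact C (k \<cdot> a) c))"
proof -
  have d: "c # ds \<in> power_lists C (Suc n)" using c ds by simp
  define G where "G hs = rotate n k (pure_power C (map2 (lact C) hs (c # ds)))" for hs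
  have G: "mlin H (Suc n) (P n) G"
    unfolding G_def by (rule mlin_compose[OF rotate_linear[OF k] mlin_lact_left[OF mlin_pure_power[OF C.vs_C] d]])
  have LHS: "rotate n k (diag_act H C n h (pure_power C (c # ds))) = lift (P n) (iter_comult H n h) G"
    unfolding G_def by (rule linear_map_diag_act_pure[OF vs_P rotate_linear[OF k] h d])
  have Gt: "G (a # hs) = pure_power C (map2 (lact C) hs ds @ [lact C (k \<cdot> a) c])"
    if "a \<in> carrier H" "hs \<in> power_lists H n" for a hs
    using that map2_lact_closed[OF that(2) ds] by (simp add: G_def rotate_pure lact_closed lact_mult k c)
  show ?thesis
  proof (cases n)
    case 0
    then have [simp]: "ds = []" using ds by (simp add: power_lists_def)
    have lin: "linear_map H (P 0) (\<lambda>a. pure_power C [lact C (k \<cdot> a) c])"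
      by (rule linear_rules C.vs_C c k | simp)+
    have "lift (P 0) (iter_comult H 0 h) G = G [h]"
      using G 0 by (intro lift_iter_0[OF vs_P _ h]) simp
    also have "\<dots> = lift (P 0) (comult H h) (\<lambda>(a, b). counit H b \<odot>\<^bsub>P 0\<^esub> pure_power C [lact C (k \<cdot> a) c])"
      using H.lift_counit_right[OF vs_P lin h] Gt[OF h, of "[]"] 0 by simp
    finally show ?thesis using LHS 0 by (simp add: front_def)
  next
    case (Suc j)
    have "lift (P n) (iter_comult H n h) G = lift (P n) (comult H h) (\<lambda>(a, b). lift (P n) (iter_comult H j b) (\<lambda>hs. G (a # hs)))"
      unfolding Suc by (rule lift_iter_Suc[OF vs_P _ h]) (use G Suc in simp)
    also have "\<dots> = lift (P n) (comult H h) (\<lambda>(a, b). front n ds b (lact C (k \<cdot> a) c))"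
    proof (rule H.comult_cong[OF h vs_P])
      fix a b assume ab: "a \<in> carrier H" "b \<in> carrier H"
      have kac: "lact C (k \<cdot> a) c \<in> carrier C" using k ab c by (simp add: lact_closed)
      show "lift (P n) (iter_comult H j b) (\<lambda>hs. G (a # hs)) = front n ds b (lact C (k \<cdot> a) c)"
        unfolding front_def Suc nat.case
        by (rule lift_power_cong[OF H.vs_C iter_comult_closed[OF ab(2)] vs_P Gt[OF ab(1)]])
          (use pure_power_closed[OF C.vs_C map2_snoc_closed[OF Suc _ kac]] Suc in simp_all)
      show "front n ds b (lact C (k \<cdot> a) c) \<in> carrier (P n)" by (rule front_closed[OF ab(2) kac])
    qed
    finally show ?thesis using LHS by simp
  qed
qed

end

end

context sayd
begin

text \<open>
  Let \<open>d = c \<otimes> ds\<close>.  The anti-Yetter-Drinfeld condition expands \<open>\<tau>(m h \<otimes> d)\<close> as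
  \<open>m\<^sub>\<langle>\<^sub>0\<^sub>\<rangle> h\<^sup>(\<^sup>2\<^sup>) \<otimes> ds \<otimes> S(h\<^sup>(\<^sup>3\<^sup>)) m\<^sub>\<langle>\<^sub>-\<^sub>1\<^sub>\<rangle> h\<^sup>(\<^sup>1\<^sup>) c\<close>.  In the balanced quotient the factor \<open>h\<^sup>(\<^sup>2\<^sup>)\<close> moves to the right,
  where it acts diagonally and meets \<open>S(h\<^sup>(\<^sup>3\<^sup>))\<close> in the last tensor factor.  After this cancellation
  \<open>m\<^sub>\<langle>\<^sub>0\<^sub>\<rangle> \<otimes> h\<^sup>(\<^sup>2\<^sup>) ds \<otimes> m\<^sub>\<langle>\<^sub>-\<^sub>1\<^sub>\<rangle> h\<^sup>(\<^sup>1\<^sup>) c\<close> remains, which is \<open>\<tau>(m \<otimes> h d)\<close>.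
\<close>

lemma tau_balanced: "balanced n (\<lambda>x. q n (tau n x))"
  unfolding balanced_def
proof (intro ballI)
  fix m h d assume m: "m \<in> carrier M" and h: "h \<in> carrier H" and d: "d \<in> carrier (P n)"
  let ?Q = "Q n"
  have qt: "linear_map (X n) ?Q (\<lambda>x. q n (tau n x))" by (rule linear_map_compose[OF q_linear tau_linear])
  show "q n (tau n (tens n (ract M m h) d)) = q n (tau n (tens n m (diag_act H C n h d)))"
  proof (rule power_ext[OF C.vs_C vs_Q _ _ _ d])
    show "linear_map (P n) ?Q (\<lambda>d. q n (tau n (tens n (ract M m h) d)))"
      by (rule linear_map_compose[OF qt]) (assumption | rule linear_rules closed_rules m h)+
    show "linear_map (P n) ?Q (\<lambda>d. q n (tau n (tens n m (diag_act H C n h d))))"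
      by (rule linear_map_compose[OF qt]) (assumption | rule linear_rules closed_rules m h)+
    fix cs assume cs: "cs \<in> power_lists C (Suc n)"
    then obtain c ds where cs': "cs = c # ds" and c: "c \<in> carrier C" and ds: "ds \<in> power_lists C n"
      by (rule power_lists_SucE)
    have last: "ds @ [v] \<in> power_lists C (Suc n)" if "v \<in> carrier C" for v by (rule snoc_closed[OF ds that])
    note fr = front_closed[OF ds] and lfr = linear_map_compose[OF front_linear_left[OF ds]]
      linear_map_compose[OF front_linear_right[OF ds]]
    note rules = closed_rules m h c cs last fr
    note congM = lift_tensor_cong[OF H.vs_C vs_M _ vs_Q] and congH = lift_tensor_cong[OF H.vs_C H.vs_C _ vs_Q]
    let ?S = "antipode H"
    let ?F = "\<lambda>c' m'. q n (tens n m' (pure_power C (ds @ [c'])))"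
    \<comment> \<open>Here \<open>h1\<close> and \<open>h3\<close> come from the condition, and \<open>a\<close>, \<open>b\<close> are the halves of the middle component of
      \<open>h\<close> that act on \<open>ds\<close> and on the last tensor factor.\<close>
    let ?T = "\<lambda>h1 a b h3 k m0. q n (tens n m0 (front n ds a (lact C ((b \<cdot> ?S h3) \<cdot> (k \<cdot> h1)) c)))"
    let ?G = "\<lambda>h1 a b h3. lift ?Q (coact M m) (\<lambda>(k, m0). ?T h1 a b h3 k m0)"
    have G_closed: "?G h1 a b h3 \<in> carrier ?Q"
      if "h1 \<in> carrier H" "a \<in> carrier H" "b \<in> carrier H" "h3 \<in> carrier H" for h1 a b h3
      by (assumption | rule rules that)+
    have G_lin: "linear_map H ?Q (\<lambda>h1. ?G h1 a b h3)" "linear_map H ?Q (\<lambda>a. ?G h1 a b h3)"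
        "linear_map H ?Q (\<lambda>b. ?G h1 a b h3)" "linear_map H ?Q (\<lambda>h3. ?G h1 a b h3)"
      if "h1 \<in> carrier H" "a \<in> carrier H" "b \<in> carrier H" "h3 \<in> carrier H" for h1 a b h3
      by (rule lift_tensor_family[OF H.vs_C vs_M coact_closed[OF m] H.vs_C vs_Q],
          (assumption | rule linear_map_q linear_map_tens_right lfr linear_rules rules that)+)+
    have Fb: "bilin C M ?Q ?F"
    proof (rule bilinI)
      fix m' assume m': "m' \<in> carrier M"
      show "linear_map C ?Q (\<lambda>c'. ?F c' m')"
        by (rule linear_map_q[OF linear_map_tens_right[OF linear_map_mlin_last[OF mlin_pure_power[OF C.vs_C] ds] m']])
    qed (assumption | rule linear_rules rules)+

    have "q n (tau n (tens n (ract M m h) (pure_power C cs))) =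
        q n (lift (X n) (coact M (ract M m h)) (\<lambda>(k, m0). tens n m0 (rotate n k (pure_power C cs))))"
      using tau_tens[OF ract_closed[OF m h] pure_power_closed[OF C.vs_C cs]] by simp
    also have "\<dots> = lift ?Q (coact M (ract M m h)) (\<lambda>(k, m0). q n (tens n m0 (rotate n k (pure_power C cs))))"
      by (rule lift_tensor_push[OF H.vs_C vs_M q_linear vs_X vs_Q]) (assumption | rule rules)+
    also have "\<dots> = lift ?Q (coact M (ract M m h)) (\<lambda>(k, m0). ?F (lact C k c) m0)"
      apply (rule congM)
        apply (assumption | rule rules)+
       apply (simp add: cs' rotate_pure c ds)
      apply (assumption | rule rules)+
      done
    also have "\<dots> = lift ?Q (comult H h) (\<lambda>(h', h3). lift ?Q (comult H h') (\<lambda>(h1, h2). lift ?Q (coact M m) (\<lambda>(k, m0).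
        ?F (lact C (?S h3 \<cdot> k \<cdot> h1) c) (ract M m0 h2))))"
      by (rule lift_AYD[OF vs_Q Fb m h c])
    also have "\<dots> = lift ?Q (comult H h) (\<lambda>(h', h3). lift ?Q (comult H h') (\<lambda>(h1, h2). lift ?Q (coact M m) (\<lambda>(k, m0).
        lift ?Q (comult H h2) (\<lambda>(a, b). ?T h1 a b h3 k m0))))"
    proof (rule congH[OF H.comult_closed[OF h]], rule congH, erule H.comult_closed, rule congM[OF coact_closed[OF m]])
      fix h' h3 h1 h2 k m0
      assume h3: "h3 \<in> carrier H" and h12: "h1 \<in> carrier H" "h2 \<in> carrier H"
        and k: "k \<in> carrier H" and m0: "m0 \<in> carrier M"
      let ?x = "?S h3 \<cdot> k \<cdot> h1"
      have x: "?x \<in> carrier H" using h3 h12 k by (simp add: antipode_closed)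
      have xc: "lact C ?x c \<in> carrier C" by (rule lact_closed[OF x c])
      have qm: "linear_map (P n) ?Q (\<lambda>d. q n (tens n m0 d))" by (assumption | rule linear_rules m0)+
      have "?F (lact C ?x c) (ract M m0 h2) = q n (tens n m0 (diag_act H C n h2 (pure_power C (ds @ [lact C ?x c]))))"
        by (rule balancedD[OF balanced_q m0 h12(2) pure_power_closed[OF C.vs_C last[OF xc]]])
      also have "\<dots> = lift ?Q (comult H h2) (\<lambda>(a, b). q n (tens n m0 (front n ds a (lact C b (lact C ?x c)))))"
        unfolding diag_act_snoc[OF ds h12(2) xc]
        by (rule lift_tensor_push[OF H.vs_C H.vs_C qm vs_P vs_Q]) (assumption | rule rules h12 xc)+
      also have "\<dots> = lift ?Q (comult H h2) (\<lambda>(a, b). ?T h1 a b h3 k m0)"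
        apply (rule congH[OF H.comult_closed[OF h12(2)]])
        subgoal for a b
          using lact_mult[of b ?x c] x c h3 h12 k by (simp add: H.m_assoc antipode_closed)
        apply (assumption | rule rules h12 h3 k m0)+
        done
      finally show "?F (lact C ?x c) (ract M m0 h2) = lift ?Q (comult H h2) (\<lambda>(a, b). ?T h1 a b h3 k m0)" .
    qed (assumption | rule rules)+
    also have "\<dots> = lift ?Q (comult H h) (\<lambda>(h', h3). lift ?Q (comult H h') (\<lambda>(h1, h2).
        lift ?Q (comult H h2) (\<lambda>(a, b). ?G h1 a b h3)))"
      apply (rule congH[OF H.comult_closed[OF h]])
       apply (rule congH, erule H.comult_closed)
        apply (rule lift_tensor_swap[OF H.vs_C vs_M H.vs_C H.vs_C _ _ vs_Q])
          apply (assumption | rule rules)+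
      done
    also have "\<dots> = lift ?Q (comult H h) (\<lambda>(h1, h''). lift ?Q (comult H h'') (\<lambda>(h2, h3).
        lift ?Q (comult H h2) (\<lambda>(a, b). ?G h1 a b h3)))"
      by (rule H.lift_coassoc[OF vs_Q _ h]) (assumption | rule G_lin trilinI bilinI G_closed
          linear_map_lift_tensor_compose[OF H.comult_linear] lift_tensor_family[OF H.vs_C H.vs_C] H.comult_closed H.vs_C vs_Q)+
    also have "\<dots> = lift ?Q (comult H h) (\<lambda>(h1, h''). lift ?Q (comult H h'') (\<lambda>(a, y).
        lift ?Q (comult H y) (\<lambda>(b, h3). ?G h1 a b h3)))"
      apply (rule congH[OF H.comult_closed[OF h]])
       apply (rule H.lift_coassoc[OF vs_Q])
        apply (assumption | rule G_lin trilinI)+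
      apply (assumption | rule rules G_closed)+
      done
    also have "\<dots> = lift ?Q (comult H h) (\<lambda>(h1, h''). lift ?Q (coact M m) (\<lambda>(k, m0).
        q n (tens n m0 (front n ds h'' (lact C (k \<cdot> h1) c)))))"
    proof (rule congH[OF H.comult_closed[OF h]])
      fix h1 h'' assume h1: "h1 \<in> carrier H" and h'': "h'' \<in> carrier H"
      let ?g = "\<lambda>a z. lift ?Q (coact M m) (\<lambda>(k, m0). q n (tens n m0 (front n ds a (lact C (z \<cdot> (k \<cdot> h1)) c))))"
      have lz: "linear_map H ?Q (?g a)" if "a \<in> carrier H" for a
        by (rule lift_tensor_family[OF H.vs_C vs_M coact_closed[OF m] H.vs_C vs_Q],
          (assumption | rule linear_map_q linear_map_tens_right lfr linear_rules rules that h1)+)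
      have la: "linear_map H ?Q (\<lambda>a. ?g a \<one>\<^bsub>H\<^esub>)"
        by (rule lift_tensor_family[OF H.vs_C vs_M coact_closed[OF m] H.vs_C vs_Q],
          (assumption | rule linear_map_q linear_map_tens_right lfr linear_rules rules h1)+)
      have "lift ?Q (comult H h'') (\<lambda>(a, y). lift ?Q (comult H y) (\<lambda>(b, h3). ?G h1 a b h3)) =
          lift ?Q (comult H h'') (\<lambda>(a, y). counit H y \<odot>\<^bsub>?Q\<^esub> ?g a \<one>\<^bsub>H\<^esub>)"
        apply (rule congH[OF H.comult_closed[OF h'']])
         apply (rule lift_antipode_right[OF vs_Q lz])
          apply (assumption | rule rules h1)+
        done
      also have "\<dots> = ?g h'' \<one>\<^bsub>H\<^esub>" by (rule H.lift_counit_right[OF vs_Q la h''])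
      also have "\<dots> = lift ?Q (coact M m) (\<lambda>(k, m0). q n (tens n m0 (front n ds h'' (lact C (k \<cdot> h1) c))))"
        apply (rule congM[OF coact_closed[OF m]])
         apply (simp add: h1)
        apply (assumption | rule rules h1 h'')+
        done
      finally show "lift ?Q (comult H h'') (\<lambda>(a, y). lift ?Q (comult H y) (\<lambda>(b, h3). ?G h1 a b h3)) =
          lift ?Q (coact M m) (\<lambda>(k, m0). q n (tens n m0 (front n ds h'' (lact C (k \<cdot> h1) c))))" .
    qed (assumption | rule rules)+
    also have "\<dots> = lift ?Q (coact M m) (\<lambda>(k, m0). lift ?Q (comult H h) (\<lambda>(h1, h'').
        q n (tens n m0 (front n ds h'' (lact C (k \<cdot> h1) c)))))"
      by (rule lift_tensor_swap[OF H.vs_C H.vs_C H.vs_C vs_M _ _ vs_Q]) (assumption | rule rules)+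
    also have "\<dots> = lift ?Q (coact M m) (\<lambda>(k, m0). q n (tens n m0 (rotate n k (diag_act H C n h (pure_power C cs)))))"
    proof (rule congM[OF coact_closed[OF m]])
      fix k m0 assume k: "k \<in> carrier H" and m0: "m0 \<in> carrier M"
      have qm: "linear_map (P n) ?Q (\<lambda>d. q n (tens n m0 d))" by (assumption | rule linear_rules m0)+
      show "lift ?Q (comult H h) (\<lambda>(h1, h''). q n (tens n m0 (front n ds h'' (lact C (k \<cdot> h1) c)))) =
          q n (tens n m0 (rotate n k (diag_act H C n h (pure_power C cs))))"
        unfolding cs' rotate_diag_act[OF ds h c k]
        by (rule lift_tensor_push[OF H.vs_C H.vs_C qm vs_P vs_Q, symmetric]) (assumption | rule rules k)+
    qed (assumption | rule rules cs)+
    also have "\<dots> = q n (tau n (tens n m (diag_act H C n h (pure_power C cs))))"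
      unfolding tau_tens[OF m diag_act_closed[OF h pure_power_closed[OF C.vs_C cs]]]
      by (rule lift_tensor_push[OF H.vs_C vs_M q_linear vs_X vs_Q, symmetric])
        (assumption | rule rules cs)+
    finally show "q n (tau n (tens n (ract M m h) (pure_power C cs))) =
        q n (tau n (tens n m (diag_act H C n h (pure_power C cs))))" .
  qed
qed

end

section \<open>The commutator subspace\<close>

context sayd
begin

abbreviation W where "W n \<equiv> W_space H C M n"
abbreviation V where "V n \<equiv> quot_space (X n) (W n)"
abbreviation w where "w n x \<equiv> W n +>\<^bsub>X n\<^esub> x"
abbreviation taup where "taup n i \<equiv> cochain_cyclic C M n ^^ i"

lemma taup_linear: "linear_map (X n) (X n) (taup n i)"
proof (induction i)
  case (Suc i)
  then show ?case using linear_map_compose[OF tau_linear Suc] by (simp add: comp_def)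
qed (simp add: linear_map_id id_def)

lemma taup_closed [closed_rules]: "x \<in> carrier (X n) \<Longrightarrow> taup n i x \<in> carrier (X n)"
  by (rule linear_map_closed[OF taup_linear])

lemma W_eq: "W n = lin_span (X n) {L n g (taup n i x) \<ominus>\<^bsub>X n\<^esub> taup n i (L n g x) | g i x.
    g \<in> carrier H \<and> 0 < i \<and> x \<in> carrier (X n)}"
  by (simp add: W_space_def)

lemma W_gens_carrier: "{L n g (taup n i x) \<ominus>\<^bsub>X n\<^esub> taup n i (L n g x) | g i x.
    g \<in> carrier H \<and> 0 < i \<and> x \<in> carrier (X n)} \<subseteq> carrier (X n)"
  by (auto intro!: vs_minus_closed L_closed taup_closed)

lemma submodule_W: "submodule (W n) cplx (X n)"
  unfolding W_eq by (rule submodule_lin_span[OF vs_X W_gens_carrier])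

lemmas vs_V [simp, closed_rules] = vs_quot_space[OF vs_X submodule_W]

lemma w_linear: "linear_map (X n) (V n) (w n)"
  by (rule linear_map_coset[OF vs_X submodule_W])

lemma w_closed [closed_rules]: "x \<in> carrier (X n) \<Longrightarrow> w n x \<in> carrier (V n)"
  by (rule linear_map_closed[OF w_linear])

lemma V_cases:
  assumes "v \<in> carrier (V n)"
  obtains x where "x \<in> carrier (X n)" "v = w n x"
  using assms carrier_quot_space[OF vs_X submodule_W] by auto

lemma W_subset: "x \<in> W n \<Longrightarrow> x \<in> carrier (X n)"
  using submodule_subset[OF vs_X submodule_W] by blast

lemma B_subset: "x \<in> B n \<Longrightarrow> x \<in> carrier (X n)"
  using submodule_subset[OF vs_X submodule_B] by blast

lemma w_L_taup:
  assumes "g \<in> carrier H" "x \<in> carrier (X n)"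
  shows "w n (L n g (taup n i x)) = w n (taup n i (L n g x))"
proof (cases "i = 0")
  case False
  then have "L n g (taup n i x) \<ominus>\<^bsub>X n\<^esub> taup n i (L n g x) \<in> W n"
    unfolding W_eq using assms by (intro subsetD[OF lin_span_superset]) blast
  then show ?thesis
    using assms by (subst coset_eq_iff[OF vs_X submodule_W]) (auto intro!: closed_rules)
qed simp

text \<open>
  \<open>W\<close> is spanned by differences, so a linear map sends it into \<open>U\<close> as soon as it identifies the two terms
  of each difference modulo \<open>U\<close>.
\<close>

lemma linear_map_W:
  assumes Z: "vspace Z" and U: "submodule U cplx Z" and f: "linear_map (X n) Z f"
    and eq: "\<And>g i x. g \<in> carrier H \<Longrightarrow> x \<in> carrier (X n) \<Longrightarrow>
      U +>\<^bsub>Z\<^esub> f (L n g (taup n i x)) = U +>\<^bsub>Z\<^esub> f (taup n i (L n g x))"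
    and x: "x \<in> W n"
  shows "f x \<in> U"
proof (rule linear_map_lin_span[OF vs_X Z f U W_gens_carrier _ x[unfolded W_eq]])
  fix y assume "y \<in> {L n g (taup n i x) \<ominus>\<^bsub>X n\<^esub> taup n i (L n g x) | g i x.
    g \<in> carrier H \<and> 0 < i \<and> x \<in> carrier (X n)}"
  then obtain g i z where y: "y = L n g (taup n i z) \<ominus>\<^bsub>X n\<^esub> taup n i (L n g z)"
    and g: "g \<in> carrier H" and z: "z \<in> carrier (X n)" by blast
  have c: "L n g (taup n i z) \<in> carrier (X n)" "taup n i (L n g z) \<in> carrier (X n)"
    using g z by (auto intro!: closed_rules)
  show "f y \<in> U"
    unfolding y linear_map_minus[OF vs_X Z f c]
    using eq[OF g z, of i] coset_eq_iff[OF Z U linear_map_closed[OF f c(1)] linear_map_closed[OF f c(2)]] by simp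
qed

lemma w_cong:
  assumes f: "linear_map (X n) (X n') f" "\<And>x. x \<in> W n \<Longrightarrow> f x \<in> W n'"
    and xy: "x \<in> carrier (X n)" "y \<in> carrier (X n)" "w n x = w n y"
  shows "w n' (f x) = w n' (f y)"
proof -
  have "x \<ominus>\<^bsub>X n\<^esub> y \<in> W n" using coset_eq_iff[OF vs_X submodule_W xy(1,2)] xy(3) by simp
  then have "f x \<ominus>\<^bsub>X n'\<^esub> f y \<in> W n'" using f(2) linear_map_minus[OF vs_X vs_X f(1) xy(1,2)] by metis
  then show ?thesis
    using coset_eq_iff[OF vs_X submodule_W linear_map_closed[OF f(1) xy(1)] linear_map_closed[OF f(1) xy(2)]] by simp
qed

lemma L_W: "h \<in> carrier H \<Longrightarrow> x \<in> W n \<Longrightarrow> L n h x \<in> W n"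
proof (rule linear_map_W[OF vs_X submodule_W L_linear])
  fix g i x assume h: "h \<in> carrier H" and g: "g \<in> carrier H" and x: "x \<in> carrier (X n)"
  have "w n (L n h (L n g (taup n i x))) = w n (L n (h \<cdot> g) (taup n i x))"
    using L_mult[OF h g taup_closed[OF x]] by simp
  also have "\<dots> = w n (taup n i (L n (h \<cdot> g) x))" by (rule w_L_taup) (simp_all add: h g x)
  also have "\<dots> = w n (taup n i (L n h (L n g x)))" by (simp add: L_mult[OF h g x])
  also have "\<dots> = w n (L n h (taup n i (L n g x)))" by (rule w_L_taup[symmetric, OF h L_closed[OF g x]])
  finally show "w n (L n h (L n g (taup n i x))) = w n (L n h (taup n i (L n g x)))" .
qed

lemma tau_W: "x \<in> W n \<Longrightarrow> tau n x \<in> W n"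
proof (rule linear_map_W[OF vs_X submodule_W tau_linear])
  fix g i x assume g: "g \<in> carrier H" and x: "x \<in> carrier (X n)"
  have "w n (L n g (taup n 1 (taup n i x))) = w n (taup n 1 (L n g (taup n i x)))"
    by (rule w_L_taup[OF g taup_closed[OF x]])
  moreover have "w n (L n g (taup n (Suc i) x)) = w n (taup n (Suc i) (L n g x))"
    by (rule w_L_taup[OF g x])
  ultimately show "w n (tau n (L n g (taup n i x))) = w n (tau n (taup n i (L n g x)))" by simp
qed

text \<open>
  Moving a coface to the right of a power of \<open>\<tau>\<close> changes the index of the coface and the exponent.  Their
  values depend on \<open>i\<close> and \<open>j\<close> in a complicated way, but only their existence matters.
\<close>

lemma coface_taup:
  "j \<le> n \<Longrightarrow> \<exists>i' j'. j' \<le> n \<and> (\<forall>x\<in>carrier (X n).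
     tmap (Suc n) (comult_at n j) (taup n i x) = taup (Suc n) i' (tmap (Suc n) (comult_at n j') x))"
proof (induction i arbitrary: j)
  case 0
  then show ?case by (intro exI[of _ 0] exI[of _ j]) simp
next
  case (Suc i)
  show ?case
  proof (cases "j < n")
    case True
    then have "Suc j \<le> n" by simp
    from Suc.IH[OF this] obtain i' j' where "j' \<le> n"
      and "\<forall>x\<in>carrier (X n). tmap (Suc n) (comult_at n (Suc j)) (taup n i x) =
        taup (Suc n) i' (tmap (Suc n) (comult_at n j') x)" by blast
    then show ?thesis
      using coface_tau[OF True taup_closed] by (intro exI[of _ "Suc i'"] exI[of _ j']) simp
  next
    case False
    then have j: "j = n" using Suc.prems by simp
    from Suc.IH[of 0] obtain i' j' where "j' \<le> n"
      and "\<forall>x\<in>carrier (X n). tmap (Suc n) (comult_at n 0) (taup n i x) =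
        taup (Suc n) i' (tmap (Suc n) (comult_at n j') x)" by blast
    then show ?thesis
      using coface_tau_last[OF taup_closed] j by (intro exI[of _ "Suc (Suc i')"] exI[of _ j']) simp
  qed
qed

text \<open>
  The map \<open>counit_at n 0\<close> belongs to no codegeneracy.  It has to be included because it is what is left when
  the counit meets a factor that \<open>\<tau>\<close> has just moved to the end.
\<close>

lemma codegen_taup:
  "j \<le> Suc n \<Longrightarrow> \<exists>i' j'. j' \<le> Suc n \<and> (\<forall>x\<in>carrier (X (Suc n)).
     tmap n (counit_at n j) (taup (Suc n) i x) = taup n i' (tmap n (counit_at n j') x))"
proof (induction i arbitrary: j)
  case 0
  then show ?case by (intro exI[of _ 0] exI[of _ j]) simp
next
  case (Suc i)
  show ?case
  proof (cases "j \<le> n")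
    case True
    then have "Suc j \<le> Suc n" by simp
    from Suc.IH[OF this] obtain i' j' where "j' \<le> Suc n"
      and "\<forall>x\<in>carrier (X (Suc n)). tmap n (counit_at n (Suc j)) (taup (Suc n) i x) =
        taup n i' (tmap n (counit_at n j') x)" by blast
    then show ?thesis
      using codegen_tau[OF True taup_closed] by (intro exI[of _ "Suc i'"] exI[of _ j']) simp
  next
    case False
    then have j: "j = Suc n" using Suc.prems by simp
    from Suc.IH[of 0] obtain i' j' where "j' \<le> Suc n"
      and "\<forall>x\<in>carrier (X (Suc n)). tmap n (counit_at n 0) (taup (Suc n) i x) =
        taup n i' (tmap n (counit_at n j') x)" by blast
    then show ?thesis
      using codegen_tau_last[OF taup_closed] j by (intro exI[of _ i'] exI[of _ j']) simp
  qed
qed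

text \<open>
  If \<open>f \<tau>\<^sup>i = \<tau>\<^sup>j f'\<close>, where \<open>f\<close> and \<open>f'\<close> both commute with \<open>L\<^sub>g\<close>, then \<open>f [L\<^sub>g, \<tau>\<^sup>i] = [L\<^sub>g, \<tau>\<^sup>j] f'\<close>.
\<close>

lemma tmap_W:
  assumes f: "equivariant n n' f"
    and moves: "\<And>i. \<exists>i' f'. equivariant n n' f' \<and>
      (\<forall>x\<in>carrier (X n). tmap n' f (taup n i x) = taup n' i' (tmap n' f' x))"
    and x: "x \<in> W n"
  shows "tmap n' f x \<in> W n'"
proof (rule linear_map_W[OF vs_X submodule_W _ _ x])
  show "linear_map (X n) (X n') (tmap n' f)" using f by (simp add: equivariant_def tmap_linear)
  fix g i x assume g: "g \<in> carrier H" and x: "x \<in> carrier (X n)"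
  obtain i' f' where f': "equivariant n n' f'"
    and e: "\<And>x. x \<in> carrier (X n) \<Longrightarrow> tmap n' f (taup n i x) = taup n' i' (tmap n' f' x)"
    using moves[of i] by blast
  have "linear_map (P n) (P n') f'" using f' by (simp add: equivariant_def)
  then have "tmap n' f' x \<in> carrier (X n')" using x by (rule tmap_closed)
  then show "w n' (tmap n' f (L n g (taup n i x))) = w n' (tmap n' f (taup n i (L n g x)))"
    using w_L_taup[OF g, of "tmap n' f' x" n' i']
    by (simp add: tmap_L[OF f g taup_closed[OF x]] e[OF x] e[OF L_closed[OF g x]] tmap_L[OF f' g x])
qed

lemma tau_B:
  assumes "x \<in> B n"
  shows "tau n x \<in> B n"
  using balanced_zero[OF vs_Q linear_map_compose[OF q_linear tau_linear] tau_balanced assms]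
    coset_zero_iff[OF vs_X submodule_B tau_closed[OF B_subset[OF assms]]] by blast

lemma tmap_B:
  assumes f: "equivariant n n' f" and x: "x \<in> B n"
  shows "tmap n' f x \<in> B n'"
proof -
  have lin: "linear_map (P n) (P n') f" using f by (simp add: equivariant_def)
  have "balanced n (\<lambda>x. q n' (tmap n' f x))"
    unfolding balanced_def using f
    by (simp add: equivariant_def tmap_tens ract_closed diag_act_closed balancedD[OF balanced_q] linear_map_closed[OF lin])
  from balanced_zero[OF vs_Q linear_map_compose[OF q_linear tmap_linear[OF lin]] this x]
  show ?thesis
    using coset_zero_iff[OF vs_X submodule_B tmap_closed[OF lin B_subset[OF x]]] by blast
qed

lemma q_L: "g \<in> carrier H \<Longrightarrow> x \<in> carrier (X n) \<Longrightarrow> q n (L n g x) = counit H g \<odot>\<^bsub>Q n\<^esub> q n x"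
  by (rule balanced_imp_L_invariant[OF vs_Q q_linear balanced_q])

text \<open>
  As \<open>\<tau>\<close> preserves \<open>B\<close>, the map that sends \<open>x\<close> to the class of \<open>\<tau>\<^sup>i x\<close> is balanced, hence invariant under \<open>L\<close>.  So both terms
  of a commutator become \<open>\<epsilon>(g) \<tau>\<^sup>i x\<close> modulo \<open>B\<close>.
\<close>

lemma W_subset_B: "x \<in> W n \<Longrightarrow> x \<in> B n"
proof (rule linear_map_W[OF vs_X submodule_B linear_map_id])
  fix g i x assume g: "g \<in> carrier H" and x: "x \<in> carrier (X n)"
  have taup_B: "taup n i y \<in> B n" if "y \<in> B n" for y
    using that by (induction i) (auto intro: tau_B)
  have lin: "linear_map (X n) (Q n) (\<lambda>x. q n (taup n i x))" by (rule linear_map_compose[OF q_linear taup_linear])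
  have "balanced n (\<lambda>x. q n (taup n i x))"
    by (rule balanced_if_zero[OF lin vs_Q])
      (simp add: coset_zero_iff[OF vs_X submodule_B] taup_closed[OF B_subset] taup_B)
  from balanced_imp_L_invariant[OF vs_Q lin this g x]
  show "q n (L n g (taup n i x)) = q n (taup n i (L n g x))"
    using q_L[OF g taup_closed[OF x]] by simp
qed

section \<open>The comparison map\<close>

abbreviation act where "act n \<equiv> PCM_act H C M n"
abbreviation T where "T n \<equiv> tensor cplx (V n)"
abbreviation A where "A n \<equiv> balancing H cplx (trivial_act H) (V n) (act n)"
abbreviation CMn where "CMn n \<equiv> quot_space (T n) (A n)"

lemma act_w: "g \<in> carrier H \<Longrightarrow> x \<in> carrier (X n) \<Longrightarrow> act n g (w n x) = w n (L n g x)"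
  unfolding PCM_act_def by (rule induced_coset[OF vs_X submodule_W vs_X submodule_W L_linear L_W])

lemma act_closed: "g \<in> carrier H \<Longrightarrow> v \<in> carrier (V n) \<Longrightarrow> act n g v \<in> carrier (V n)"
  by (erule V_cases) (simp add: act_w w_closed L_closed)

lemmas vs_T [simp] = vs_tensor[OF vs_cplx vs_V]

lemma A_gens_carrier: "{pure_tensor cplx (V n) (trivial_act H a h) v \<ominus>\<^bsub>T n\<^esub> pure_tensor cplx (V n) a (act n h v) | a h v.
    a \<in> carrier cplx \<and> h \<in> carrier H \<and> v \<in> carrier (V n)} \<subseteq> carrier (T n)"
  using act_closed by (auto intro!: vs_minus_closed pure_tensor_closed vs_cplx)

lemma submodule_A: "submodule (A n) cplx (T n)"
  unfolding balancing_def by (rule submodule_lin_span[OF vs_T A_gens_carrier])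

lemmas vs_CMn [simp] = vs_quot_space[OF vs_T submodule_A]

text \<open>
  The elements of \<open>X / W\<close> in the generators of \<open>A\<close> may be represented by cochains, on which the action of \<open>H\<close>
  is \<open>L\<close>.
\<close>

lemma A_lin_map:
  assumes Z: "vspace Z" and f: "linear_map (T n) Z f" and U: "submodule U cplx Z"
    and gen: "\<And>a h x. h \<in> carrier H \<Longrightarrow> x \<in> carrier (X n) \<Longrightarrow>
      U +>\<^bsub>Z\<^esub> f (pure_tensor cplx (V n) (a * counit H h) (w n x)) = U +>\<^bsub>Z\<^esub> f (pure_tensor cplx (V n) a (w n (L n h x)))"
    and t: "t \<in> A n"
  shows "f t \<in> U"
proof (rule linear_map_lin_span[OF vs_T Z f U A_gens_carrier _ t[unfolded balancing_def]])
  fix y assume "y \<in> {pure_tensor cplx (V n) (trivial_act H a h) v \<ominus>\<^bsub>T n\<^esub> pure_tensor cplx (V n) a (act n h v) | a h v.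
    a \<in> carrier cplx \<and> h \<in> carrier H \<and> v \<in> carrier (V n)}"
  then obtain a h x where h: "h \<in> carrier H" and x: "x \<in> carrier (X n)"
    and y: "y = pure_tensor cplx (V n) (a * counit H h) (w n x) \<ominus>\<^bsub>T n\<^esub> pure_tensor cplx (V n) a (w n (L n h x))"
    by (auto elim!: V_cases simp: act_w trivial_act_def)
  have c: "pure_tensor cplx (V n) (a * counit H h) (w n x) \<in> carrier (T n)"
    "pure_tensor cplx (V n) a (w n (L n h x)) \<in> carrier (T n)"
    using h x by (auto intro!: pure_tensor_closed vs_cplx vs_V w_closed L_closed)
  show "f y \<in> U"
    unfolding y linear_map_minus[OF vs_T Z f c]
    using gen[OF h x, of a] coset_eq_iff[OF Z U linear_map_closed[OF f c(1)] linear_map_closed[OF f c(2)]] by simp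
qed

lemma coset_A_gen:
  assumes "h \<in> carrier H" "x \<in> carrier (X n)"
  shows "A n +>\<^bsub>T n\<^esub> pure_tensor cplx (V n) (a * counit H h) (w n x) = A n +>\<^bsub>T n\<^esub> pure_tensor cplx (V n) a (w n (L n h x))"
proof -
  have c: "pure_tensor cplx (V n) (a * counit H h) (w n x) \<in> carrier (T n)"
    "pure_tensor cplx (V n) a (w n (L n h x)) \<in> carrier (T n)"
    using assms by (auto intro!: pure_tensor_closed vs_cplx vs_V w_closed L_closed)
  have "pure_tensor cplx (V n) (trivial_act H a h) (w n x) \<ominus>\<^bsub>T n\<^esub> pure_tensor cplx (V n) a (act n h (w n x)) \<in> A n"
    unfolding balancing_def using assms w_closed by (intro subsetD[OF lin_span_superset]) force
  then show ?thesis
    using coset_eq_iff[OF vs_T submodule_A c] assms by (simp add: act_w trivial_act_def)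
qed

text \<open>
  The class of a cochain in \<open>\<complex> \<otimes>\<^sub>H PCM\<close>.  It is onto with kernel \<open>B\<close>, and this presents \<open>\<complex> \<otimes>\<^sub>H PCM\<close> as
  \<open>X / B\<close>.
\<close>

definition cls where "cls n x = A n +>\<^bsub>T n\<^esub> pure_tensor cplx (V n) 1 (w n x)"

lemma cls_linear: "linear_map (X n) (CMn n) (cls n)"
  unfolding cls_def
  by (rule linear_map_compose[OF linear_map_coset[OF vs_T submodule_A]
        linear_map_pure_tensor_right[OF w_linear _ vs_cplx vs_V]]) simp

lemma cls_closed: "x \<in> carrier (X n) \<Longrightarrow> cls n x \<in> carrier (CMn n)"
  by (rule linear_map_closed[OF cls_linear])

lemma T_pure:
  assumes "t \<in> carrier (T n)"
  obtains x where "x \<in> carrier (X n)" "t = pure_tensor cplx (V n) 1 (w n x)"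
proof -
  let ?s = "\<lambda>t. lift (V n) t (\<lambda>(a, v). a \<odot>\<^bsub>V n\<^esub> v)"
  have b: "bilin cplx (V n) (V n) (\<lambda>a v. a \<odot>\<^bsub>V n\<^esub> v)"
    by (intro bilinI linear_map_smult_left linear_map_scale linear_map_id vs_V)
  have s: "linear_map (T n) (V n) ?s" by (rule linear_map_lift_tensor[OF vs_cplx vs_V vs_V b])
  have "pure_tensor cplx (V n) 1 (?s t) = t"
  proof (rule tensor_ext[OF vs_cplx vs_V vs_T linear_map_pure_tensor_right[OF s _ vs_cplx vs_V] linear_map_id _ assms])
    fix a v assume a: "a \<in> carrier cplx" and v: "v \<in> carrier (V n)"
    note pb = bilin_pure_tensor[OF vs_cplx vs_V[of n]]
    have "pure_tensor cplx (V n) 1 (a \<odot>\<^bsub>V n\<^esub> v) = pure_tensor cplx (V n) (a \<odot>\<^bsub>cplx\<^esub> 1) v"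
      using linear_map_smult[OF bilin_right[OF pb] v, of 1 a] linear_map_smult[OF bilin_left[OF pb v], of 1 a] by simp
    then show "pure_tensor cplx (V n) 1 (?s (pure_tensor cplx (V n) a v)) = pure_tensor cplx (V n) a v"
      using lift_pure_tensor[OF vs_cplx vs_V vs_V b a v] by simp
  qed simp
  moreover obtain x where "x \<in> carrier (X n)" "?s t = w n x"
    using linear_map_closed[OF s assms] by (rule V_cases)
  ultimately show ?thesis using that by metis
qed

lemma CMn_cases:
  assumes "Y \<in> carrier (CMn n)"
  obtains x where "x \<in> carrier (X n)" "Y = cls n x"
proof -
  obtain t where t: "t \<in> carrier (T n)" "Y = A n +>\<^bsub>T n\<^esub> t"
    using assms unfolding carrier_quot_space[OF vs_T submodule_A] by (rule imageE) (rule that)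
  obtain x where "x \<in> carrier (X n)" "t = pure_tensor cplx (V n) 1 (w n x)" using t(1) by (rule T_pure)
  then show ?thesis using t(2) that by (simp add: cls_def)
qed

text \<open>
  The map \<open>cls\<close> is invariant under \<open>L\<close>, hence balanced, and so it vanishes on \<open>B\<close>.  Conversely, the
  projection to \<open>X / B\<close> factors through \<open>\<complex> \<otimes>\<^sub>H PCM\<close>, because it vanishes on \<open>W\<close> and is invariant under
  \<open>L\<close>; the factor is \<open>?k\<close> below.
\<close>

lemma cls_zero_iff:
  assumes x: "x \<in> carrier (X n)"
  shows "cls n x = \<zero>\<^bsub>CMn n\<^esub> \<longleftrightarrow> x \<in> B n"
proof
  assume "x \<in> B n"
  have "cls n (L n g y) = counit H g \<odot>\<^bsub>CMn n\<^esub> cls n y" if g: "g \<in> carrier H" and y: "y \<in> carrier (X n)" for g y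
  proof -
    note pb = bilin_pure_tensor[OF vs_cplx vs_V[of n]]
    have one: "pure_tensor cplx (V n) 1 (w n y) \<in> carrier (T n)"
      by (rule pure_tensor_closed[OF vs_cplx vs_V _ w_closed[OF y]]) simp
    have "cls n (L n g y) = A n +>\<^bsub>T n\<^esub> pure_tensor cplx (V n) (counit H g \<odot>\<^bsub>cplx\<^esub> 1) (w n y)"
      unfolding cls_def using coset_A_gen[OF g y, of 1] by simp
    also have "\<dots> = A n +>\<^bsub>T n\<^esub> (counit H g \<odot>\<^bsub>T n\<^esub> pure_tensor cplx (V n) 1 (w n y))"
      using linear_map_smult[OF bilin_left[OF pb w_closed[OF y]], of 1 "counit H g"] by simp
    also have "\<dots> = counit H g \<odot>\<^bsub>CMn n\<^esub> cls n y"
      unfolding cls_def by (rule smult_quot_space[OF vs_T submodule_A one, symmetric])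
    finally show ?thesis .
  qed
  then have "balanced n (cls n)" by (rule L_invariant_imp_balanced[OF vs_CMn cls_linear])
  then show "cls n x = \<zero>\<^bsub>CMn n\<^esub>" using \<open>x \<in> B n\<close> by (rule balanced_zero[OF vs_CMn cls_linear])
next
  assume zero: "cls n x = \<zero>\<^bsub>CMn n\<^esub>"
  define i where "i = induced (X n) (B n) (\<lambda>x. x)"
  have i: "linear_map (V n) (Q n) i"
    unfolding i_def by (rule linear_map_induced[OF vs_X submodule_W vs_X submodule_B linear_map_id W_subset_B])
  have iw: "i (w n x) = q n x" if "x \<in> carrier (X n)" for x
    unfolding i_def by (rule induced_coset[OF vs_X submodule_W vs_X submodule_B linear_map_id W_subset_B that])
  let ?f = "\<lambda>a v. a \<odot>\<^bsub>Q n\<^esub> i v"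
  have b: "bilin cplx (V n) (Q n) ?f"
    by (rule bilinI; rule linear_map_smult_left[OF vs_Q linear_map_id] linear_map_scale[OF vs_Q i])
      (rule linear_map_closed[OF i])
  let ?k = "\<lambda>t. lift (Q n) t (case_prod ?f)"
  have k: "linear_map (T n) (Q n) ?k" by (rule linear_map_lift_tensor[OF vs_cplx vs_V vs_Q b])
  have kp: "?k (pure_tensor cplx (V n) a (w n x)) = a \<odot>\<^bsub>Q n\<^esub> q n x" if "x \<in> carrier (X n)" for a x
    using lift_pure_tensor[OF vs_cplx vs_V vs_Q b _ w_closed[OF that], of a] by (simp add: iw that)
  have one: "pure_tensor cplx (V n) 1 (w n x) \<in> carrier (T n)"
    by (rule pure_tensor_closed[OF vs_cplx vs_V _ w_closed[OF x]]) simp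
  have "pure_tensor cplx (V n) 1 (w n x) \<in> A n"
    using zero coset_zero_iff[OF vs_T submodule_A one] by (simp add: cls_def)
  then have "?k (pure_tensor cplx (V n) 1 (w n x)) \<in> {\<zero>\<^bsub>Q n\<^esub>}"
  proof (rule A_lin_map[OF vs_Q k submodule_zero_space[OF vs_Q], rotated])
    fix a h x assume h: "h \<in> carrier H" and x: "x \<in> carrier (X n)"
    have "?k (pure_tensor cplx (V n) (a * counit H h) (w n x)) = ?k (pure_tensor cplx (V n) a (w n (L n h x)))"
      using h x by (simp add: kp L_closed q_L vs_smult_smult[OF vs_Q] q_closed)
    then show "{\<zero>\<^bsub>Q n\<^esub>} +>\<^bsub>Q n\<^esub> ?k (pure_tensor cplx (V n) (a * counit H h) (w n x)) =
        {\<zero>\<^bsub>Q n\<^esub>} +>\<^bsub>Q n\<^esub> ?k (pure_tensor cplx (V n) a (w n (L n h x)))" by simp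
  qed
  then have "q n x = \<zero>\<^bsub>Q n\<^esub>" using x by (simp add: kp vs_smult_one[OF vs_Q] q_closed)
  then show "x \<in> B n" using coset_zero_iff[OF vs_X submodule_B x] by simp
qed

text \<open>
  The conditions under which an operator on cochains induces operators on \<open>X / B\<close> and on
  \<open>\<complex> \<otimes>\<^sub>H (X / W)\<close>.  The comparison map intertwines the two, since both are computed on the same
  representatives.
\<close>

definition descends where
  "descends n n' f \<longleftrightarrow> linear_map (X n) (X n') f \<and> (\<forall>x\<in>W n. f x \<in> W n') \<and> (\<forall>x\<in>B n. f x \<in> B n') \<and>
     (\<forall>h\<in>carrier H. \<forall>x\<in>carrier (X n). w n' (f (L n h x)) = w n' (L n' h (f x)))"

lemma descends_tmap:
  assumes f: "equivariant n n' f"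
    and moves: "\<And>i. \<exists>i' f'. equivariant n n' f' \<and>
      (\<forall>x\<in>carrier (X n). tmap n' f (taup n i x) = taup n' i' (tmap n' f' x))"
  shows "descends n n' (tmap n' f)"
  unfolding descends_def
  using tmap_W[OF f moves] tmap_B[OF f] tmap_L[OF f] tmap_linear f by (simp add: equivariant_def)

lemma descends_comult_at:
  assumes "i \<le> n"
  shows "descends n (Suc n) (tmap (Suc n) (comult_at n i))"
proof (rule descends_tmap[OF equivariant_comult_at[OF assms]])
  show "\<exists>i' f'. equivariant n (Suc n) f' \<and> (\<forall>x\<in>carrier (X n).
      tmap (Suc n) (comult_at n i) (taup n j x) = taup (Suc n) i' (tmap (Suc n) f' x))" for j
    using coface_taup[OF assms, of j] equivariant_comult_at by blast
qed

lemma descends_counit_at: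
  assumes "i \<le> Suc n"
  shows "descends (Suc n) n (tmap n (counit_at n i))"
proof (rule descends_tmap[OF equivariant_counit_at[OF assms]])
  show "\<exists>i' f'. equivariant (Suc n) n f' \<and> (\<forall>x\<in>carrier (X (Suc n)).
      tmap n (counit_at n i) (taup (Suc n) j x) = taup n i' (tmap n f' x))" for j
    using codegen_taup[OF assms, of j] equivariant_counit_at by blast
qed

lemma descends_tau: "descends n n (tau n)"
  using w_L_taup[of _ _ n 1] by (simp add: descends_def tau_linear tau_W tau_B)

lemma descends_compose:
  assumes f: "descends n n' f" and g: "descends n' n'' g"
  shows "descends n n'' (\<lambda>x. g (f x))"
proof -
  have f_lin: "linear_map (X n) (X n') f" and g_lin: "linear_map (X n') (X n'') g"
    using f g by (auto simp: descends_def)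
  have "w n'' (g (f (L n h x))) = w n'' (L n'' h (g (f x)))" if h: "h \<in> carrier H" and x: "x \<in> carrier (X n)" for h x
  proof -
    have fx: "f x \<in> carrier (X n')" by (rule linear_map_closed[OF f_lin x])
    have "w n'' (g (f (L n h x))) = w n'' (g (L n' h (f x)))"
      using f g h x fx by (intro w_cong[OF g_lin]) (auto simp: descends_def L_closed linear_map_closed[OF f_lin])
    then show ?thesis using g h fx by (simp add: descends_def)
  qed
  then show ?thesis
    using f g linear_map_compose[OF g_lin f_lin] by (auto simp: descends_def)
qed

lemma descends_cong:
  assumes "descends n n' f" "\<And>x. x \<in> carrier (X n) \<Longrightarrow> g x = f x"
  shows "descends n n' g"
  using assms linear_map_cong[of "X n" "X n'" f g]
  by (auto simp: descends_def W_subset B_subset L_closed)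

lemma induced_q:
  assumes "descends n n' f" "x \<in> carrier (X n)"
  shows "induced (X n') (B n') f (q n x) = q n' (f x)"
  using assms by (intro induced_coset[OF vs_X submodule_B vs_X submodule_B]) (auto simp: descends_def)

lemma CM_induced_cls:
  assumes f: "descends n n' f" and x: "x \<in> carrier (X n)"
    and V': "component (PCM H C M) n' = V n'"
  shows "CM_induced H C M n' (induced (X n') (W n') f) (cls n x) = cls n' (f x)"
proof -
  have f_lin: "linear_map (X n) (X n') f" and f_W: "\<And>x. x \<in> W n \<Longrightarrow> f x \<in> W n'"
    using f by (auto simp: descends_def)
  let ?i = "induced (X n') (W n') f"
  have i: "linear_map (V n) (V n') ?i"
    by (rule linear_map_induced[OF vs_X submodule_W vs_X submodule_W f_lin f_W])
  have iw: "?i (w n x) = w n' (f x)" if "x \<in> carrier (X n)" for x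
    by (rule induced_coset[OF vs_X submodule_W vs_X submodule_W f_lin f_W that])
  let ?g = "\<lambda>a v. pure_tensor cplx (V n') a (?i v)"
  have b: "bilin cplx (V n) (T n') ?g"
    by (rule bilinI; rule linear_map_pure_tensor_left[OF linear_map_id _ vs_cplx vs_V]
          linear_map_pure_tensor_right[OF i _ vs_cplx vs_V]) (rule linear_map_closed[OF i])
  let ?k = "\<lambda>t. lift (T n') t (case_prod ?g)"
  have k: "linear_map (T n) (T n') ?k" by (rule linear_map_lift_tensor[OF vs_cplx vs_V vs_T b])
  have kp: "?k (pure_tensor cplx (V n) a (w n x)) = pure_tensor cplx (V n') a (w n' (f x))" if "x \<in> carrier (X n)" for a x
    using lift_pure_tensor[OF vs_cplx vs_V vs_T b _ w_closed[OF that], of a] by (simp add: iw that)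
  have one: "pure_tensor cplx (V n) 1 (w n x) \<in> carrier (T n)"
    by (rule pure_tensor_closed[OF vs_cplx vs_V _ w_closed[OF x]]) simp
  have kA: "?k t \<in> A n'" if "t \<in> A n" for t
  proof (rule A_lin_map[OF vs_T k submodule_A _ that])
    fix a h x assume h: "h \<in> carrier H" and x: "x \<in> carrier (X n)"
    have "w n' (f (L n h x)) = w n' (L n' h (f x))" using f h x by (simp add: descends_def)
    then show "A n' +>\<^bsub>T n'\<^esub> ?k (pure_tensor cplx (V n) (a * counit H h) (w n x)) =
        A n' +>\<^bsub>T n'\<^esub> ?k (pure_tensor cplx (V n) a (w n (L n h x)))"
      using coset_A_gen[OF h linear_map_closed[OF f_lin x], of a] by (simp add: kp x L_closed h)
  qed
  show ?thesis
    unfolding CM_induced_def V' cls_def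
    using induced_coset[OF vs_T submodule_A vs_T submodule_A k kA one] kp[OF x, of 1] by simp
qed

text \<open>
  As \<open>B\<close> is the kernel of \<open>cls\<close>, the fibres of \<open>cls\<close> are the cosets of \<open>B\<close>, that is, the elements of \<open>X / B\<close>.
\<close>

definition comparison :: "nat \<Rightarrow> (complex \<times> ('m, 'c) cochain set \<Rightarrow> complex) set set \<Rightarrow> ('m, 'c) cochain set" where
  "comparison n Y = {x \<in> carrier (X n). cls n x = Y}"

lemma cls_eq_iff:
  assumes "x \<in> carrier (X n)" "y \<in> carrier (X n)"
  shows "cls n x = cls n y \<longleftrightarrow> x \<ominus>\<^bsub>X n\<^esub> y \<in> B n"
  using cls_zero_iff[OF vs_minus_closed[OF vs_X assms]] linear_map_minus[OF vs_X vs_CMn cls_linear assms]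
    vs_minus_zero_iff[OF vs_CMn cls_closed[OF assms(1)] cls_closed[OF assms(2)]] by simp

lemma comparison_cls:
  assumes "x \<in> carrier (X n)"
  shows "comparison n (cls n x) = q n x"
  using assms coset_mem_iff[OF vs_X submodule_B assms] cls_eq_iff[OF _ assms] by (auto simp: comparison_def)

lemma comparison_linear: "linear_map (CMn n) (Q n) (comparison n)"
proof (rule linear_mapI)
  fix Y assume "Y \<in> carrier (CMn n)"
  then obtain x where x: "x \<in> carrier (X n)" "Y = cls n x" by (rule CMn_cases)
  show "comparison n Y \<in> carrier (Q n)" by (simp add: x comparison_cls q_closed)
  show "comparison n (a \<odot>\<^bsub>CMn n\<^esub> Y) = a \<odot>\<^bsub>Q n\<^esub> comparison n Y" for a
    using comparison_cls[OF vs_smult_closed[OF vs_X x(1)], of a]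
    by (simp add: x comparison_cls linear_map_smult[OF cls_linear] linear_map_smult[OF q_linear])
  fix Y' assume "Y' \<in> carrier (CMn n)"
  then obtain y where y: "y \<in> carrier (X n)" "Y' = cls n y" by (rule CMn_cases)
  show "comparison n (Y \<oplus>\<^bsub>CMn n\<^esub> Y') = comparison n Y \<oplus>\<^bsub>Q n\<^esub> comparison n Y'"
    using comparison_cls[OF vs_add_closed[OF vs_X x(1) y(1)]]
    by (simp add: x y comparison_cls linear_map_add[OF cls_linear] linear_map_add[OF q_linear])
qed

lemma comparison_bij: "bij_betw (comparison n) (carrier (CMn n)) (carrier (Q n))"
  unfolding bij_betw_def
proof (intro conjI inj_onI)
  fix Y Y' assume Y: "Y \<in> carrier (CMn n)" "Y' \<in> carrier (CMn n)" and eq: "comparison n Y = comparison n Y'"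
  obtain x where x: "x \<in> carrier (X n)" "Y = cls n x" using Y(1) by (rule CMn_cases)
  then have "x \<in> comparison n Y'" using eq by (auto simp: comparison_def)
  then show "Y = Y'" using x by (simp add: comparison_def)
next
  show "comparison n ` carrier (CMn n) = carrier (Q n)"
  proof
    show "comparison n ` carrier (CMn n) \<subseteq> carrier (Q n)" using linear_map_closed[OF comparison_linear] by blast
    show "carrier (Q n) \<subseteq> comparison n ` carrier (CMn n)"
      unfolding carrier_quot_space[OF vs_X submodule_B]
    proof safe
      fix x assume x: "x \<in> carrier (X n)"
      then show "q n x \<in> comparison n ` carrier (CMn n)"
        by (intro image_eqI[of _ _ "cls n x"]) (simp_all add: comparison_cls cls_closed)
    qed
  qed
qed

lemma comparison_CM_induced:
  assumes f: "descends n n' f" and Y: "Y \<in> carrier (CMn n)" and V': "component (PCM H C M) n' = V n'"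
  shows "comparison n' (CM_induced H C M n' (induced (X n') (W n') f) Y) = induced (X n') (B n') f (comparison n Y)"
proof -
  obtain x where x: "x \<in> carrier (X n)" "Y = cls n x" using Y by (rule CMn_cases)
  have "f x \<in> carrier (X n')" using f x linear_map_closed[of "X n" "X n'" f x] by (simp add: descends_def)
  then show ?thesis by (simp add: x CM_induced_cls[OF f x(1) V'] comparison_cls induced_q[OF f x(1)])
qed

lemma descends_coface: "i \<le> Suc n \<Longrightarrow> descends n (Suc n) (cochain_coface C M n i)"
proof (cases "i \<le> n")
  case True
  then show ?thesis by (rule descends_cong[OF descends_comult_at coface_eq[OF True]])
next
  case False
  assume "i \<le> Suc n"
  then have i: "i = Suc n" using False by simp
  show ?thesis
    unfolding i by (rule descends_cong[OF descends_compose[OF descends_comult_at[OF le0] descends_tau] coface_last_eq])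
qed

lemma descends_codegeneracy: "i < n \<Longrightarrow> descends n (n - 1) (cochain_codegeneracy C M n i)"
proof (cases n)
  case (Suc k)
  assume "i < n"
  then have i: "i < Suc k" "Suc i \<le> Suc k" using Suc by simp_all
  show ?thesis
    unfolding Suc diff_Suc_1 by (rule descends_cong[OF descends_counit_at[OF i(2)] codegeneracy_eq[OF i(1)]])
qed simp

lemma component_PCM: "component (PCM H C M) n = V n"
  by (simp add: PCM_def)

lemma component_CM: "component (CM H C M) n = CMn n"
  by (simp add: CM_def tensor_over_def component_PCM)

lemma component_CH: "component (CH H C M) n = Q n"
  by (simp add: CH_def tensor_over_def CH_relations_def cochains_def)

theorem cocyclic_iso_comparison: "cocyclic_iso (CM H C M) (CH H C M) comparison"
  unfolding cocyclic_iso_def component_CM component_CH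
proof (intro conjI allI impI ballI)
  fix n Y assume Y: "Y \<in> carrier (CMn n)"
  show "comparison n (cyclic_op (CM H C M) n Y) = cyclic_op (CH H C M) n (comparison n Y)"
    using comparison_CM_induced[OF descends_tau Y component_PCM] by (simp add: CM_def CH_def PCM_def)
  show "comparison (Suc n) (coface (CM H C M) n i Y) = coface (CH H C M) n i (comparison n Y)" if "i \<le> Suc n" for i
    using comparison_CM_induced[OF descends_coface[OF that] Y component_PCM] by (simp add: CM_def CH_def PCM_def)
  show "comparison (n - 1) (codegeneracy (CM H C M) n i Y) = codegeneracy (CH H C M) n i (comparison n Y)" if "i < n" for i
    using comparison_CM_induced[OF descends_codegeneracy[OF that] Y component_PCM] by (simp add: CM_def CH_def PCM_def)
qed (rule comparison_linear comparison_bij)+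

end

theorem proposition2p14:
  fixes H :: "'h hopf_algebra"
    and C :: "('h, 'c) module_coalgebra"
    and M :: "('h, 'm) module_comodule"
  assumes "hopf_algebra H"
    and "invertible_antipode H"
    and "module_coalgebra H C"
    and "SAYD_module H C M"
  shows "cocyclic_isomorphic (CM H C M) (CH H C M)"
proof -
  interpret sayd H C M
    using assms by (simp add: sayd_def hopf_module_coalgebra_def)
  show ?thesis
    unfolding cocyclic_isomorphic_def using cocyclic_iso_comparison by blast
qed

end
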